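(* Let $G$ be a locally compact second countable group, $\mu$ a Borel probability measure on $G$, $E$ a Banach space with a separable predual $E_*$, and $\pi$ a representation of $G$ in $E$ which is the adjoint of a strongly continuous representation $\pi_*$ of $G$ by isometries in $E_*$. If $\mathcal{H}_{\mu\pi}\neq\{0\}$, then there exists a projection $K$, of norm $1$, of $E$ onto $\mathcal{H}_{\mu\pi}$, which commutes with every weakly* continuous linear operator $T:E\to E$ commuting with $\pi$. If $E$ is a $W^*$-algebra and $\pi(g)\in\operatorname{Aut}(E)$ for every $g\in G$, then $K$ can be chosen completely positive.
   Context: $\langle x_*,x\rangle$ is the duality between $E_*$ and $E=(E_* )^*$; $\pi(g)=[\pi_*(g^{-1})]^*$. $\pi(\mu)$ is the bounded operator on $E$ with $\langle x_*,\pi(\mu)x\rangle=\int_G\langle x_*,\pi(g)x\rangle\,\mu(dg)$ for all $x_*\in E_*$, $x\in E$, and $\mathcal{H}_{\mu\pi}=\{x\in E:\pi(\mu)x=x\}$. $T$ commutes with $\pi$ if $T\pi(g)=\pi(g)T$ for every $g\in G$. $\operatorname{Aut}(E)$ is the group of *-automorphisms of $E$. *)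

theory Defs
  imports "HOL-Probability.Probability"
begin

text \<open>
  Scalar multiplications are explicit parameters over a scalar field \<open>'k\<close>, so that real and
  complex Banach spaces are treated together. The sort \<open>{real_normed_field, euclidean_space}\<close>
  contains the types of real and of complex numbers, and up to isomorphism nothing else.
\<close>

locale normed_space_over = vector_space scale
  for scale :: "'k::real_normed_field \<Rightarrow> 'v::real_normed_vector \<Rightarrow> 'v" +
  assumes scale_of_real: "scale (of_real r) x = r *\<^sub>R x"
    and norm_scale: "norm (scale c x) = norm c * norm x"

definition bounded_functional :: "('k::real_normed_field \<Rightarrow> 'p::real_normed_vector \<Rightarrow> 'p) \<Rightarrow> ('p \<Rightarrow> 'k) \<Rightarrow> bool"
  where "bounded_functional scaleP f \<longleftrightarrow> Vector_Spaces.linear scaleP (*) f \<and> bounded_linear f"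

definition bounded_operator :: "('k::real_normed_field \<Rightarrow> 'e::real_normed_vector \<Rightarrow> 'e) \<Rightarrow> ('e \<Rightarrow> 'e) \<Rightarrow> bool"
  where "bounded_operator scaleE T \<longleftrightarrow> Vector_Spaces.linear scaleE scaleE T \<and> bounded_linear T"

text \<open>
  \<open>'e\<close> is identified with the Banach dual of \<open>'p\<close> by the duality \<open>pairing p x\<close>: the map
  \<open>x \<mapsto> pairing _ x\<close> is a linear isometry of \<open>'e\<close> onto the space of bounded functionals on \<open>'p\<close>
  with the operator norm.
\<close>

locale banach_predual =
  predual: normed_space_over scaleP + dual: normed_space_over scaleE
  for scaleP :: "'k::{real_normed_field,euclidean_space} \<Rightarrow> 'p::banach \<Rightarrow> 'p"
    and scaleE :: "'k \<Rightarrow> 'e::banach \<Rightarrow> 'e" +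
  fixes pairing :: "'p \<Rightarrow> 'e \<Rightarrow> 'k"
  assumes pairing_functional: "bounded_functional scaleP (\<lambda>p. pairing p x)"
    and pairing_linear: "Vector_Spaces.linear scaleE (*) (\<lambda>x. pairing p x)"
    and pairing_isometry: "norm x = onorm (\<lambda>p. pairing p x)"
    and pairing_surj: "bounded_functional scaleP f \<Longrightarrow> \<exists>x. \<forall>p. pairing p x = f p"

definition weak_star_topology :: "('p \<Rightarrow> 'e \<Rightarrow> 'k::topological_space) \<Rightarrow> 'e topology"
  where "weak_star_topology pairing = pullback_topology UNIV (\<lambda>x p. pairing p x) euclidean"

definition weak_star_continuous :: "('p \<Rightarrow> 'e \<Rightarrow> 'k::topological_space) \<Rightarrow> ('e \<Rightarrow> 'e) \<Rightarrow> bool"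
  where "weak_star_continuous pairing T \<longleftrightarrow>
    continuous_map (weak_star_topology pairing) (weak_star_topology pairing) T"

text \<open>
  The group is written additively, as the library's topological groups are; the class
  \<open>group_add\<close> does not assume commutativity.
\<close>

locale strongly_continuous_isometric_rep = normed_space_over scaleP
  for scaleP :: "'k::{real_normed_field,euclidean_space} \<Rightarrow> 'p::banach \<Rightarrow> 'p" +
  fixes rep :: "'g::topological_group_add \<Rightarrow> 'p \<Rightarrow> 'p"
  assumes rep_linear: "Vector_Spaces.linear scaleP scaleP (rep g)"
    and rep_isometry: "norm (rep g p) = norm p"
    and rep_zero: "rep 0 = id"
    and rep_add: "rep (g + h) = rep g \<circ> rep h"
    and rep_continuous: "continuous_on UNIV (\<lambda>g. rep g p)"

definition adjoint_operator :: "('p \<Rightarrow> 'e \<Rightarrow> 'k) \<Rightarrow> ('p \<Rightarrow> 'p) \<Rightarrow> 'e \<Rightarrow> 'e"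
  where "adjoint_operator pairing S x = (THE y. \<forall>p. pairing p y = pairing (S p) x)"

definition adjoint_rep :: "('p \<Rightarrow> 'e \<Rightarrow> 'k) \<Rightarrow> ('g::uminus \<Rightarrow> 'p \<Rightarrow> 'p) \<Rightarrow> 'g \<Rightarrow> 'e \<Rightarrow> 'e"
  where "adjoint_rep pairing rep g = adjoint_operator pairing (rep (- g))"

definition averaged_operator ::
    "('p \<Rightarrow> 'e \<Rightarrow> 'k::{banach,second_countable_topology}) \<Rightarrow> ('g \<Rightarrow> 'e \<Rightarrow> 'e) \<Rightarrow> 'g measure \<Rightarrow> 'e \<Rightarrow> 'e"
  where "averaged_operator pairing \<pi> \<mu> x =
    (THE y. \<forall>p. pairing p y = (\<integral>g. pairing p (\<pi> g x) \<partial>\<mu>))"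

definition harmonic_elements ::
    "('p \<Rightarrow> 'e \<Rightarrow> 'k::{banach,second_countable_topology}) \<Rightarrow> ('g \<Rightarrow> 'e \<Rightarrow> 'e) \<Rightarrow> 'g measure \<Rightarrow> 'e set"
  where "harmonic_elements pairing \<pi> \<mu> = {x. averaged_operator pairing \<pi> \<mu> x = x}"

definition norm_one_projection_onto ::
    "('k::real_normed_field \<Rightarrow> 'e::real_normed_vector \<Rightarrow> 'e) \<Rightarrow> 'e set \<Rightarrow> ('e \<Rightarrow> 'e) \<Rightarrow> bool"
  where "norm_one_projection_onto scaleE H K \<longleftrightarrow>
    bounded_operator scaleE K \<and> K \<circ> K = K \<and> range K = H \<and> onorm K = 1"

definition commutes_with_rep :: "('g \<Rightarrow> 'e \<Rightarrow> 'e) \<Rightarrow> ('e \<Rightarrow> 'e) \<Rightarrow> bool"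
  where "commutes_with_rep \<pi> T \<longleftrightarrow> (\<forall>g. T \<circ> \<pi> g = \<pi> g \<circ> T)"

locale cstar_algebra = normed_space_over scaleE
  for scaleE :: "complex \<Rightarrow> 'e::banach \<Rightarrow> 'e" +
  fixes mul :: "'e \<Rightarrow> 'e \<Rightarrow> 'e" and star :: "'e \<Rightarrow> 'e"
  assumes mult_assoc: "mul (mul x y) z = mul x (mul y z)"
    and mult_linear_left: "Vector_Spaces.linear scaleE scaleE (\<lambda>x. mul x y)"
    and mult_linear_right: "Vector_Spaces.linear scaleE scaleE (\<lambda>y. mul x y)"
    and norm_mult_le: "norm (mul x y) \<le> norm x * norm y"
    and star_add: "star (x + y) = star x + star y"
    and star_scale: "star (scaleE c x) = scaleE (cnj c) (star x)"
    and star_mult: "star (mul x y) = mul (star y) (star x)"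
    and star_star: "star (star x) = x"
    and cstar_identity: "norm (mul (star x) x) = (norm x)\<^sup>2"

text \<open>
  A W*-algebra is a C*-algebra which is a dual Banach space; that it has a unit is a theorem.
\<close>

locale wstar_algebra = banach_predual scaleP scaleE pairing + cstar_algebra scaleE mul star
  for scaleP :: "complex \<Rightarrow> 'p::banach \<Rightarrow> 'p"
    and scaleE :: "complex \<Rightarrow> 'e::banach \<Rightarrow> 'e"
    and pairing :: "'p \<Rightarrow> 'e \<Rightarrow> complex"
    and mul :: "'e \<Rightarrow> 'e \<Rightarrow> 'e" and star :: "'e \<Rightarrow> 'e"

definition star_automorphisms ::
    "(complex \<Rightarrow> 'e::ab_group_add \<Rightarrow> 'e) \<Rightarrow> ('e \<Rightarrow> 'e \<Rightarrow> 'e) \<Rightarrow> ('e \<Rightarrow> 'e) \<Rightarrow> ('e \<Rightarrow> 'e) set"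
  where "star_automorphisms scaleE mul star =
    {\<alpha>. bij \<alpha> \<and> Vector_Spaces.linear scaleE scaleE \<alpha> \<and>
        (\<forall>x y. \<alpha> (mul x y) = mul (\<alpha> x) (\<alpha> y)) \<and> (\<forall>x. \<alpha> (star x) = star (\<alpha> x))}"

text \<open>
  An \<open>n \<times> n\<close> matrix over the algebra is a function of which only the entries with indices
  below \<open>n\<close> are used. The positive elements of the matrix algebra are those of the
  form \<open>b\<^sup>* b\<close>.
\<close>

definition positive_matrix ::
    "('e::comm_monoid_add \<Rightarrow> 'e \<Rightarrow> 'e) \<Rightarrow> ('e \<Rightarrow> 'e) \<Rightarrow> nat \<Rightarrow> (nat \<Rightarrow> nat \<Rightarrow> 'e) \<Rightarrow> bool"
  where "positive_matrix mul star n a \<longleftrightarrow>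
    (\<exists>b. \<forall>i<n. \<forall>j<n. a i j = (\<Sum>k<n. mul (star (b k i)) (b k j)))"

definition completely_positive ::
    "('e::comm_monoid_add \<Rightarrow> 'e \<Rightarrow> 'e) \<Rightarrow> ('e \<Rightarrow> 'e) \<Rightarrow> ('e \<Rightarrow> 'e) \<Rightarrow> bool"
  where "completely_positive mul star K \<longleftrightarrow>
    (\<forall>n a. positive_matrix mul star n a \<longrightarrow> positive_matrix mul star n (\<lambda>i j. K (a i j)))"

end

theory Submission
  imports Defs "HOL-Library.Function_Algebras"
begin

text \<open>
  Write \<open>P = \<pi>(\<mu>)\<close>, so that the harmonic elements are the fixed points of the contraction \<open>P\<close>. The
  projection is a mean ergodic limit: \<open>K x\<close> is the weak* limit, along a suitable filter, of the
  means of \<open>x, P x, \<dots>, P\<^sup>n x\<close>. Such limits exist because bounded sets are relatively weak*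
  compact (\<open>universal_filter\<close>). Every fixed point of \<open>P\<close> is fixed by \<open>K\<close>; conversely
  \<open>P (K x) = K x\<close> as soon as \<open>P\<close> passes through bounded weak* limits. This holds because the orbits
  of the predual representation are norm continuous, so that the integral defining \<open>P\<close> is
  approximated, uniformly in \<open>x\<close>, by convex combinations of finitely many operators \<open>\<pi>(g)\<close>
  (\<open>average_approx\<close>). A weak* continuous \<open>T\<close> has an adjoint on the predual
  (\<open>weak_star_adjoint_exists\<close>); if it commutes with all \<open>\<pi>(g)\<close> then it commutes with the weak*
  integral \<open>P\<close>, with the means, and with their limit.

  For a W*-algebra, automorphisms are completely positive, and \<open>K\<close> arises from them by convex
  combinations, compositions and bounded weak* limits. All of the work lies in showing that such
  limits preserve complete positivity (\<open>completely_positive_limit\<close>). Positivity of a matrix \<open>a\<close> has to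
  be tested by the elements \<open>\<Sum>\<^sub>i\<^sub>j star (\<xi> i) \<odot> a i j \<odot> \<xi> j\<close>, so one needs that multiplication by fixed
  elements passes through bounded weak* limits. This is a form of Sakai's theorem on the separate
  weak* continuity of the product, and the predual is only given as a Banach space.

  The argument uses no spectral theory and no states. Positivity is expressed by norms: a
  self-adjoint \<open>a\<close> is positive if \<open>norm (t - a) \<le> t\<close> for some \<open>t\<close>. The bridge between norm and order
  is \<open>sa_norm_le\<close>: for self-adjoint \<open>a\<close>, one of \<open>1 + a\<close>, \<open>1 - a\<close> has norm at least \<open>1 + norm a\<close>.
  Together with square roots from the binomial series this gives the order theory of
  C*-algebras, including the positivity of \<open>star x \<odot> x\<close>. Since norm balls are weak* closed, the
  positive cone is closed under bounded weak* limits, and weak* compactness provides a unit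
  (\<open>unit_exists\<close>).

  Let \<open>R b\<close> denote the weak* limit of a bounded net \<open>b\<close>. For a unitary \<open>u\<close>, put
  \<open>\<Delta> \<Phi> b = \<Phi> (u b) - u \<Phi> b\<close>; the goal is \<open>\<Delta> R = 0\<close>. Limits do not increase norms, and this yields
  \<open>norm (x x (R b))\<^sup>2 \<le> (norm x)\<^sup>2 norm (x (R b)) sup (norm (x b))\<close> for normal \<open>x\<close>: if \<open>x\<close> is small on
  the net, it is small on its limit. Applied to powers of \<open>u - \<omega>\<close> and to nets \<open>F\<^sub>\<omega> b\<close>, where \<open>F\<^sub>\<omega>\<close>
  is a Fejer kernel in \<open>u\<close> concentrated at the point \<open>\<omega>\<close> of the circle, it bounds \<open>\<Delta>\<^sup>4 R (F\<^sub>\<omega> b)\<close>, and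
  averaging over \<open>\<omega>\<close> gives \<open>\<Delta>\<^sup>4 R = 0\<close>. Hence \<open>u\<^sup>-\<^sup>m R (u\<^sup>m b)\<close> is a polynomial in \<open>m\<close>; being bounded,
  it is constant, so \<open>\<Delta> R = 0\<close>. Unitaries span the algebra.

  Finally, a matrix whose quadratic form is positive is of the form \<open>star b \<odot> b\<close>, again by the
  binomial series (\<open>psd_imp_positive_matrix\<close>).
\<close>

section \<open>Weak* limits in a dual Banach space\<close>

text \<open>
  By induction on \<open>J\<close>: if \<open>f j\<close> does not already vanish on the common kernel of the others, that
  kernel contains a vector \<open>x0\<close> with \<open>f j x0 = 1\<close>, and \<open>\<psi> - \<psi> x0 * f j\<close> vanishes on it.
\<close>

lemma functional_in_span_of_kernels:
  fixes f :: "'j \<Rightarrow> 'e::ab_group_add \<Rightarrow> 'k::field"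
  assumes "finite J" and vs: "vector_space s"
    and "\<And>j. j \<in> J \<Longrightarrow> Vector_Spaces.linear s (*) (f j)" and "Vector_Spaces.linear s (*) \<psi>"
    and "\<And>x. (\<forall>j\<in>J. f j x = 0) \<Longrightarrow> \<psi> x = 0"
  shows "\<exists>c. \<forall>x. \<psi> x = (\<Sum>j\<in>J. c j * f j x)"
  using assms(1,3-)
proof (induction J arbitrary: \<psi> rule: finite_induct)
  case empty
  thus ?case by simp
next
  case (insert j J)
  have lin: "f i (x + y) = f i x + f i y" "f i (s a x) = a * f i x" if "i \<in> insert j J" for i x y a
    using insert.prems(1)[OF that] by (auto simp: Vector_Spaces.linear_iff)
  have lin\<psi>: "\<psi> (x + y) = \<psi> x + \<psi> y" "\<psi> (s a x) = a * \<psi> x" for x y a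
    using insert.prems(2) by (auto simp: Vector_Spaces.linear_iff)
  show ?case
  proof (cases "\<forall>x. (\<forall>i\<in>J. f i x = 0) \<longrightarrow> f j x = 0")
    case True
    have "\<exists>c. \<forall>x. \<psi> x = (\<Sum>j\<in>J. c j * f j x)"
      using True insert.prems by (intro insert.IH) auto
    then obtain c where c: "\<And>x. \<psi> x = (\<Sum>j\<in>J. c j * f j x)" by blast
    have "(\<Sum>i\<in>insert j J. (c(j := 0)) i * f i x) = (\<Sum>i\<in>J. c i * f i x)" for x
      using insert.hyps by (simp cong: sum.cong) (auto intro!: sum.cong)
    thus ?thesis using c by (intro exI[of _ "c(j := 0)"]) simp
  next
    case False
    then obtain x1 where x1: "\<forall>i\<in>J. f i x1 = 0" "f j x1 \<noteq> 0" by blast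
    define x0 where "x0 = s (1 / f j x1) x1"
    have x0: "\<forall>i\<in>J. f i x0 = 0" "f j x0 = 1" using x1 lin by (auto simp: x0_def)
    define \<psi>' where "\<psi>' x = \<psi> x - \<psi> x0 * f j x" for x
    have "\<exists>c. \<forall>x. \<psi>' x = (\<Sum>j\<in>J. c j * f j x)"
    proof (rule insert.IH)
      show "Vector_Spaces.linear s (*) (f i)" if "i \<in> J" for i using insert.prems(1) that by blast
      show "Vector_Spaces.linear s (*) \<psi>'"
        using insert.prems(2) lin[of j] lin\<psi> by (simp add: Vector_Spaces.linear_iff \<psi>'_def algebra_simps)
      show "\<psi>' x = 0" if x: "\<forall>i\<in>J. f i x = 0" for x
      proof -
        have "\<forall>i\<in>insert j J. f i (x + s (- f j x) x0) = 0" using x x0 lin by auto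
        hence "\<psi> (x + s (- f j x) x0) = 0" by (rule insert.prems(3))
        thus ?thesis by (simp add: \<psi>'_def lin\<psi>)
      qed
    qed
    then obtain c where c: "\<And>x. \<psi>' x = (\<Sum>j\<in>J. c j * f j x)" by blast
    have "\<psi> x = (\<Sum>i\<in>insert j J. (c(j := \<psi> x0)) i * f i x)" for x
    proof -
      have "(\<Sum>i\<in>J. (c(j := \<psi> x0)) i * f i x) = (\<Sum>i\<in>J. c i * f i x)"
        using insert.hyps by (intro sum.cong) auto
      thus ?thesis using insert.hyps c[of x] by (simp add: \<psi>'_def algebra_simps)
    qed
    thus ?thesis by blast
  qed
qed

context banach_predual
begin

lemma pairing_bounded_linear: "bounded_linear (\<lambda>p. pairing p x)"
  using pairing_functional by (simp add: bounded_functional_def)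

lemma pairing_add_left: "pairing (p + q) x = pairing p x + pairing q x"
  and pairing_scale_left: "pairing (scaleP c p) x = c * pairing p x"
  using pairing_functional[where x=x] by (auto simp: bounded_functional_def Vector_Spaces.linear_iff)

lemma pairing_add_right: "pairing p (x + y) = pairing p x + pairing p y"
  and pairing_scale_right: "pairing p (scaleE c x) = c * pairing p x"
  using pairing_linear[where p=p] by (auto simp: Vector_Spaces.linear_iff)

lemma pairing_zero_right [simp]: "pairing p 0 = 0"
  using pairing_scale_right[of p 0 0] by simp

lemma pairing_zero_left [simp]: "pairing 0 x = 0"
  using pairing_scale_left[of 0 0 x] by simp

lemma pairing_minus_right: "pairing p (- x) = - pairing p x"
  using pairing_add_right[of p x "- x"] by (simp add: eq_neg_iff_add_eq_0 add.commute)

lemma pairing_diff_right: "pairing p (x - y) = pairing p x - pairing p y"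
  using pairing_add_right[of p x "- y"] by (simp add: pairing_minus_right)

lemma pairing_diff_left: "pairing (p - q) x = pairing p x - pairing q x"
  using pairing_bounded_linear[of x] by (rule bounded_linear.linear[THEN linear_diff])

lemma pairing_sum_left: "pairing (\<Sum>i\<in>A. f i) x = (\<Sum>i\<in>A. pairing (f i) x)"
  by (induction A rule: infinite_finite_induct) (simp_all add: pairing_add_left)

lemma pairing_sum_right: "pairing p (\<Sum>i\<in>A. f i) = (\<Sum>i\<in>A. pairing p (f i))"
  by (induction A rule: infinite_finite_induct) (simp_all add: pairing_add_right)

lemma pairing_scaleR_right: "pairing p (r *\<^sub>R x) = of_real r * pairing p x"
  by (simp flip: dual.scale_of_real add: pairing_scale_right)

lemma norm_pairing_le: "norm (pairing p x) \<le> norm p * norm x"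
  using onorm[OF pairing_bounded_linear[of x], of p] by (simp add: pairing_isometry mult.commute)

lemma norm_leI: "0 \<le> B \<Longrightarrow> (\<And>p. norm (pairing p x) \<le> B * norm p) \<Longrightarrow> norm x \<le> B"
  unfolding pairing_isometry by (rule onorm_bound)

lemma pairing_eqI: assumes "\<And>p. pairing p x = pairing p y" shows "x = y"
proof -
  have "norm (x - y) \<le> 0" by (rule norm_leI) (simp_all add: pairing_diff_right assms)
  thus ?thesis by simp
qed

text \<open>
  Elements of the dual space are constructed by prescribing their pairings.
\<close>

lemma represent_functional:
  assumes add: "\<And>p q. f (p + q) = f p + f q" and sc: "\<And>c p. f (scaleP c p) = c * f p"
    and bd: "\<And>p. norm (f p) \<le> B * norm p" and B: "B \<ge> 0"
  shows "\<exists>x. (\<forall>p. pairing p x = f p) \<and> norm x \<le> B"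
proof -
  have "f (r *\<^sub>R p) = r *\<^sub>R f p" for r p
    using sc[of "of_real r" p] by (simp add: predual.scale_of_real scaleR_conv_of_real)
  hence "bounded_linear f" using add bd by (intro bounded_linear_intro[where K = B]) (auto simp: mult.commute)
  moreover have "Vector_Spaces.linear scaleP (*) f"
    unfolding Vector_Spaces.linear_iff using add sc predual.vector_space_axioms
    by (auto simp: vector_space_def algebra_simps)
  ultimately obtain x where x: "\<forall>p. pairing p x = f p"
    using pairing_surj[where f=f] by (auto simp: bounded_functional_def)
  have "norm x \<le> B" using B bd x by (intro norm_leI) auto
  thus ?thesis using x by blast
qed

text \<open>
  Weak* convergence is taken along filters, so that cluster points of nets become limits.
\<close>

definition wlim :: "('i \<Rightarrow> 'e) \<Rightarrow> 'e \<Rightarrow> 'i filter \<Rightarrow> bool"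
  where "wlim b r G \<longleftrightarrow> (\<forall>p. ((\<lambda>i. pairing p (b i)) \<longlongrightarrow> pairing p r) G)"

lemma wlimD: "wlim b r G \<Longrightarrow> ((\<lambda>i. pairing p (b i)) \<longlongrightarrow> pairing p r) G"
  by (simp add: wlim_def)

lemma wlim_unique: assumes "wlim b r G" "wlim b s G" "G \<noteq> bot" shows "r = s"
  using assms by (intro pairing_eqI) (auto simp: wlim_def intro: tendsto_unique)

lemma wlim_mono: "wlim b r F \<Longrightarrow> G \<le> F \<Longrightarrow> wlim b r G"
  unfolding wlim_def by (blast intro: tendsto_mono)

lemma wlim_const: "wlim (\<lambda>_. x) x G"
  by (simp add: wlim_def)

lemma wlim_add: "wlim b r G \<Longrightarrow> wlim c s G \<Longrightarrow> wlim (\<lambda>i. b i + c i) (r + s) G"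
  unfolding wlim_def by (simp add: pairing_add_right tendsto_add)

lemma wlim_scale: "wlim b r G \<Longrightarrow> wlim (\<lambda>i. scaleE c (b i)) (scaleE c r) G"
  unfolding wlim_def by (auto simp: pairing_scale_right intro!: tendsto_mult)

lemma wlim_diff: "wlim b r G \<Longrightarrow> wlim c s G \<Longrightarrow> wlim (\<lambda>i. b i - c i) (r - s) G"
  unfolding wlim_def by (simp add: pairing_diff_right tendsto_diff)

lemma wlim_sum: "(\<And>j. j \<in> A \<Longrightarrow> wlim (b j) (r j) G) \<Longrightarrow> wlim (\<lambda>i. \<Sum>j\<in>A. b j i) (\<Sum>j\<in>A. r j) G"
  unfolding wlim_def by (auto simp: pairing_sum_right intro!: tendsto_sum)

lemma wlim_norm_le:
  assumes "wlim b r G" "G \<noteq> bot" "eventually (\<lambda>i. norm (b i) \<le> B) G" shows "norm r \<le> B"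
proof (rule norm_leI)
  obtain i where "norm (b i) \<le> B" using eventually_happens[OF assms(3)] assms(2) by blast
  thus "B \<ge> 0" using norm_ge_zero[of "b i"] by linarith
  fix p
  show "norm (pairing p r) \<le> B * norm p"
  proof (rule tendsto_upperbound)
    show "((\<lambda>i. norm (pairing p (b i))) \<longlongrightarrow> norm (pairing p r)) G"
      by (intro tendsto_norm wlimD assms)
    show "\<forall>\<^sub>F i in G. norm (pairing p (b i)) \<le> B * norm p"
      using assms(3)
    proof eventually_elim
      case (elim i)
      have "norm (pairing p (b i)) \<le> norm p * norm (b i)" by (rule norm_pairing_le)
      also have "\<dots> \<le> norm p * B" using elim by (rule mult_left_mono) simp
      finally show ?case by (simp add: mult.commute)
    qed
  qed (rule assms)
qed

text \<open>
  Tychonoff's theorem, applied to the product, over all bounded nets \<open>b\<close> and all \<open>p\<close>, of the balls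
  containing the values \<open>pairing p (b i)\<close>. The filter \<open>G\<close> plays the role of an ultrafilter.
\<close>

lemma universal_filter:
  assumes F: "(F :: 'i filter) \<noteq> bot"
  obtains G where "G \<le> F" "G \<noteq> bot"
    "\<And>b B. (\<And>i. norm (b i) \<le> B) \<Longrightarrow> \<exists>r. wlim b r G"
proof -
  define bd where "bd b \<longleftrightarrow> (\<exists>B. \<forall>i. norm (b i) \<le> B)" for b :: "'i \<Rightarrow> 'e"
  define Bd where "Bd b = (SOME B. \<forall>i. norm (b i) \<le> B)" for b :: "'i \<Rightarrow> 'e"
  have Bd: "norm (b i) \<le> Bd b" if "bd b" for b i
    using someI_ex[OF that[unfolded bd_def]] by (auto simp: Bd_def)
  \<comment> \<open>Unbounded nets get the constant value \<open>0\<close>, so that all coordinates lie in compact sets.\<close>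
  define \<Phi> where "\<Phi> i = (\<lambda>(b, p). if bd b then pairing p (b i) else 0)" for i :: 'i
  define S where "S = (\<lambda>(b::'i \<Rightarrow> 'e, p::'p). if bd b then cball (0::'k) (Bd b * norm p) else {0})"
  have "compact (PiE UNIV S)"
  proof -
    have "compactin (product_topology (\<lambda>_. euclidean) UNIV) (PiE UNIV S)"
      unfolding compactin_PiE by (auto simp: S_def)
    thus ?thesis by (simp add: euclidean_product_topology)
  qed
  moreover have "filtermap \<Phi> F \<noteq> bot" using F by (simp add: filtermap_bot_iff)
  moreover have "\<Phi> i \<in> PiE UNIV S" for i
  proof -
    have "norm (pairing p (b i)) \<le> Bd b * norm p" if "bd b" for b p
      using norm_pairing_le[of p "b i"] mult_left_mono[OF Bd[OF that, of i] norm_ge_zero[of p]]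
      by (simp add: mult.commute)
    thus ?thesis by (auto simp: \<Phi>_def S_def)
  qed
  hence "eventually (\<lambda>y. y \<in> PiE UNIV S) (filtermap \<Phi> F)" by (simp add: eventually_filtermap)
  ultimately obtain L where L: "inf (nhds L) (filtermap \<Phi> F) \<noteq> bot"
    unfolding compact_filter by blast
  define G where "G = inf F (filtercomap \<Phi> (nhds L))"
  have GF: "G \<le> F" by (simp add: G_def)
  have Gbot: "G \<noteq> bot"
  proof
    assume "G = bot"
    hence "eventually (\<lambda>_. False) G" by simp
    then obtain P Q where PQ: "eventually P F" "eventually Q (filtercomap \<Phi> (nhds L))" "\<And>i. P i \<Longrightarrow> Q i \<Longrightarrow> False"
      unfolding G_def eventually_inf by blast
    obtain Q' where Q': "eventually Q' (nhds L)" "\<And>i. Q' (\<Phi> i) \<Longrightarrow> Q i"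
      using PQ(2) unfolding eventually_filtercomap by blast
    have "eventually (\<lambda>y. \<exists>i. P i \<and> y = \<Phi> i) (filtermap \<Phi> F)"
      unfolding eventually_filtermap using PQ(1) by (rule eventually_mono) blast
    with Q'(1) have "eventually (\<lambda>_. False) (inf (nhds L) (filtermap \<Phi> F))"
      unfolding eventually_inf using Q'(2) PQ(3) by blast
    thus False using L by (simp add: trivial_limit_def)
  qed
  have coord: "((\<lambda>i. \<Phi> i z) \<longlongrightarrow> L z) G" for z
  proof -
    have this_lim: "filterlim \<Phi> (nhds L) G" unfolding G_def filterlim_iff_le_filtercomap by simp
    show ?thesis
    proof (rule topological_tendstoI)
      fix S assume S: "open S" "L z \<in> S"
      have "continuous_on UNIV (\<lambda>y :: (('i \<Rightarrow> 'e) \<times> 'p) \<Rightarrow> 'k. y z)"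
        by (rule continuous_on_product_coordinates)
      hence "open ((\<lambda>y :: (('i \<Rightarrow> 'e) \<times> 'p) \<Rightarrow> 'k. y z) -` S)" using S(1) by (rule open_vimage[rotated])
      from topological_tendstoD[OF this_lim this] S(2)
      show "\<forall>\<^sub>F i in G. \<Phi> i z \<in> S" by simp
    qed
  qed
  have "\<exists>r. wlim b r G" if B: "\<And>i. norm (b i) \<le> B" for b B
  proof -
    have bdb: "bd b" using B by (auto simp: bd_def)
    have lim: "((\<lambda>i. pairing p (b i)) \<longlongrightarrow> L (b, p)) G" for p
      using coord[of "(b, p)"] bdb by (simp add: \<Phi>_def)
    have B0: "B \<ge> 0" using B norm_ge_zero order_trans by blast
    have "\<exists>x. (\<forall>p. pairing p x = L (b, p)) \<and> norm x \<le> B"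
    proof (rule represent_functional[OF _ _ _ B0])
      show "L (b, p + q) = L (b, p) + L (b, q)" for p q
        using lim[of "p + q"] tendsto_add[OF lim[of p] lim[of q]] tendsto_unique[OF Gbot]
        by (auto simp: pairing_add_left)
      show "L (b, scaleP c p) = c * L (b, p)" for c p
        using lim[of "scaleP c p"] tendsto_mult[OF tendsto_const[of c] lim[of p]] tendsto_unique[OF Gbot]
        by (auto simp: pairing_scale_left)
      show "norm (L (b, p)) \<le> B * norm p" for p
      proof (rule tendsto_upperbound[OF tendsto_norm[OF lim] _ Gbot])
        have "norm (pairing p (b i)) \<le> B * norm p" for i
          using norm_pairing_le[of p "b i"] mult_left_mono[OF B[of i] norm_ge_zero[of p]]
          by (simp add: mult.commute)
        thus "\<forall>\<^sub>F i in G. norm (pairing p (b i)) \<le> B * norm p" by simp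
      qed
    qed
    then obtain x where "\<And>p. pairing p x = L (b, p)" by blast
    thus ?thesis using lim by (auto simp: wlim_def intro!: exI[of _ x])
  qed
  thus ?thesis using that GF Gbot by blast
qed

text \<open>
  Weak* continuity of \<open>T\<close> at \<open>0\<close> provides finitely many predual elements such that
  \<open>pairing p (T x)\<close> is small when \<open>x\<close> pairs to small values with them. By homogeneity it vanishes on
  their common kernel, hence it is a linear combination of these pairings.
\<close>

lemma weak_star_adjoint_exists:
  assumes lin: "Vector_Spaces.linear scaleE scaleE T" and cont: "weak_star_continuous pairing T"
  shows "\<exists>q. \<forall>x. pairing p (T x) = pairing q x"
proof -
  let ?j = "\<lambda>(x::'e) (p::'p). pairing p x"
  have Tlin: "T (x + y) = T x + T y" "T (scaleE c x) = scaleE c (T x)" for x y c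
    using lin by (auto simp: Vector_Spaces.linear_iff)
  have T0: "T 0 = 0" using Tlin(2)[of 0 0] by simp
  define W where "W = {x. norm (pairing p x) < 1}"
  have "openin (weak_star_topology pairing) W"
  proof -
    have "continuous_on UNIV (\<lambda>f::'p \<Rightarrow> 'k. f p)" by (rule continuous_on_product_coordinates)
    hence "open ((\<lambda>f::'p \<Rightarrow> 'k. f p) -` ball 0 1)" by (rule open_vimage[rotated]) simp
    moreover have "W = ?j -` ((\<lambda>f::'p \<Rightarrow> 'k. f p) -` ball 0 1) \<inter> UNIV" by (auto simp: W_def)
    ultimately show ?thesis unfolding weak_star_topology_def openin_pullback_topology by auto
  qed
  hence "openin (weak_star_topology pairing) {x \<in> topspace (weak_star_topology pairing). T x \<in> W}"
    using cont unfolding weak_star_continuous_def continuous_map_def by blast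
  moreover have "topspace (weak_star_topology pairing) = UNIV"
    by (auto simp: weak_star_topology_def topspace_pullback_topology)
  ultimately obtain U where U: "open U" "{x. T x \<in> W} = ?j -` U"
    unfolding weak_star_topology_def openin_pullback_topology by auto
  have "0 \<in> {x. T x \<in> W}" using T0 by (simp add: W_def)
  hence jU: "?j 0 \<in> U" unfolding U(2) by simp
  have "openin (product_topology (\<lambda>_. euclidean) UNIV) U"
    unfolding euclidean_product_topology using U(1) by (simp only: open_openin)
  from product_topology_open_contains_basis[OF this jU]
  obtain X where X: "?j 0 \<in> PiE UNIV X" "finite {i. X i \<noteq> topspace (euclidean :: 'k topology)}" "PiE UNIV X \<subseteq> U"
    by metis
  define J where "J = {i. X i \<noteq> UNIV}"
  have J: "finite J" using X(2) by (simp add: J_def)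
  have "\<exists>c. \<forall>x. pairing p (T x) = (\<Sum>j\<in>J. c j * pairing j x)"
  proof (rule functional_in_span_of_kernels[OF J dual.vector_space_axioms])
    show "Vector_Spaces.linear scaleE (*) (pairing j)" for j using pairing_linear[where p=j] by simp
    show "Vector_Spaces.linear scaleE (*) (\<lambda>x. pairing p (T x))"
      using pairing_linear[where p=p] Tlin unfolding Vector_Spaces.linear_iff by auto
    fix x assume x: "\<forall>j\<in>J. pairing j x = 0"
    have small: "norm (c * pairing p (T x)) < 1" for c
    proof -
      have "?j (scaleE c x) i \<in> X i" for i
      proof (cases "i \<in> J")
        case True
        thus ?thesis using x X(1) by (auto simp: pairing_scale_right PiE_iff)
      qed (simp add: J_def)
      hence "?j (scaleE c x) \<in> U" using X(3) by (auto simp: PiE_iff)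
      hence "T (scaleE c x) \<in> W" using U(2) by blast
      thus ?thesis by (simp add: W_def Tlin pairing_scale_right)
    qed
    show "pairing p (T x) = 0"
      using small[of "inverse (pairing p (T x))"] by (cases "pairing p (T x) = 0") auto
  qed
  then obtain c where "\<And>x. pairing p (T x) = (\<Sum>j\<in>J. c j * pairing j x)" by blast
  hence "\<forall>x. pairing p (T x) = pairing (\<Sum>j\<in>J. scaleP (c j) j) x"
    by (simp add: pairing_sum_left pairing_scale_left)
  thus ?thesis by blast
qed

end

section \<open>The mean ergodic projection of the averaged operator\<close>

locale averaged_representation =
  banach_predual scaleP scaleE pairing +
  strongly_continuous_isometric_rep scaleP rep +
  prob_space \<mu>
  for scaleP :: "'k::{real_normed_field,euclidean_space} \<Rightarrow> 'p::banach \<Rightarrow> 'p"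
    and scaleE :: "'k \<Rightarrow> 'e::banach \<Rightarrow> 'e"
    and pairing :: "'p \<Rightarrow> 'e \<Rightarrow> 'k"
    and rep :: "'g::{topological_group_add,t2_space,second_countable_topology} \<Rightarrow> 'p \<Rightarrow> 'p"
    and \<mu> :: "'g measure" +
  assumes sets_\<mu>: "sets \<mu> = sets borel"
begin

abbreviation "\<pi> \<equiv> adjoint_rep pairing rep"
abbreviation "P \<equiv> averaged_operator pairing \<pi> \<mu>"

lemma space_\<mu>: "space \<mu> = UNIV"
  using sets_eq_imp_space_eq[OF sets_\<mu>] by simp

lemma rep_additive: "rep g (p + q) = rep g p + rep g q"
  and rep_scale: "rep g (scaleP c p) = scaleP c (rep g p)"
  using rep_linear[of g] by (auto simp: Vector_Spaces.linear_iff)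

lemma pairing_adjoint: "pairing p (\<pi> g x) = pairing (rep (- g) p) x"
proof -
  have "\<exists>y. (\<forall>p. pairing p y = pairing (rep (- g) p) x) \<and> norm y \<le> norm x"
    by (rule represent_functional)
       (auto simp: rep_additive rep_scale pairing_add_left pairing_scale_left
         intro: order_trans[OF norm_pairing_le] simp: rep_isometry mult.commute)
  then obtain y where y: "\<forall>p. pairing p y = pairing (rep (- g) p) x" by blast
  have "\<pi> g x = y" unfolding adjoint_rep_def adjoint_operator_def
    using y by (intro the_equality) (auto intro: pairing_eqI)
  thus ?thesis using y by simp
qed

lemma norm_adjoint_le: "norm (\<pi> g x) \<le> norm x"
proof (rule norm_leI)
  show "norm (pairing p (\<pi> g x)) \<le> norm x * norm p" for p
    using norm_pairing_le[of "rep (- g) p" x] by (simp add: pairing_adjoint rep_isometry mult.commute)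
qed simp

lemma continuous_orbit: "continuous_on UNIV (\<lambda>g. rep (- g) p)"
  by (rule continuous_on_compose2[OF rep_continuous[of p], where f = uminus])
     (auto intro: continuous_intros)

lemma integrable_pairing: "integrable \<mu> (\<lambda>g. pairing (rep (- g) p) x)"
proof (rule integrable_const_bound)
  have "continuous_on UNIV (\<lambda>g. pairing (rep (- g) p) x)"
    by (rule bounded_linear.continuous_on[OF pairing_bounded_linear continuous_orbit])
  hence "(\<lambda>g. pairing (rep (- g) p) x) \<in> borel_measurable borel"
    by (rule borel_measurable_continuous_onI)
  thus "(\<lambda>g. pairing (rep (- g) p) x) \<in> borel_measurable \<mu>"
    using measurable_cong_sets[OF sets_\<mu> refl] by blast
  show "AE g in \<mu>. norm (pairing (rep (- g) p) x) \<le> norm p * norm x"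
    using norm_pairing_le rep_isometry by (metis (mono_tags, lifting) AE_I2)
qed

lemma pairing_average: "pairing p (P x) = (\<integral>g. pairing (rep (- g) p) x \<partial>\<mu>)"
  and norm_average_le: "norm (P x) \<le> norm x"
proof -
  have "\<exists>y. (\<forall>p. pairing p y = (\<integral>g. pairing (rep (- g) p) x \<partial>\<mu>)) \<and> norm y \<le> norm x"
  proof (rule represent_functional)
    show "(\<integral>g. pairing (rep (- g) (p + q)) x \<partial>\<mu>)
        = (\<integral>g. pairing (rep (- g) p) x \<partial>\<mu>) + (\<integral>g. pairing (rep (- g) q) x \<partial>\<mu>)" for p q
      by (simp add: rep_additive pairing_add_left integrable_pairing)
    show "(\<integral>g. pairing (rep (- g) (scaleP c p)) x \<partial>\<mu>) = c * (\<integral>g. pairing (rep (- g) p) x \<partial>\<mu>)" for c p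
      by (simp add: rep_scale pairing_scale_left integrable_pairing)
    show "norm (\<integral>g. pairing (rep (- g) p) x \<partial>\<mu>) \<le> norm x * norm p" for p
    proof -
      have "norm (\<integral>g. pairing (rep (- g) p) x \<partial>\<mu>) \<le> (\<integral>g. norm (pairing (rep (- g) p) x) \<partial>\<mu>)"
        by (rule integral_norm_bound)
      also have "\<dots> \<le> norm x * norm p"
      proof (rule integral_le_const)
        show "integrable \<mu> (\<lambda>g. norm (pairing (rep (- g) p) x))"
          by (intro integrable_norm integrable_pairing)
        show "AE g in \<mu>. norm (pairing (rep (- g) p) x) \<le> norm x * norm p"
          using norm_pairing_le[of "rep (- _) p" x] by (simp add: rep_isometry mult.commute)
      qed
      finally show ?thesis .
    qed
  qed simp
  then obtain y where y: "\<forall>p. pairing p y = (\<integral>g. pairing (rep (- g) p) x \<partial>\<mu>)" "norm y \<le> norm x"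
    by blast
  have "P x = y" unfolding averaged_operator_def pairing_adjoint
    using y(1) by (intro the_equality) (auto intro: pairing_eqI)
  thus "pairing p (P x) = (\<integral>g. pairing (rep (- g) p) x \<partial>\<mu>)" "norm (P x) \<le> norm x" using y by auto
qed

lemma average_add: "P (x + y) = P x + P y"
  by (rule pairing_eqI) (simp add: pairing_average pairing_add_right integrable_pairing)

lemma average_scale: "P (scaleE c x) = scaleE c (P x)"
  by (rule pairing_eqI) (simp add: pairing_average pairing_scale_right integrable_pairing)

lemma average_zero [simp]: "P 0 = 0"
  using average_scale[of 0 0] by simp

text \<open>
  The maps \<open>g \<mapsto> rep (- g) p\<close> are norm continuous, so the group is covered by open sets on which they
  vary by less than \<open>\<delta>\<close>, for all \<open>p \<in> Q\<close> at once. By the Lindelof property countably many of these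
  sets suffice, and finitely many carry all but \<open>\<delta>\<close> of the mass. Because the error is estimated on
  the side of the predual, it is uniform in \<open>x\<close>.
\<close>

lemma average_approx:
  assumes Q: "finite Q" and \<epsilon>: "\<epsilon> > 0"
  shows "\<exists>(n::nat) (w :: nat \<Rightarrow> real) (h :: nat \<Rightarrow> 'g). (\<forall>k. w k \<ge> 0) \<and> (\<Sum>k<n. w k) = 1 \<and>
    (\<forall>p\<in>Q. \<forall>x. norm (pairing p (P x - (\<Sum>k<n. w k *\<^sub>R \<pi> (h k) x))) \<le> \<epsilon> * norm x)"
proof -
  define m where "m = Max (insert 0 (norm ` Q))"
  have m: "m \<ge> 0" "\<And>p. p \<in> Q \<Longrightarrow> norm p \<le> m" using Q by (auto simp: m_def)
  \<comment> \<open>On the exceptional set, of mass at most \<open>\<delta>\<close>, the integrand is off by at most \<open>2 * m * norm x\<close>.\<close>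
  define \<delta> where "\<delta> = \<epsilon> / (1 + 2 * m)"
  have "\<delta> * (1 + 2 * m) = \<epsilon>" using m(1) by (simp add: \<delta>_def)
  hence \<delta>2: "\<delta> + 2 * m * \<delta> = \<epsilon>" by (simp add: algebra_simps)
  have \<delta>: "\<delta> > 0" using \<epsilon> m(1) by (simp add: \<delta>_def)
  define U where "U h = (\<Inter>p\<in>Q. {g. norm (rep (- g) p - rep (- h) p) < \<delta>})" for h
  have openU: "open (U h)" for h
    unfolding U_def using Q
    by (intro open_INT ballI open_Collect_less continuous_intros continuous_orbit)
  have selfU: "h \<in> U h" for h using \<delta> by (simp add: U_def)
  obtain F' where F': "F' \<subseteq> range U" "countable F'" "\<Union>F' = \<Union>(range U)"
    using Lindelof[of "range U"] openU by blast
  have cover: "\<Union>F' = UNIV" using F'(3) selfU by blast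
  hence ne: "F' \<noteq> {}" by auto
  have "\<exists>h. from_nat_into F' k = U h" for k
    using from_nat_into[OF ne, of k] F'(1) by blast
  then obtain h where h: "\<And>k. from_nat_into F' k = U (h k)" by metis
  have UNh: "(\<Union>k. U (h k)) = UNIV"
    using range_from_nat_into[OF ne F'(2)] cover unfolding h by auto
  define A where "A n = (\<Union>k<n. U (h k))" for n
  have A: "A n \<in> sets \<mu>" for n using openU by (auto simp: A_def sets_\<mu>)
  have "(\<lambda>n. measure \<mu> (A n)) \<longlonglongrightarrow> measure \<mu> (\<Union>n. A n)"
  proof (rule finite_Lim_measure_incseq)
    show "range A \<subseteq> sets \<mu>" using A by auto
    show "incseq A" unfolding incseq_def A_def by (intro allI impI UN_mono) auto
  qed
  moreover have "(\<Union>n. A n) = UNIV" using UNh by (fastforce simp: A_def)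
  ultimately have "(\<lambda>n. measure \<mu> (A n)) \<longlonglongrightarrow> 1" using prob_space space_\<mu> by simp
  hence "eventually (\<lambda>n. measure \<mu> (A n) > 1 - \<delta>) sequentially"
    by (rule order_tendstoD(1)) (use \<delta> in simp)
  then obtain n where n: "measure \<mu> (A n) > 1 - \<delta>" by (auto simp: eventually_sequentially)
  \<comment> \<open>A measurable partition: \<open>B k\<close> for \<open>k < n\<close> is part of \<open>U (h k)\<close>, and \<open>B n\<close> is what remains.\<close>
  define B where "B k = (if k < n then U (h k) - A k else - A n)" for k
  have B: "B k \<in> sets \<mu>" for k
    using openU[of "h k"] A[of k] A[of n] by (auto simp: B_def sets_\<mu>)
  have uniq: "\<exists>!k. k < Suc n \<and> g \<in> B k" for g
  proof (cases "g \<in> A n")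
    case True
    then obtain k where k: "k < n" "g \<in> U (h k)" by (auto simp: A_def)
    define l where "l = (LEAST k. g \<in> U (h k))"
    have l1: "g \<in> U (h l)" unfolding l_def using k(2) by (rule LeastI)
    have "l \<le> k" unfolding l_def using k(2) by (rule Least_le)
    hence l2: "l < n" using k(1) by simp
    have l3: "g \<notin> U (h j)" if "j < l" for j
      using that unfolding l_def by (rule not_less_Least)
    show ?thesis
    proof (rule ex1I[of _ l])
      show "l < Suc n \<and> g \<in> B l" using l1 l2 l3 by (auto simp: B_def A_def)
      fix j assume j: "j < Suc n \<and> g \<in> B j"
      hence "j < n" using True by (auto simp: B_def less_Suc_eq split: if_splits)
      hence "g \<in> U (h j)" "g \<notin> A j" using j by (auto simp: B_def)
      moreover have "l < j \<Longrightarrow> g \<in> A j" using l1 by (auto simp: A_def)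
      ultimately show "j = l" using l3[of j] by (metis nat_neq_iff)
    qed
  next
    case False
    hence "g \<in> B n" by (simp add: B_def)
    moreover have "g \<notin> B k" if "k < n" for k using False that by (auto simp: B_def A_def)
    ultimately show ?thesis by (intro ex1I[of _ n]) (auto simp: less_Suc_eq)
  qed
  have split: "(\<Sum>k<Suc n. indicator (B k) g *\<^sub>R f k) = f (THE k. k < Suc n \<and> g \<in> B k)"
    for g and f :: "nat \<Rightarrow> 'z::real_vector"
  proof -
    obtain l where l: "l < Suc n" "g \<in> B l" "\<And>k. k < Suc n \<Longrightarrow> g \<in> B k \<Longrightarrow> k = l" using uniq[of g] by blast
    have "(THE k. k < Suc n \<and> g \<in> B k) = l" by (rule the_equality) (use l in blast)+
    moreover have "(\<Sum>k<Suc n. indicator (B k) g *\<^sub>R f k) = (\<Sum>k<Suc n. if k = l then f k else 0)"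
    proof (rule sum.cong[OF refl])
      fix k assume "k \<in> {..<Suc n}"
      hence "g \<in> B k \<longleftrightarrow> k = l" using l(2) l(3)[of k] by blast
      thus "indicator (B k) g *\<^sub>R f k = (if k = l then f k else 0)" by (simp only: indicator_def) simp
    qed
    ultimately show ?thesis using l(1) by simp
  qed
  define w where "w k = measure \<mu> (B k)" for k
  have int_ind: "integrable \<mu> (\<lambda>g. indicator (B k) g *\<^sub>R (c::'k))" for k c
    using B[of k] by (intro integrable_scaleR_left integrable_real_indicator) (auto simp: emeasure_eq_measure)
  have int_ind': "integrable \<mu> (\<lambda>g. indicator (B k) g :: real)" for k
    using B[of k] by (intro integrable_real_indicator) (auto simp: emeasure_eq_measure)
  have val_ind: "(\<integral>g. indicator (B k) g *\<^sub>R (c::'k) \<partial>\<mu>) = w k *\<^sub>R c" for k c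
  proof -
    have "(\<integral>g. indicator (B k) g *\<^sub>R c \<partial>\<mu>) = (\<integral>g. indicator (B k) g \<partial>\<mu>) *\<^sub>R c"
      by (rule integral_scaleR_left) (rule int_ind')
    thus ?thesis using B[of k] by (simp add: w_def space_\<mu>)
  qed
  have wsum: "(\<Sum>k<Suc n. w k) = 1"
  proof -
    have "(\<Sum>k<Suc n. w k) = (\<Sum>k<Suc n. \<integral>g. indicator (B k) g \<partial>\<mu>)"
      using B by (simp add: w_def space_\<mu>)
    also have "\<dots> = (\<integral>g. (\<Sum>k<Suc n. indicator (B k) g :: real) \<partial>\<mu>)"
      by (rule Bochner_Integration.integral_sum[symmetric]) (rule int_ind')
    also have "\<dots> = (\<integral>g. 1 \<partial>\<mu>)"
      using split[of _ "\<lambda>_. 1::real"] by (intro Bochner_Integration.integral_cong) auto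
    finally show ?thesis by (simp add: prob_space)
  qed
  have small: "w n \<le> \<delta>"
  proof -
    have "w n = 1 - measure \<mu> (A n)"
      using prob_compl[OF A[of n]] by (simp add: w_def B_def space_\<mu> Compl_eq_Diff_UNIV)
    thus ?thesis using n by simp
  qed
  have main: "norm (pairing p (P x - (\<Sum>k<Suc n. w k *\<^sub>R \<pi> (h k) x))) \<le> \<epsilon> * norm x" if p: "p \<in> Q" for p x
  proof -
    let ?f = "\<lambda>g. pairing (rep (- g) p) x"
    let ?s = "\<lambda>g. \<Sum>k<Suc n. indicator (B k) g *\<^sub>R pairing (rep (- h k) p) x"
    let ?b = "\<lambda>g. \<delta> * norm x + indicator (B n) g *\<^sub>R (2 * m * norm x)"
    have ints: "integrable \<mu> ?s" by (intro Bochner_Integration.integrable_sum int_ind)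
    have intb: "integrable \<mu> ?b"
      by (intro Bochner_Integration.integrable_add integrable_const integrable_scaleR_left int_ind')
    have "pairing p (P x - (\<Sum>k<Suc n. w k *\<^sub>R \<pi> (h k) x)) = (\<integral>g. ?f g \<partial>\<mu>) - (\<Sum>k<Suc n. w k *\<^sub>R pairing (rep (- h k) p) x)"
      by (simp only: pairing_diff_right pairing_sum_right pairing_scaleR_right pairing_average pairing_adjoint scaleR_conv_of_real)
    also have "(\<Sum>k<Suc n. w k *\<^sub>R pairing (rep (- h k) p) x) = (\<integral>g. ?s g \<partial>\<mu>)"
      by (subst Bochner_Integration.integral_sum[OF int_ind]) (simp only: val_ind)
    also have "(\<integral>g. ?f g \<partial>\<mu>) - (\<integral>g. ?s g \<partial>\<mu>) = (\<integral>g. ?f g - ?s g \<partial>\<mu>)"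
      by (rule Bochner_Integration.integral_diff[symmetric, OF integrable_pairing ints])
    also have "norm \<dots> \<le> (\<integral>g. norm (?f g - ?s g) \<partial>\<mu>)" by (rule integral_norm_bound)
    also have "\<dots> \<le> (\<integral>g. ?b g \<partial>\<mu>)"
    proof (rule integral_mono)
      show "integrable \<mu> (\<lambda>g. norm (?f g - ?s g))"
        by (intro integrable_norm Bochner_Integration.integrable_diff integrable_pairing ints)
      show "integrable \<mu> ?b" by (rule intb)
      fix g
      obtain l where l: "l < Suc n" "g \<in> B l" "(THE k. k < Suc n \<and> g \<in> B k) = l"
        using theI'[OF uniq[of g]] by blast
      have "?f g - ?s g = pairing (rep (- g) p - rep (- h l) p) x"
        unfolding split l(3) by (simp add: pairing_diff_left)
      also have "norm \<dots> \<le> norm (rep (- g) p - rep (- h l) p) * norm x" by (rule norm_pairing_le)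
      also have "\<dots> \<le> ?b g"
      proof (cases "l < n")
        case True
        hence "g \<in> U (h l)" using l by (simp add: B_def)
        hence "norm (rep (- g) p - rep (- h l) p) \<le> \<delta>" using p by (auto simp: U_def less_imp_le)
        hence "norm (rep (- g) p - rep (- h l) p) * norm x \<le> \<delta> * norm x" by (rule mult_right_mono) simp
        thus ?thesis using m(1) by (simp add: add_increasing2)
      next
        case False
        hence "l = n" using l by simp
        have "norm (rep (- g) p - rep (- h l) p) \<le> norm (rep (- g) p) + norm (rep (- h l) p)"
          by (rule norm_triangle_ineq4)
        also have "\<dots> \<le> 2 * m" using m(2)[OF p] by (simp add: rep_isometry)
        finally have "norm (rep (- g) p - rep (- h l) p) * norm x \<le> 2 * m * norm x" by (rule mult_right_mono) simp
        thus ?thesis using l \<open>l = n\<close> \<delta> by (simp add: add_increasing)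
      qed
      finally show "norm (?f g - ?s g) \<le> ?b g" .
    qed
    also have "\<dots> = \<delta> * norm x + w n * (2 * m * norm x)"
    proof -
      have "(\<integral>g. ?b g \<partial>\<mu>) = (\<integral>g. \<delta> * norm x \<partial>\<mu>) + (\<integral>g. indicator (B n) g *\<^sub>R (2 * m * norm x) \<partial>\<mu>)"
        by (rule Bochner_Integration.integral_add) (intro integrable_const integrable_scaleR_left int_ind')+
      also have "(\<integral>g. indicator (B n) g *\<^sub>R (2 * m * norm x) \<partial>\<mu>) = (\<integral>g. indicator (B n) g \<partial>\<mu>) *\<^sub>R (2 * m * norm x)"
        by (rule integral_scaleR_left) (rule int_ind')
      finally show ?thesis using B[of n] by (simp add: w_def space_\<mu> prob_space[unfolded space_\<mu>])
    qed
    also have "\<dots> \<le> \<delta> * norm x + \<delta> * (2 * m * norm x)"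
      using small m(1) by (intro add_left_mono mult_right_mono) auto
    also have "\<dots> = (\<delta> + 2 * m * \<delta>) * norm x" by (simp add: algebra_simps)
    finally show ?thesis by (simp only: \<delta>2)
  qed
  have "w k \<ge> 0" for k by (simp add: w_def)
  thus ?thesis using wsum main by blast
qed

lemma wlim_adjoint: assumes "wlim b r F" shows "wlim (\<lambda>i. \<pi> g (b i)) (\<pi> g r) F"
  using assms by (simp add: wlim_def pairing_adjoint)

lemma wlim_scaleR: "wlim b r G \<Longrightarrow> wlim (\<lambda>i. c *\<^sub>R b i) (c *\<^sub>R r) G"
  using wlim_scale[of b r G "of_real c"] by (simp add: dual.scale_of_real)

text \<open>
  The uniformity in \<open>x\<close> of the approximation replaces the exchange of limit and integral, for which
  dominated convergence would not be available along a filter.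
\<close>

lemma wlim_average:
  assumes lim: "wlim b r F" and bd: "\<And>i. norm (b i) \<le> B"
  shows "wlim (\<lambda>i. P (b i)) (P r) F"
  unfolding wlim_def
proof
  fix p
  define M where "M = B + norm r + 1"
  have B0: "B \<ge> 0" using bd norm_ge_zero order_trans by blast
  have M: "M > 0" using B0 by (simp add: M_def add_nonneg_pos)
  show "((\<lambda>i. pairing p (P (b i))) \<longlongrightarrow> pairing p (P r)) F"
  proof (rule tendstoI)
    fix \<epsilon> :: real assume \<epsilon>: "\<epsilon> > 0"
    \<comment> \<open>Both \<open>b i\<close> and \<open>r\<close> contribute an approximation error; together they use up half of \<open>\<epsilon>\<close>.\<close>
    define \<eta> where "\<eta> = \<epsilon> / (2 * M)"
    have \<eta>: "\<eta> > 0" "\<eta> * M = \<epsilon> / 2" using \<epsilon> M by (auto simp: \<eta>_def)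
    from average_approx[OF finite.insertI[OF finite.emptyI, of p] \<eta>(1)]
    obtain n :: nat and w :: "nat \<Rightarrow> real" and h :: "nat \<Rightarrow> 'g"
      where "\<forall>q\<in>{p}. \<forall>x. norm (pairing q (P x - (\<Sum>k<n. w k *\<^sub>R \<pi> (h k) x))) \<le> \<eta> * norm x"
      by blast
    hence w: "norm (pairing p (P x - (\<Sum>k<n. w k *\<^sub>R \<pi> (h k) x))) \<le> \<eta> * norm x" for x by simp
    let ?C = "\<lambda>x. \<Sum>k<n. w k *\<^sub>R \<pi> (h k) x"
    have "wlim (\<lambda>i. ?C (b i)) (?C r) F" by (intro wlim_sum wlim_scaleR wlim_adjoint lim)
    hence "eventually (\<lambda>i. dist (pairing p (?C (b i))) (pairing p (?C r)) < \<epsilon> / 2) F"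
      using \<epsilon> by (intro tendstoD wlimD) auto
    thus "eventually (\<lambda>i. dist (pairing p (P (b i))) (pairing p (P r)) < \<epsilon>) F"
    proof eventually_elim
      case (elim i)
      have eq: "pairing p (P (b i)) - pairing p (P r) = pairing p (P (b i) - ?C (b i)) - pairing p (P r - ?C r)
          + (pairing p (?C (b i)) - pairing p (?C r))" by (simp only: pairing_diff_right) simp
      have "norm (pairing p (P (b i)) - pairing p (P r)) \<le> (norm (pairing p (P (b i) - ?C (b i))) + norm (pairing p (P r - ?C r)))
          + norm (pairing p (?C (b i)) - pairing p (?C r))"
        unfolding eq by (rule order_trans[OF norm_triangle_ineq], rule add_right_mono, rule norm_triangle_ineq4)
      also have "\<dots> < (\<eta> * norm (b i) + \<eta> * norm r) + \<epsilon> / 2"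
        by (rule add_le_less_mono[OF add_mono[OF w w] elim[unfolded dist_norm]])
      also have "\<dots> \<le> \<eta> * M + \<epsilon> / 2"
      proof -
        have "\<eta> * (norm (b i) + norm r) \<le> \<eta> * M"
          using bd[of i] \<eta>(1) by (intro mult_left_mono) (auto simp: M_def)
        thus ?thesis by (simp add: distrib_left)
      qed
      also have "\<eta> * M + \<epsilon> / 2 = \<epsilon>" by (simp only: \<eta>(2))
      finally show ?case by (simp only: dist_norm)
    qed
  qed
qed

text \<open>
  The index is shifted by one so that there is no empty mean.
\<close>

definition cesaro :: "nat \<Rightarrow> 'e \<Rightarrow> 'e"
  where "cesaro n x = (1 / real (Suc n)) *\<^sub>R (\<Sum>k<Suc n. (P ^^ k) x)"

lemma average_sum: "P (\<Sum>k\<in>A. f k) = (\<Sum>k\<in>A. P (f k))"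
  by (induction A rule: infinite_finite_induct) (simp_all add: average_add)

lemma average_scaleR: "P (r *\<^sub>R x) = r *\<^sub>R P x"
  using average_scale[of "of_real r" x] by (simp add: dual.scale_of_real)

lemma funpow_average_add: "(P ^^ k) (x + y) = (P ^^ k) x + (P ^^ k) y"
  by (induction k) (simp_all add: average_add)

lemma funpow_average_scale: "(P ^^ k) (scaleE c x) = scaleE c ((P ^^ k) x)"
  by (induction k) (simp_all add: average_scale)

lemma norm_funpow_average_le: "norm ((P ^^ k) x) \<le> norm x"
  by (induction k) (auto intro: order_trans[OF norm_average_le])

lemma scaleE_scaleR: "scaleE c (r *\<^sub>R x) = r *\<^sub>R scaleE c x"
  by (simp flip: dual.scale_of_real add: mult.commute)

lemma cesaro_add: "cesaro n (x + y) = cesaro n x + cesaro n y"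
  by (simp only: cesaro_def funpow_average_add sum.distrib scaleR_add_right)

lemma cesaro_scale: "cesaro n (scaleE c x) = scaleE c (cesaro n x)"
  by (simp only: cesaro_def funpow_average_scale scaleE_scaleR dual.scale_sum_right)

lemma norm_cesaro_le: "norm (cesaro n x) \<le> norm x"
proof -
  have "norm (\<Sum>k<Suc n. (P ^^ k) x) \<le> (\<Sum>k<Suc n. norm x)"
    by (rule order_trans[OF norm_sum sum_mono]) (rule norm_funpow_average_le)
  also have "\<dots> = real (Suc n) * norm x" by simp
  finally show ?thesis by (simp add: cesaro_def divide_simps mult.commute)
qed

lemma average_cesaro: "P (cesaro n x) = cesaro n x + (1 / real (Suc n)) *\<^sub>R ((P ^^ Suc n) x - x)"
proof -
  have "P (\<Sum>k<Suc n. (P ^^ k) x) = (\<Sum>k<Suc n. (P ^^ Suc k) x)"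
    by (simp only: average_sum funpow.simps o_apply)
  also have "\<dots> = (\<Sum>k<Suc n. (P ^^ k) x) + ((P ^^ Suc n) x - x)"
  proof -
    have "x + (\<Sum>k<Suc n. (P ^^ Suc k) x) = (\<Sum>k<Suc (Suc n). (P ^^ k) x)"
      by (subst (2) sum.lessThan_Suc_shift) simp
    also have "\<dots> = (\<Sum>k<Suc n. (P ^^ k) x) + (P ^^ Suc n) x" by (rule sum.lessThan_Suc)
    finally show ?thesis by (simp add: algebra_simps)
  qed
  finally show ?thesis by (simp only: cesaro_def average_scaleR scaleR_add_right)
qed

lemma cesaro_fixed: assumes "P x = x" shows "cesaro n x = x"
proof -
  have "(P ^^ k) x = x" for k by (induction k) (simp_all add: assms)
  thus ?thesis by (simp add: cesaro_def scaleR_conv_of_real sum_constant_scaleR del: sum_constant)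
qed

text \<open>
  The means \<open>cesaro n x\<close> converge weak* along \<open>G\<close>, and \<open>P (cesaro n x) - cesaro n x\<close> tends to \<open>0\<close> in norm
  by telescoping; as \<open>P\<close> passes through bounded weak* limits, the limits are fixed by \<open>P\<close>. The filter
  is part of the conclusion because complete positivity is transported along it.
\<close>

theorem mean_ergodic_projection:
  assumes nontriv: "harmonic_elements pairing \<pi> \<mu> \<noteq> {0}"
  obtains K G where "G \<noteq> bot" "G \<le> sequentially" "\<And>x. wlim (\<lambda>n. cesaro n x) (K x) G"
    "norm_one_projection_onto scaleE (harmonic_elements pairing \<pi> \<mu>) K"
    "\<And>T. Vector_Spaces.linear scaleE scaleE T \<Longrightarrow> weak_star_continuous pairing T \<Longrightarrow>
       commutes_with_rep \<pi> T \<Longrightarrow> K \<circ> T = T \<circ> K"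
proof -
  obtain G where G: "G \<le> sequentially" "G \<noteq> bot"
    and all: "\<And>(b :: nat \<Rightarrow> 'e) B. (\<And>i. norm (b i) \<le> B) \<Longrightarrow> \<exists>r. wlim b r G"
    using universal_filter[OF sequentially_bot] by blast
  have "\<exists>r. wlim (\<lambda>n. cesaro n x) r G" for x by (rule all[OF norm_cesaro_le])
  then obtain K where K: "\<And>x. wlim (\<lambda>n. cesaro n x) (K x) G" by metis
  have KI: "K x = r" if "wlim (\<lambda>n. cesaro n x) r G" for x r
    by (rule wlim_unique[OF K that G(2)])
  have fixed: "K x = x" if "P x = x" for x
    by (rule KI) (simp add: cesaro_fixed[OF that] wlim_const)
  have PK: "P (K x) = K x" for x
  proof -
    have "wlim (\<lambda>n. P (cesaro n x)) (P (K x)) G" by (rule wlim_average[OF K norm_cesaro_le])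
    moreover have "wlim (\<lambda>n. P (cesaro n x)) (K x + 0) G"
      unfolding average_cesaro
    proof (rule wlim_add[OF K])
      have "((\<lambda>n. pairing p ((1 / real (Suc n)) *\<^sub>R ((P ^^ Suc n) x - x))) \<longlongrightarrow> 0) sequentially" for p
      proof (rule tendsto_norm_zero_cancel, rule tendsto_sandwich[where f = "\<lambda>_. 0" and h = "\<lambda>n. (2 * norm p * norm x) * (1 / real (Suc n))"])
        show "\<forall>\<^sub>F n in sequentially. norm (pairing p ((1 / real (Suc n)) *\<^sub>R ((P ^^ Suc n) x - x)))
            \<le> (2 * norm p * norm x) * (1 / real (Suc n))"
        proof (rule always_eventually, rule allI)
          fix n
          have "norm ((P ^^ Suc n) x - x) \<le> 2 * norm x"
            using norm_triangle_ineq4[of "(P ^^ Suc n) x" x] norm_funpow_average_le[of "Suc n" x] by linarith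
          hence "norm (pairing p ((P ^^ Suc n) x - x)) \<le> norm p * (2 * norm x)"
            by (rule order_trans[OF norm_pairing_le mult_left_mono]) simp
          hence "1 / real (Suc n) * norm (pairing p ((P ^^ Suc n) x - x)) \<le> 1 / real (Suc n) * (norm p * (2 * norm x))"
            by (rule mult_left_mono) simp
          moreover have "norm (pairing p ((1 / real (Suc n)) *\<^sub>R ((P ^^ Suc n) x - x)))
              = 1 / real (Suc n) * norm (pairing p ((P ^^ Suc n) x - x))"
            by (simp only: pairing_scaleR_right norm_mult norm_of_real) simp
          ultimately show "norm (pairing p ((1 / real (Suc n)) *\<^sub>R ((P ^^ Suc n) x - x)))
              \<le> (2 * norm p * norm x) * (1 / real (Suc n))" by (simp only: mult_ac)
        qed
        show "(\<lambda>n. (2 * norm p * norm x) * (1 / real (Suc n))) \<longlonglongrightarrow> 0"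
          using tendsto_mult_right_zero[OF LIMSEQ_inverse_real_of_nat] by (simp only: inverse_eq_divide)
      qed auto
      hence "wlim (\<lambda>n. (1 / real (Suc n)) *\<^sub>R ((P ^^ Suc n) x - x)) 0 sequentially"
        unfolding wlim_def by simp
      thus "wlim (\<lambda>n. (1 / real (Suc n)) *\<^sub>R ((P ^^ Suc n) x - x)) 0 G"
        using G(1) by (rule wlim_mono)
    qed
    ultimately show ?thesis using wlim_unique[OF _ _ G(2)] by fastforce
  qed
  have Kadd: "K (x + y) = K x + K y" for x y
    by (rule KI) (simp only: cesaro_add wlim_add K)
  have Kscale: "K (scaleE c x) = scaleE c (K x)" for c x
    by (rule KI) (simp only: cesaro_scale wlim_scale K)
  have Knorm: "norm (K x) \<le> 1 * norm x" for x
    using wlim_norm_le[OF K G(2)] norm_cesaro_le by simp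
  have linK: "Vector_Spaces.linear scaleE scaleE K"
    unfolding Vector_Spaces.linear_iff using Kadd Kscale dual.vector_space_axioms by blast
  have "K (r *\<^sub>R x) = r *\<^sub>R K x" for r x
    using Kscale[of "of_real r" x] by (simp add: dual.scale_of_real)
  hence blK: "bounded_linear K"
    using Kadd Knorm by (intro bounded_linear_intro[where K = 1]) auto
  have rangeK: "range K = harmonic_elements pairing \<pi> \<mu>"
    using PK fixed by (auto simp: harmonic_elements_def image_iff) metis
  have "onorm K = 1"
  proof (rule antisym)
    show "onorm K \<le> 1" by (rule onorm_bound[OF zero_le_one Knorm])
    have "0 \<in> harmonic_elements pairing \<pi> \<mu>" by (simp add: harmonic_elements_def)
    then obtain x where x: "P x = x" "x \<noteq> 0" using nontriv by (auto simp: harmonic_elements_def)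
    have "norm (K x) \<le> onorm K * norm x" by (rule onorm[OF blK])
    thus "1 \<le> onorm K" using x by (simp add: fixed)
  qed
  hence proj: "norm_one_projection_onto scaleE (harmonic_elements pairing \<pi> \<mu>) K"
    unfolding norm_one_projection_onto_def bounded_operator_def
    using linK blK rangeK by (auto simp: fun_eq_iff fixed PK)
  have comm: "K \<circ> T = T \<circ> K"
    if T: "Vector_Spaces.linear scaleE scaleE T" "weak_star_continuous pairing T" "commutes_with_rep \<pi> T" for T
  proof -
    have Tlin: "T (x + y) = T x + T y" "T (scaleE c x) = scaleE c (T x)" for x y c
      using T(1) by (auto simp: Vector_Spaces.linear_iff)
    have Tsum: "T (\<Sum>k\<in>A. f k) = (\<Sum>k\<in>A. T (f k))" for f :: "nat \<Rightarrow> 'e" and A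
      using Tlin(2)[of 0 0] by (induction A rule: infinite_finite_induct) (simp_all add: Tlin)
    have TscaleR: "T (r *\<^sub>R x) = r *\<^sub>R T x" for r x
      using Tlin(2)[of "of_real r" x] by (simp add: dual.scale_of_real)
    have T\<pi>: "T (\<pi> g x) = \<pi> g (T x)" for g x
      using T(3) by (auto simp: commutes_with_rep_def fun_eq_iff)
    have "\<forall>p. \<exists>q. \<forall>x. pairing p (T x) = pairing q x"
      using weak_star_adjoint_exists[OF T(1,2)] by blast
    then obtain S where S: "\<And>p x. pairing p (T x) = pairing (S p) x" by metis
    have TP: "T (P x) = P (T x)" for x
    proof (rule pairing_eqI)
      fix p
      have "pairing p (T (P x)) = (\<integral>g. pairing (S p) (\<pi> g x) \<partial>\<mu>)"
        by (simp add: S pairing_average pairing_adjoint)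
      also have "\<dots> = (\<integral>g. pairing p (\<pi> g (T x)) \<partial>\<mu>)" by (simp only: S[symmetric] T\<pi>)
      also have "\<dots> = pairing p (P (T x))" by (simp add: pairing_average pairing_adjoint)
      finally show "pairing p (T (P x)) = pairing p (P (T x))" .
    qed
    have "T ((P ^^ k) x) = (P ^^ k) (T x)" for k x
      by (induction k) (simp_all add: TP)
    hence TA: "T (cesaro n x) = cesaro n (T x)" for n x
      by (simp only: cesaro_def TscaleR Tsum)
    have "wlim (\<lambda>n. cesaro n (T x)) (T (K x)) G" for x
      using K[of x] unfolding wlim_def TA[symmetric] S by blast
    thus ?thesis by (auto simp: fun_eq_iff intro: KI)
  qed
  show ?thesis using that[OF G(2,1) K proj comm] .
qed

end

section \<open>Square roots by the binomial series\<close>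

text \<open>
  The coefficient of \<open>t ^ Suc k\<close> in the power series of \<open>1 - sqrt (1 - t)\<close>. The index is shifted
  because the series will be evaluated in algebras without a unit.
\<close>

definition sqrt_coeff :: "nat \<Rightarrow> real"
  where "sqrt_coeff k = (-1) ^ k * (1/2 gchoose Suc k)"

lemma sqrt_coeff_0: "sqrt_coeff 0 = 1/2"
  by (simp add: sqrt_coeff_def)

lemma sum_sqrt_coeff: "(\<Sum>k<m. sqrt_coeff k) = 1 - (-1) ^ m * ((-1/2::real) gchoose m)"
proof (induction m)
  case (Suc m)
  have "((1/2::real) gchoose Suc m) = ((-1/2) gchoose m) + ((-1/2) gchoose Suc m)"
    using gbinomial_Suc_Suc[of "-1/2::real" m] by simp
  with Suc show ?case by (simp add: sqrt_coeff_def algebra_simps)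
qed simp

lemma alternating_gbinomial_nonneg: "(-1) ^ m * ((-1/2::real) gchoose m) \<ge> 0"
proof (induction m)
  case (Suc m)
  have "(-1/2) * ((-1/2::real) gchoose m) = real m * ((-1/2) gchoose m) + real (Suc m) * ((-1/2) gchoose Suc m)"
    by (rule gbinomial_mult_1)
  hence "real (Suc m) * ((-1/2::real) gchoose Suc m) = - (real m + 1/2) * ((-1/2) gchoose m)"
    by (simp add: algebra_simps)
  hence "((-1/2::real) gchoose Suc m) = - ((real m + 1/2) / real (Suc m)) * ((-1/2) gchoose m)"
    by (simp add: divide_simps) (simp add: algebra_simps)
  hence "(-1) ^ Suc m * ((-1/2::real) gchoose Suc m) =
      (-1) * (-1) ^ m * (- ((real m + 1/2) / real (Suc m)) * ((-1/2) gchoose m))"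
    by (simp only: power_Suc)
  also have "\<dots> = (real m + 1/2) / real (Suc m) * ((-1) ^ m * ((-1/2) gchoose m))"
    by (simp only: mult_minus_left mult_minus_right minus_minus mult_1_left mult.left_commute)
  finally have "(-1) ^ Suc m * ((-1/2::real) gchoose Suc m) =
      (real m + 1/2) / real (Suc m) * ((-1) ^ m * ((-1/2) gchoose m))" .
  thus ?case using Suc by simp
qed simp

lemma sqrt_coeff_nonneg: "sqrt_coeff m \<ge> 0"
proof -
  have "(-1/2) * ((-1/2::real) gchoose m) = real m * ((-1/2) gchoose m) + real (Suc m) * ((-1/2) gchoose Suc m)"
    by (rule gbinomial_mult_1)
  moreover have "((1/2::real) gchoose Suc m) = ((-1/2) gchoose m) + ((-1/2) gchoose Suc m)"
    using gbinomial_Suc_Suc[of "-1/2::real" m] by simp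
  ultimately have "real (Suc m) * ((1/2::real) gchoose Suc m) = 1/2 * ((-1/2) gchoose m)"
    by (simp add: algebra_simps)
  hence "sqrt_coeff m = 1/2 / real (Suc m) * ((-1) ^ m * ((-1/2) gchoose m))"
    by (simp add: sqrt_coeff_def divide_simps) (simp add: algebra_simps)
  thus ?thesis using alternating_gbinomial_nonneg[of m] by simp
qed

lemma summable_sqrt_coeff: "summable sqrt_coeff"
proof (rule bounded_imp_summable)
  fix n show "sum sqrt_coeff {..n} \<le> 1"
    using sum_sqrt_coeff[of "Suc n"] alternating_gbinomial_nonneg[of "Suc n"] by (simp add: lessThan_Suc_atMost)
qed (rule sqrt_coeff_nonneg)

text \<open>
  Compare the coefficients of \<open>t ^ (m + 2)\<close> in \<open>(sqrt (1 - t))\<^sup>2 = 1 - t\<close>, using Vandermonde's identity.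
\<close>

lemma sqrt_coeff_convolution:
  "(\<Sum>i\<le>m. sqrt_coeff i * sqrt_coeff (m - i)) = 2 * sqrt_coeff (Suc m)"
proof -
  let ?g = "\<lambda>k. (1/2::real) gchoose k"
  have "(\<Sum>k\<le>Suc (Suc m). ?g k * ?g (Suc (Suc m) - k)) = (1::real) gchoose Suc (Suc m)"
    using gbinomial_Vandermonde[of "1/2::real" "1/2" "Suc (Suc m)"] by (simp only: atLeast0AtMost) simp
  also have "\<dots> = 0"
    using binomial_gbinomial[of 1 "Suc (Suc m)", where 'a=real] by simp
  finally have "(\<Sum>k\<le>Suc (Suc m). ?g k * ?g (Suc (Suc m) - k)) = 0" .
  moreover have "(\<Sum>k\<le>Suc (Suc m). ?g k * ?g (Suc (Suc m) - k))
      = ?g (Suc (Suc m)) + (\<Sum>k\<le>m. ?g (Suc k) * ?g (Suc m - k)) + ?g (Suc (Suc m))"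
    by (subst sum.atMost_Suc_shift) (simp add: )
  moreover have "(\<Sum>k\<le>m. sqrt_coeff k * sqrt_coeff (m - k)) = (-1)^m * (\<Sum>k\<le>m. ?g (Suc k) * ?g (Suc m - k))"
    unfolding sum_distrib_left
  proof (rule sum.cong)
    fix k assume "k \<in> {..m}"
    hence *: "Suc m - k = Suc (m - k)" "m = k + (m - k)" by auto
    have "(-1::real)^m = (-1)^k * (-1)^(m-k)" by (subst *(2)) (simp add: power_add)
    thus "sqrt_coeff k * sqrt_coeff (m - k) = (- 1) ^ m * (?g (Suc k) * ?g (Suc m - k))"
      by (simp add: sqrt_coeff_def *(1))
  qed simp
  ultimately have "(\<Sum>k\<le>m. ?g (Suc k) * ?g (Suc m - k)) = - 2 * ?g (Suc (Suc m))"
    and "(\<Sum>k\<le>m. sqrt_coeff k * sqrt_coeff (m - k)) = (-1)^m * (\<Sum>k\<le>m. ?g (Suc k) * ?g (Suc m - k))"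
    by linarith+
  hence "(\<Sum>k\<le>m. sqrt_coeff k * sqrt_coeff (m - k)) = (-1)^m * (- 2 * ?g (Suc (Suc m)))"
    by (simp only:)
  thus ?thesis by (simp add: sqrt_coeff_def)
qed

text \<open>
  With \<open>s\<close> the sum, the convolution identity gives \<open>s\<^sup>2 = 2 (s - 1/2)\<close>, that is \<open>(s - 1)\<^sup>2 = 0\<close>.
\<close>

lemma suminf_sqrt_coeff: "suminf sqrt_coeff = 1"
proof -
  let ?s = "suminf sqrt_coeff"
  have abs: "summable (\<lambda>k. norm (sqrt_coeff k))"
    using summable_sqrt_coeff sqrt_coeff_nonneg by simp
  have "?s * ?s = (\<Sum>m. \<Sum>i\<le>m. sqrt_coeff i * sqrt_coeff (m - i))"
    by (rule Cauchy_product[OF abs abs])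
  also have "\<dots> = (\<Sum>m. 2 * sqrt_coeff (Suc m))"
    by (simp add: sqrt_coeff_convolution)
  also have "\<dots> = 2 * (\<Sum>m. sqrt_coeff (Suc m))"
    by (rule suminf_mult) (simp add: summable_Suc_iff summable_sqrt_coeff)
  also have "(\<Sum>m. sqrt_coeff (Suc m)) = ?s - 1/2"
    using suminf_split_head[OF summable_sqrt_coeff] by (simp add: sqrt_coeff_0)
  finally have "(?s - 1)\<^sup>2 = 0" by (simp add: power2_eq_square algebra_simps)
  thus ?thesis by simp
qed

text \<open>
  This covers a C*-algebra, its unitization, and the \<open>n \<times> n\<close> matrices over it, represented by
  functions of which only part of the values matter. Therefore the norm is a parameter and only a
  seminorm, and there need not be a unit.
\<close>

locale complete_seminormed_star_algebra = vector_space sc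
  for sc :: "complex \<Rightarrow> 'a::ab_group_add \<Rightarrow> 'a" +
  fixes mul :: "'a \<Rightarrow> 'a \<Rightarrow> 'a" (infixl "\<odot>" 70)
    and star :: "'a \<Rightarrow> 'a"
    and N :: "'a \<Rightarrow> real"
  assumes mul_assoc: "(x \<odot> y) \<odot> z = x \<odot> (y \<odot> z)"
    and mul_add_left: "(x + y) \<odot> z = x \<odot> z + y \<odot> z"
    and mul_add_right: "x \<odot> (y + z) = x \<odot> y + x \<odot> z"
    and mul_sc_left: "sc c x \<odot> y = sc c (x \<odot> y)"
    and mul_sc_right: "x \<odot> sc c y = sc c (x \<odot> y)"
    and star_add: "star (x + y) = star x + star y"
    and star_sc: "star (sc c x) = sc (cnj c) (star x)"
    and star_mul: "star (x \<odot> y) = star y \<odot> star x"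
    and star_star: "star (star x) = x"
    and N_triangle: "N (x + y) \<le> N x + N y"
    and N_sc: "N (sc c x) = cmod c * N x"
    and N_mul: "N (x \<odot> y) \<le> N x * N y"
    and N_star: "N (star x) = N x"
    and N_complete: "summable (\<lambda>k. N (X k)) \<Longrightarrow> \<exists>s. (\<lambda>m. N (s - (\<Sum>k<m. X k))) \<longlonglongrightarrow> 0"
begin

lemma mul_zero [simp]: "0 \<odot> x = 0" "x \<odot> 0 = 0"
  using mul_sc_left[of 0 0 x] mul_sc_right[of x 0 0] by simp_all

lemma mul_minus: "(- x) \<odot> y = - (x \<odot> y)" "x \<odot> (- y) = - (x \<odot> y)"
  using mul_sc_left[of "-1" x y] mul_sc_right[of x "-1" y] by (simp_all add: scale_minus_left)

lemma mul_diff: "(x - y) \<odot> z = x \<odot> z - y \<odot> z" "x \<odot> (y - z) = x \<odot> y - x \<odot> z"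
  using mul_add_left[of x "- y" z] mul_add_right[of x y "- z"] by (simp_all add: mul_minus)

lemma mul_sum: "(\<Sum>i\<in>A. f i) \<odot> y = (\<Sum>i\<in>A. f i \<odot> y)" "y \<odot> (\<Sum>i\<in>A. f i) = (\<Sum>i\<in>A. y \<odot> f i)"
  by (induction A rule: infinite_finite_induct) (simp_all add: mul_add_left mul_add_right)

lemma star_zero [simp]: "star 0 = 0"
  using star_sc[of 0 0] by simp

lemma star_minus: "star (- x) = - star x"
  using star_sc[of "-1" x] by (simp add: scale_minus_left)

lemma star_diff: "star (x - y) = star x - star y"
  using star_add[of x "- y"] by (simp add: star_minus)

lemma star_sum: "star (\<Sum>i\<in>A. f i) = (\<Sum>i\<in>A. star (f i))"
  by (induction A rule: infinite_finite_induct) (simp_all add: star_add)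

lemma N_zero [simp]: "N 0 = 0"
  using N_sc[of 0 0] by simp

lemma N_minus [simp]: "N (- x) = N x"
  using N_sc[of "-1" x] by (simp add: scale_minus_left)

lemma N_nonneg [simp]: "N x \<ge> 0"
  using N_triangle[of x "- x"] by simp

lemma N_diff: "N (x - y) \<le> N x + N y"
  using N_triangle[of x "- y"] by simp

lemma N_sum: "N (\<Sum>i\<in>A. f i) \<le> (\<Sum>i\<in>A. N (f i))"
proof (induction A rule: infinite_finite_induct)
  case (insert x F)
  have "N (f x + sum f F) \<le> N (f x) + N (sum f F)" by (rule N_triangle)
  with insert show ?case by simp
qed simp_all

lemma N_mul_mono: "N x \<le> a \<Longrightarrow> N y \<le> b \<Longrightarrow> N (x \<odot> y) \<le> a * b"
  by (meson N_mul N_nonneg mult_mono' order_trans)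

text \<open>
  The power of exponent \<open>Suc k\<close>.
\<close>

definition ppow :: "'a \<Rightarrow> nat \<Rightarrow> 'a"
  where "ppow x k = ((\<odot>) x ^^ k) x"

lemma ppow_0 [simp]: "ppow x 0 = x"
  and ppow_Suc: "ppow x (Suc k) = x \<odot> ppow x k"
  by (simp_all add: ppow_def)

lemma ppow_mul: "ppow x i \<odot> ppow x j = ppow x (Suc (i + j))"
  by (induction i) (simp_all add: ppow_Suc mul_assoc)

lemma ppow_commute:
  assumes "w \<odot> x = x \<odot> w" shows "w \<odot> ppow x k = ppow x k \<odot> w"
  by (induction k) (use assms in \<open>simp_all add: ppow_Suc mul_assoc flip: mul_assoc, simp_all add: mul_assoc\<close>)

lemma star_ppow: assumes "star x = x" shows "star (ppow x k) = ppow x k"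
  by (induction k) (simp_all add: ppow_Suc star_mul assms ppow_commute)

text \<open>
  The element \<open>y\<close> stands for \<open>1 - sqrt (1 - x)\<close>; in the form \<open>2 y - y\<^sup>2 = x\<close> its defining equation makes
  sense without a unit. The coefficients of the binomial series are summable, so bounded powers of
  \<open>x\<close> suffice for convergence.
\<close>

theorem sqrt_series:
  assumes sa: "star x = x" and bd: "\<And>k. N (ppow x k) \<le> C"
  obtains y where "N (y + y - y \<odot> y - x) = 0" "N (star y - y) = 0" "N y \<le> C"
    "\<And>w. w \<odot> x = x \<odot> w \<Longrightarrow> N (w \<odot> y - y \<odot> w) = 0"
proof -
  have C0: "C \<ge> 0" using bd[of 0] N_nonneg[of "ppow x 0"] by linarith
  let ?a = sqrt_coeff
  define X where "X k = sc (of_real (?a k)) (ppow x k)" for k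
  define Y where "Y m = (\<Sum>k<m. X k)" for m
  have NX: "N (X k) \<le> C * ?a k" for k
    using bd[of k] sqrt_coeff_nonneg[of k] by (simp add: X_def N_sc mult.commute[of C] mult_left_mono)
  have "summable (\<lambda>k. N (X k))"
    by (rule summable_comparison_test'[of "\<lambda>k. C * ?a k" 0])
       (use NX summable_sqrt_coeff in \<open>auto intro: summable_mult\<close>)
  then obtain y where y: "(\<lambda>m. N (y - Y m)) \<longlonglongrightarrow> 0"
    using N_complete unfolding Y_def by blast
  have zeroI: "N z = 0" if "\<And>m. N z \<le> K * N (y - Y m)" for z K
  proof -
    have "(\<lambda>m. K * N (y - Y m)) \<longlonglongrightarrow> 0" using tendsto_mult_right_zero[OF y] by simp
    hence "N z \<le> 0" by (rule tendsto_lowerbound) (use that in auto)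
    thus ?thesis using N_nonneg[of z] by linarith
  qed
  have NY: "N (Y m) \<le> C" for m
  proof -
    have "N (Y m) \<le> (\<Sum>k<m. C * ?a k)" unfolding Y_def
      by (rule order_trans[OF N_sum sum_mono]) (rule NX)
    also have "\<dots> = C * (\<Sum>k<m. ?a k)" by (simp add: sum_distrib_left)
    also have "\<dots> \<le> C * 1"
      using alternating_gbinomial_nonneg[of m] by (intro mult_left_mono C0) (simp add: sum_sqrt_coeff)
    finally show ?thesis by simp
  qed
  have Ny: "N y \<le> C"
  proof (rule tendsto_lowerbound)
    show "(\<lambda>m. N (y - Y m) + C) \<longlonglongrightarrow> C" using tendsto_add[OF y tendsto_const[of C]] by simp
    show "\<forall>\<^sub>F m in sequentially. N y \<le> N (y - Y m) + C"
    proof (rule always_eventually, rule allI)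
      fix m show "N y \<le> N (y - Y m) + C" using N_triangle[of "y - Y m" "Y m"] NY[of m] by simp
    qed
  qed simp
  have sY: "star (Y m) = Y m" for m
    by (simp add: Y_def X_def star_sum star_sc star_ppow sa)
  have "N (star y - y) = 0"
  proof (rule zeroI)
    fix m
    have "star y - y = star (y - Y m) - (y - Y m)" by (simp add: star_diff sY)
    hence "N (star y - y) = N (star (y - Y m) - (y - Y m))" by (simp only:)
    thus "N (star y - y) \<le> 2 * N (y - Y m)" using N_diff[of "star (y - Y m)" "y - Y m"] by (simp add: N_star)
  qed
  moreover have "N (w \<odot> y - y \<odot> w) = 0" if "w \<odot> x = x \<odot> w" for w
  proof (rule zeroI)
    fix m
    have "w \<odot> Y m = Y m \<odot> w"
      by (simp add: Y_def X_def mul_sum mul_sc_left mul_sc_right ppow_commute[OF that])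
    hence "w \<odot> y - y \<odot> w = w \<odot> (y - Y m) - (y - Y m) \<odot> w" by (simp add: mul_diff)
    thus "N (w \<odot> y - y \<odot> w) \<le> (2 * N w) * N (y - Y m)"
      using N_diff[of "w \<odot> (y - Y m)" "(y - Y m) \<odot> w"] N_mul[of w "y - Y m"] N_mul[of "y - Y m" w]
      by (simp add: mult.commute[of "N (y - Y m)"])
  qed
  moreover have "N (y + y - y \<odot> y - x) = 0"
  proof -
    define s where "s m = (\<Sum>k<m. ?a k)" for m
    have s: "s \<longlonglongrightarrow> 1" unfolding s_def
      using summable_LIMSEQ[OF summable_sqrt_coeff] by (simp add: suminf_sqrt_coeff)
    \<comment> \<open>In \<open>Y m \<odot> Y m\<close>, the products of index sum below \<open>m\<close> (\<open>I m\<close>) collapse by the convolution identity.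
      The others (\<open>J m\<close>) are estimated by the same splitting of \<open>(\<Sum>k<m. sqrt_coeff k)\<^sup>2\<close>.\<close>
    define I where "I m = {(i, j). i < m \<and> j < m \<and> i + j < m}" for m :: nat
    define J where "J m = {(i, j). i < m \<and> j < m \<and> \<not> i + j < m}" for m :: nat
    have IJ: "{..<m} \<times> {..<m} = I m \<union> J m" "I m \<inter> J m = {}" "finite (I m)" "finite (J m)" for m
    proof -
      show 1: "{..<m} \<times> {..<m} = I m \<union> J m" by (auto simp: I_def J_def)
      show "I m \<inter> J m = {}" by (auto simp: I_def J_def)
      have "finite (I m \<union> J m)" unfolding 1[symmetric] by simp
      thus "finite (I m)" "finite (J m)" by auto
    qed
    have I: "I m = (\<lambda>(l, i). (i, l - i)) ` (SIGMA l:{..<m}. {..l})" for m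
    proof (rule set_eqI, clarify)
      fix i j
      show "(i, j) \<in> I m \<longleftrightarrow> (i, j) \<in> (\<lambda>(l, i). (i, l - i)) ` (SIGMA l:{..<m}. {..l})"
        by (auto simp: I_def image_iff intro!: bexI[of _ "i + j"])
    qed
    have inj: "inj_on (\<lambda>(l, i). (i, l - i)) (SIGMA l:{..<m}. {..l})" for m :: nat
      by (auto simp: inj_on_def)
    have prodY: "Y m \<odot> Y m = (\<Sum>(i, j)\<in>{..<m} \<times> {..<m}. sc (of_real (?a i * ?a j)) (ppow x (Suc (i + j))))" for m
      unfolding Y_def mul_sum(1) unfolding mul_sum(2) sum.cartesian_product
      by (rule sum.cong) (auto simp: X_def mul_sc_left mul_sc_right ppow_mul mult.commute)
    have partI: "(\<Sum>(i, j)\<in>I m. sc (of_real (?a i * ?a j)) (ppow x (Suc (i + j)))) = Y (Suc m) + Y (Suc m) - x" for m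
    proof -
      have "(\<Sum>(i, j)\<in>I m. sc (of_real (?a i * ?a j)) (ppow x (Suc (i + j))))
          = (\<Sum>(l, i)\<in>(SIGMA l:{..<m}. {..l}). sc (of_real (?a i * ?a (l - i))) (ppow x (Suc l)))"
        unfolding I by (subst sum.reindex[OF inj]) (auto intro!: sum.cong)
      also have "\<dots> = (\<Sum>l<m. \<Sum>i\<le>l. sc (of_real (?a i * ?a (l - i))) (ppow x (Suc l)))"
        by (simp add: sum.Sigma)
      also have "\<dots> = (\<Sum>l<m. sc (of_real (2 * ?a (Suc l))) (ppow x (Suc l)))"
      proof (rule sum.cong[OF refl])
        fix l
        have "(\<Sum>i\<le>l. sc (of_real (?a i * ?a (l - i))) (ppow x (Suc l)))
            = sc (of_real (\<Sum>i\<le>l. ?a i * ?a (l - i))) (ppow x (Suc l))"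
          unfolding of_real_sum scale_sum_left ..
        thus "(\<Sum>i\<le>l. sc (of_real (?a i * ?a (l - i))) (ppow x (Suc l)))
            = sc (of_real (2 * ?a (Suc l))) (ppow x (Suc l))"
          by (simp only: sqrt_coeff_convolution)
      qed
      also have "\<dots> = (\<Sum>l<m. X (Suc l) + X (Suc l))"
        by (simp only: X_def mult_2 of_real_add scale_left_distrib)
      also have "\<dots> = (\<Sum>l<m. X (Suc l)) + (\<Sum>l<m. X (Suc l))"
        by (simp add: sum.distrib)
      also have "(\<Sum>l<m. X (Suc l)) = Y (Suc m) - X 0"
        unfolding Y_def by (subst sum.lessThan_Suc_shift) simp
      also have "Y (Suc m) - X 0 + (Y (Suc m) - X 0) = Y (Suc m) + Y (Suc m) - (X 0 + X 0)" by simp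
      also have "X 0 + X 0 = x"
        by (simp add: X_def sqrt_coeff_0 flip: scale_left_distrib)
      finally show ?thesis .
    qed
    have realI: "(\<Sum>(i, j)\<in>I m. ?a i * ?a j) = 2 * s (Suc m) - 1" for m
    proof -
      have "(\<Sum>(i, j)\<in>I m. ?a i * ?a j) = (\<Sum>(l, i)\<in>(SIGMA l:{..<m}. {..l}). ?a i * ?a (l - i))"
        unfolding I by (subst sum.reindex[OF inj]) (auto intro!: sum.cong)
      also have "\<dots> = (\<Sum>l<m. \<Sum>i\<le>l. ?a i * ?a (l - i))"
        by (simp add: sum.Sigma)
      also have "\<dots> = 2 * (\<Sum>l<m. ?a (Suc l))"
        by (simp add: sqrt_coeff_convolution sum_distrib_left)
      also have "(\<Sum>l<m. ?a (Suc l)) = s (Suc m) - 1/2"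
        unfolding s_def by (subst sum.lessThan_Suc_shift) (simp add: sqrt_coeff_0)
      finally show ?thesis by simp
    qed
    have realJ: "(\<Sum>(i, j)\<in>J m. ?a i * ?a j) = s m * s m - (2 * s (Suc m) - 1)" for m
    proof -
      have "s m * s m = (\<Sum>(i, j)\<in>{..<m} \<times> {..<m}. ?a i * ?a j)"
        by (simp add: s_def sum_product sum.cartesian_product)
      also have "\<dots> = (\<Sum>(i, j)\<in>I m. ?a i * ?a j) + (\<Sum>(i, j)\<in>J m. ?a i * ?a j)"
        unfolding IJ(1) by (rule sum.union_disjoint) (use IJ in auto)
      finally show ?thesis by (simp add: realI)
    qed
    have est: "N (Y m \<odot> Y m - (Y (Suc m) + Y (Suc m) - x)) \<le> C * (s m * s m - (2 * s (Suc m) - 1))" for m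
    proof -
      have "Y m \<odot> Y m = (Y (Suc m) + Y (Suc m) - x) + (\<Sum>(i, j)\<in>J m. sc (of_real (?a i * ?a j)) (ppow x (Suc (i + j))))"
        unfolding prodY IJ(1) partI[symmetric] by (rule sum.union_disjoint) (use IJ in auto)
      hence "N (Y m \<odot> Y m - (Y (Suc m) + Y (Suc m) - x)) = N (\<Sum>(i, j)\<in>J m. sc (of_real (?a i * ?a j)) (ppow x (Suc (i + j))))"
        by simp
      also have "\<dots> \<le> (\<Sum>z\<in>J m. C * (case z of (i, j) \<Rightarrow> ?a i * ?a j))"
      proof (rule order_trans[OF N_sum sum_mono], clarify)
        fix i j
        have "N (sc (of_real (?a i * ?a j)) (ppow x (Suc (i + j)))) = (?a i * ?a j) * N (ppow x (Suc (i + j)))"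
          using sqrt_coeff_nonneg[of i] sqrt_coeff_nonneg[of j] by (simp add: N_sc norm_mult)
        also have "\<dots> \<le> (?a i * ?a j) * C"
          by (rule mult_left_mono[OF bd]) (simp add: sqrt_coeff_nonneg)
        finally show "N (sc (of_real (?a i * ?a j)) (ppow x (Suc (i + j)))) \<le> C * (?a i * ?a j)"
          by (simp add: mult.commute)
      qed
      also have "\<dots> = C * (s m * s m - (2 * s (Suc m) - 1))"
        by (simp flip: sum_distrib_left add: realJ)
      finally show ?thesis .
    qed
    define B where "B m = 2 * N (y - Y (Suc m)) + 2 * C * N (y - Y m) + C * (s m * s m - (2 * s (Suc m) - 1))" for m
    have "B \<longlonglongrightarrow> 2 * 0 + 2 * C * 0 + C * (1 * 1 - (2 * 1 - 1))"
      unfolding B_def by (intro tendsto_intros y s LIMSEQ_Suc)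
    hence B: "B \<longlonglongrightarrow> 0" by simp
    have "N (y + y - y \<odot> y - x) \<le> B m" for m
    proof -
      have "y + y - y \<odot> y - x = ((y - Y (Suc m)) + (y - Y (Suc m))) - (y \<odot> (y - Y m) + (y - Y m) \<odot> Y m)
          - (Y m \<odot> Y m - (Y (Suc m) + Y (Suc m) - x))"
        by (simp add: mul_diff algebra_simps)
      also have "N \<dots> \<le> (N (y - Y (Suc m)) + N (y - Y (Suc m))) + (N (y \<odot> (y - Y m)) + N ((y - Y m) \<odot> Y m))
          + N (Y m \<odot> Y m - (Y (Suc m) + Y (Suc m) - x))"
        by (intro order_trans[OF N_diff] add_mono N_triangle order_refl)
      also have "\<dots> \<le> B m"
        using est[of m] N_mul_mono[OF Ny order_refl, of "y - Y m"] N_mul_mono[OF order_refl NY, of "y - Y m" m]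
        by (simp add: B_def algebra_simps)
      finally show ?thesis .
    qed
    hence "N (y + y - y \<odot> y - x) \<le> 0" using B by (intro tendsto_lowerbound[OF B]) auto
    thus ?thesis using N_nonneg[of "y + y - y \<odot> y - x"] by linarith
  qed
  ultimately show ?thesis using that Ny by blast
qed

end

section \<open>The order of a unital C*-algebra\<close>

context complete_seminormed_star_algebra
begin

text \<open>
  The coefficients of a trigonometric polynomial are bounded by its supremum on the circle: average
  over the \<open>L\<close>-th roots of unity, where \<open>L\<close> exceeds all exponents.
\<close>

lemma circle_coefficient_bound:
  assumes fin: "finite I" and bd: "\<And>\<omega>. cmod \<omega> = 1 \<Longrightarrow> N (\<Sum>i\<in>I. sc (\<omega> ^ d i) (V i)) \<le> m"
  shows "N (\<Sum>i\<in>{i\<in>I. d i = k}. V i) \<le> m"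
proof -
  define L where "L = Suc (Max (insert k (d ` I)))"
  have L: "k < L" "\<And>i. i \<in> I \<Longrightarrow> d i < L" "L > 0"
    using fin by (auto simp: L_def less_Suc_eq_le intro!: Max_ge)
  define \<zeta> where "\<zeta> = exp (2 * of_real pi * \<i> * of_nat 1 / of_nat L)"
  have \<zeta>_pow: "\<zeta> ^ j = exp (2 * of_real pi * \<i> * of_nat j / of_nat L)" for j
    unfolding \<zeta>_def by (simp flip: exp_of_nat_mult add: algebra_simps)
  have \<zeta>_inj: "i = j" if "\<zeta> ^ i = \<zeta> ^ j" "i < L" "j < L" for i j
    using that complex_root_unity_eq[of L i j] unfolding \<zeta>_pow by (simp add: Suc_le_eq)
  have \<zeta>L: "\<zeta> ^ L = 1" using L(3) by (simp add: \<zeta>_pow)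
  have n\<zeta>: "cmod \<zeta> = 1" by (simp add: \<zeta>_def)
  have c\<zeta>: "\<zeta> * cnj \<zeta> = 1" using n\<zeta> by (simp add: complex_norm_square[symmetric])
  have orth: "(\<Sum>j<L. cnj (\<zeta> ^ j) ^ k * (\<zeta> ^ j) ^ l) = (if l = k then of_nat L else 0)" if "l < L" for l
  proof -
    define \<eta> where "\<eta> = cnj \<zeta> ^ k * \<zeta> ^ l"
    have "(\<Sum>j<L. cnj (\<zeta> ^ j) ^ k * (\<zeta> ^ j) ^ l) = (\<Sum>j<L. \<eta> ^ j)"
      by (rule sum.cong) (simp_all add: \<eta>_def power_mult_distrib mult.commute flip: power_mult)
    also have "\<dots> = (if l = k then of_nat L else 0)"
    proof (cases "l = k")
      case True
      hence "\<eta> = 1" using c\<zeta> by (simp add: \<eta>_def flip: power_mult_distrib) (simp add: mult.commute)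
      thus ?thesis using True by simp
    next
      case False
      have "\<zeta> ^ k * \<eta> = (\<zeta> * cnj \<zeta>) ^ k * \<zeta> ^ l" by (simp add: \<eta>_def power_mult_distrib)
      hence "\<zeta> ^ k * \<eta> = \<zeta> ^ l" by (simp add: c\<zeta>)
      hence "\<eta> \<noteq> 1" using \<zeta>_inj[of k l] L(1) that False by auto
      moreover have "\<eta> ^ L = 1"
      proof -
        have "\<eta> ^ L = cnj (\<zeta> ^ L) ^ k * (\<zeta> ^ L) ^ l"
          by (simp add: \<eta>_def power_mult_distrib mult.commute flip: power_mult)
        thus ?thesis by (simp add: \<zeta>L)
      qed
      ultimately show ?thesis using False by (simp add: geometric_sum)
    qed
    finally show ?thesis .
  qed
  have "(\<Sum>j<L. sc (cnj (\<zeta> ^ j) ^ k) (\<Sum>i\<in>I. sc ((\<zeta> ^ j) ^ d i) (V i)))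
      = (\<Sum>i\<in>I. \<Sum>j<L. sc (cnj (\<zeta> ^ j) ^ k * (\<zeta> ^ j) ^ d i) (V i))"
    by (subst sum.swap) (simp add: scale_sum_right)
  also have "\<dots> = (\<Sum>i\<in>I. sc (if d i = k then of_nat L else 0) (V i))"
    by (intro sum.cong refl) (simp only: scale_sum_left[symmetric] orth[OF L(2)])
  also have "\<dots> = (\<Sum>i\<in>{i\<in>I. d i = k}. sc (of_nat L) (V i))"
    using fin by (intro sum.mono_neutral_cong_right) auto
  also have "\<dots> = sc (of_nat L) (\<Sum>i\<in>{i\<in>I. d i = k}. V i)"
    by (simp add: scale_sum_right)
  finally have "real L * N (\<Sum>i\<in>{i\<in>I. d i = k}. V i)
      = N (\<Sum>j<L. sc (cnj (\<zeta> ^ j) ^ k) (\<Sum>i\<in>I. sc ((\<zeta> ^ j) ^ d i) (V i)))"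
    by (simp add: N_sc)
  also have "\<dots> \<le> (\<Sum>j<L. m)"
    by (intro order_trans[OF N_sum sum_mono]) (simp add: N_sc norm_power n\<zeta> bd)
  finally show ?thesis using L(3) by simp
qed

end

lemma le_of_power_le_linear:
  fixes x y a b :: real
  assumes "y > 0" and le: "\<And>n. x ^ n \<le> (a * real n + b) * y ^ n"
  shows "x \<le> y"
proof (rule ccontr)
  assume "\<not> x \<le> y"
  hence xy: "x > y" "x > 0" using assms by auto
  define q where "q = y / x"
  have q: "0 < q" "q < 1" using xy \<open>y > 0\<close> by (auto simp: q_def)
  have "(\<lambda>n. a * (real n * q ^ n) + b * q ^ n) \<longlonglongrightarrow> a * 0 + b * 0"
    using q by (intro tendsto_intros powser_times_n_limit_0 LIMSEQ_power_zero) auto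
  moreover have "1 \<le> a * (real n * q ^ n) + b * q ^ n" for n
    using le[of n] xy by (simp add: q_def power_divide field_simps)
  ultimately have "(1::real) \<le> a * 0 + b * 0" by (intro tendsto_lowerbound) auto
  thus False by simp
qed

locale unital_cstar_algebra = complete_seminormed_star_algebra +
  fixes e :: 'a
  assumes e_left [simp]: "e \<odot> x = x"
    and e_right [simp]: "x \<odot> e = x"
    and N_e [simp]: "N e = 1"
    and N_cstar: "N (star x \<odot> x) = (N x)\<^sup>2"
    and N_eq_0: "N x = 0 \<Longrightarrow> x = 0"
begin

lemma star_e [simp]: "star e = e"
proof -
  have "star (star e \<odot> e) = star e \<odot> e" by (simp only: star_mul star_star)
  thus ?thesis by (simp add: star_star)
qed

definition upow :: "'a \<Rightarrow> nat \<Rightarrow> 'a"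
  where "upow x k = ((\<odot>) x ^^ k) e"

lemma upow_0 [simp]: "upow x 0 = e"
  and upow_Suc: "upow x (Suc k) = x \<odot> upow x k"
  by (simp_all add: upow_def)

lemma upow_add: "upow x (i + j) = upow x i \<odot> upow x j"
  by (induction i) (simp_all add: upow_Suc mul_assoc)

lemma upow_commute: "w \<odot> x = x \<odot> w \<Longrightarrow> w \<odot> upow x k = upow x k \<odot> w"
  by (induction k) (simp_all add: upow_Suc mul_assoc, metis mul_assoc)

lemma upow_Suc2: "upow x (Suc k) = upow x k \<odot> x"
  by (simp add: upow_Suc upow_commute)

lemma star_upow: "star x = x \<Longrightarrow> star (upow x k) = upow x k"
  by (induction k) (simp_all add: star_mul upow_Suc, metis upow_commute)

lemma N_upow_le: "N (upow x k) \<le> N x ^ k"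
  by (induction k) (simp_all add: upow_Suc N_mul_mono)

text \<open>
  For exponents that are powers of two this is the C*-identity; submultiplicativity of the norm
  gives the remaining ones.
\<close>

lemma N_upow_sa:
  assumes sa: "star a = a" shows "N (upow a k) = N a ^ k"
proof (cases "N a = 0")
  case True
  thus ?thesis using N_upow_le[of a k] N_eq_0[OF True] by (cases k) (simp_all add: upow_Suc)
next
  case False
  have pow2: "N (upow a (2 ^ m)) = N a ^ (2 ^ m)" for m
  proof (induction m)
    case (Suc m)
    have "N (upow a (2 ^ Suc m)) = N (star (upow a (2 ^ m)) \<odot> upow a (2 ^ m))"
      by (simp add: star_upow sa flip: upow_add mult_2)
    also have "\<dots> = N a ^ (2 ^ Suc m)" by (simp only: N_cstar Suc) (simp add: power_mult[symmetric] mult.commute)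
    finally show ?case .
  qed (simp add: upow_Suc)
  have k: "k \<le> 2 ^ k" by (simp add: less_imp_le)
  have "N a ^ k * N a ^ (2 ^ k - k) = N (upow a (2 ^ k))" using k by (simp add: pow2 flip: power_add)
  also have "upow a (2 ^ k) = upow a k \<odot> upow a (2 ^ k - k)" using k by (simp flip: upow_add)
  also have "N \<dots> \<le> N (upow a k) * N a ^ (2 ^ k - k)" by (intro N_mul_mono order_refl N_upow_le)
  finally have "N a ^ k \<le> N (upow a k)" using False N_nonneg[of a] by (simp add: less_le)
  thus ?thesis using N_upow_le[of a k] by simp
qed

lemma upow_binomial: "upow (e + sc \<omega> a) n = (\<Sum>k\<le>n. sc (of_nat (n choose k) * \<omega> ^ k) (upow a k))"
proof (induction n)
  case (Suc n)
  have A: "(\<Sum>k\<le>n. sc (of_nat (n choose k) * \<omega> ^ k) (upow a k)) =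
      e + (\<Sum>k\<le>n. sc (of_nat (n choose Suc k) * \<omega> ^ Suc k) (upow a (Suc k)))"
  proof -
    have "(\<Sum>k\<le>n. sc (of_nat (n choose k) * \<omega> ^ k) (upow a k)) = (\<Sum>k\<le>Suc n. sc (of_nat (n choose k) * \<omega> ^ k) (upow a k))"
      by simp
    also have "\<dots> = e + (\<Sum>k\<le>n. sc (of_nat (n choose Suc k) * \<omega> ^ Suc k) (upow a (Suc k)))"
      by (subst sum.atMost_Suc_shift) simp
    finally show ?thesis .
  qed
  have "upow (e + sc \<omega> a) (Suc n) = upow (e + sc \<omega> a) n + sc \<omega> (a \<odot> upow (e + sc \<omega> a) n)"
    by (simp add: upow_Suc mul_add_left mul_sc_left)
  also have "sc \<omega> (a \<odot> upow (e + sc \<omega> a) n) = (\<Sum>k\<le>n. sc (of_nat (n choose k) * \<omega> ^ Suc k) (upow a (Suc k)))"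
    unfolding Suc by (simp add: mul_sum mul_sc_right scale_sum_right upow_Suc mult.left_commute)
  also have "upow (e + sc \<omega> a) n = e + (\<Sum>k\<le>n. sc (of_nat (n choose Suc k) * \<omega> ^ Suc k) (upow a (Suc k)))"
    unfolding Suc A ..
  also have "\<dots> + (\<Sum>k\<le>n. sc (of_nat (n choose k) * \<omega> ^ Suc k) (upow a (Suc k)))
      = e + (\<Sum>k\<le>n. sc ((of_nat (n choose Suc k) + of_nat (n choose k)) * \<omega> ^ Suc k) (upow a (Suc k)))"
    unfolding distrib_right scale_left_distrib sum.distrib add.assoc ..
  also have "\<dots> = e + (\<Sum>k\<le>n. sc (of_nat (Suc n choose Suc k) * \<omega> ^ Suc k) (upow a (Suc k)))"
    by (simp add: add.commute)
  also have "\<dots> = (\<Sum>k\<le>Suc n. sc (of_nat (Suc n choose k) * \<omega> ^ k) (upow a k))"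
    unfolding sum.atMost_Suc_shift by simp
  finally show ?case .
qed simp

text \<open>
  The norm of a self-adjoint element is determined by the real direction alone. By the C*-identity,
  the hypotheses bound \<open>e + (\<omega>/2) a\<close> by \<open>sqrt M\<close> for all \<open>\<omega>\<close> on the circle. Extracting the coefficients
  of its \<open>n\<close>-th power, with \<open>N (a ^ k) = N a ^ k\<close>, gives \<open>(1 + N a / 2) ^ n \<le> (n + 1) * sqrt M ^ n\<close>, and
  for large \<open>n\<close> the linear factor disappears.
\<close>

lemma sa_norm_le:
  assumes sa: "star a = a" and le: "N (e + a) \<le> 1 + \<sigma>" "N (e - a) \<le> 1 + \<sigma>"
  shows "N a \<le> \<sigma>"
proof -
  define \<rho> where "\<rho> = N a"
  define M where "M = 1 + \<sigma> + \<rho>\<^sup>2 / 4"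
  have \<sigma>1: "1 + \<sigma> \<ge> 1"
  proof -
    have "(e + a) + (e - a) = sc 2 e" using scale_left_distrib[of 1 1 e] by simp
    hence "2 = N ((e + a) + (e - a))" by (simp only: N_sc) simp
    also have "\<dots> \<le> 2 * (1 + \<sigma>)" using N_triangle[of "e + a" "e - a"] le by simp
    finally show ?thesis by simp
  qed
  have M: "M \<ge> 1" using \<sigma>1 by (simp add: M_def)
  have seg: "N (e + sc (of_real t) a) \<le> 1 + \<sigma>" if "\<bar>t\<bar> \<le> 1" for t
  proof -
    have "e + sc (of_real t) a = sc (of_real ((1 + t) / 2)) (e + a) + sc (of_real ((1 - t) / 2)) (e - a)"
    proof -
      have "sc (of_real ((1 + t) / 2)) (e + a) + sc (of_real ((1 - t) / 2)) (e - a)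
        = sc (of_real ((1 + t) / 2) + of_real ((1 - t) / 2)) e + sc (of_real ((1 + t) / 2) - of_real ((1 - t) / 2)) a"
        by (simp add: scale_right_distrib scale_right_diff_distrib scale_left_distrib scale_left_diff_distrib)
      also have "of_real ((1 + t) / 2) + of_real ((1 - t) / 2) = (1::complex)" by (simp add: field_simps)
      also have "of_real ((1 + t) / 2) - of_real ((1 - t) / 2) = (of_real t ::complex)" by (simp add: field_simps)
      finally show ?thesis by simp
    qed
    also have "N \<dots> \<le> (1 + t) / 2 * (1 + \<sigma>) + (1 - t) / 2 * (1 + \<sigma>)"
      using that by (intro order_trans[OF N_triangle] add_mono) (simp_all only: N_sc norm_of_real, auto intro!: mult_left_mono le)
    also have "\<dots> = 1 + \<sigma>" by (simp add: field_simps)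
    finally show ?thesis .
  qed
  have circ: "N (e + sc \<omega> (sc (1/2) a)) \<le> sqrt M" if \<omega>: "cmod \<omega> = 1" for \<omega>
  proof -
    let ?w = "e + sc \<omega> (sc (1/2) a)"
    have "cnj \<omega> * \<omega> = 1" using \<omega> by (simp add: complex_norm_square[symmetric] mult.commute)
    hence 1: "(cnj \<omega> / 2) * (\<omega> / 2) = 1/4" by simp
    have 2: "cnj \<omega> / 2 + \<omega> / 2 = of_real (Re \<omega>)" by (simp add: complex_eq_iff)
    have "star ?w \<odot> ?w = e + (sc (cnj \<omega> / 2) a + sc (\<omega> / 2) a) + sc ((cnj \<omega> / 2) * (\<omega> / 2)) (a \<odot> a)"
      by (simp add: star_add star_sc sa mul_add_left mul_add_right mul_sc_left mul_sc_right scale_right_distrib mult.commute)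
    also have "\<dots> = e + sc (of_real (Re \<omega>)) a + sc (1/4) (a \<odot> a)"
      by (simp only: 1 2 flip: scale_left_distrib)
    also have "N \<dots> \<le> (1 + \<sigma>) + \<rho>\<^sup>2 / 4"
      using seg[of "Re \<omega>"] abs_Re_le_cmod[of \<omega>] \<omega> N_mul[of a a]
      by - (rule order_trans[OF N_triangle], rule add_mono, auto simp: N_sc \<rho>_def power2_eq_square)
    finally have "(N ?w)\<^sup>2 \<le> M" by (simp add: N_cstar M_def)
    thus ?thesis by (simp add: real_le_rsqrt)
  qed
  have pow_le: "(1 + \<rho>/2) ^ n \<le> (1 * real n + 1) * sqrt M ^ n" for n
  proof -
    have coef: "real (n choose k) * (\<rho>/2) ^ k \<le> sqrt M ^ n" if "k \<le> n" for k
    proof -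
      have "N (\<Sum>i\<in>{i\<in>{..n}. id i = k}. sc (of_nat (n choose i)) (upow (sc (1/2) a) i)) \<le> sqrt M ^ n"
      proof (rule circle_coefficient_bound)
        fix \<omega> :: complex assume "cmod \<omega> = 1"
        have "(\<Sum>i\<le>n. sc (\<omega> ^ id i) (sc (of_nat (n choose i)) (upow (sc (1/2) a) i))) = upow (e + sc \<omega> (sc (1/2) a)) n"
          unfolding upow_binomial by (simp only: id_apply scale_scale mult.commute)
        thus "N (\<Sum>i\<le>n. sc (\<omega> ^ id i) (sc (of_nat (n choose i)) (upow (sc (1/2) a) i))) \<le> sqrt M ^ n"
          using N_upow_le[of "e + sc \<omega> (sc (1/2) a)" n] power_mono[OF circ[OF \<open>cmod \<omega> = 1\<close>] N_nonneg, of n] by simp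
      qed simp
      moreover have "{i\<in>{..n}. id i = k} = {k}" using that by auto
      moreover have "star (sc (1/2) a) = sc (1/2) a" by (simp add: star_sc sa)
      ultimately show ?thesis by (simp add: N_sc N_upow_sa \<rho>_def)
    qed
    have "(1 + \<rho>/2) ^ n = (\<Sum>k\<le>n. real (n choose k) * (\<rho>/2) ^ k)"
      using binomial_ring[of "\<rho>/2" 1 n] by (simp add: add.commute)
    also have "\<dots> \<le> (\<Sum>k\<le>n. sqrt M ^ n)" by (intro sum_mono coef) simp
    finally show ?thesis by (simp add: algebra_simps)
  qed
  have "1 + \<rho>/2 \<le> sqrt M" using M by (intro le_of_power_le_linear[OF _ pow_le]) auto
  hence "(1 + \<rho>/2)\<^sup>2 \<le> (sqrt M)\<^sup>2" by (rule power_mono) (simp add: \<rho>_def)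
  hence "(1 + \<rho>/2)\<^sup>2 \<le> M" using M by simp
  thus ?thesis by (simp add: M_def \<rho>_def power2_eq_square field_simps)
qed

end

context unital_cstar_algebra
begin

definition rs :: "real \<Rightarrow> 'a \<Rightarrow> 'a"
  where "rs t x = sc (of_real t) x"

lemma rs_rs: "rs s (rs t x) = rs (s * t) x"
  and rs_add_right: "rs s (x + y) = rs s x + rs s y"
  and rs_diff_right: "rs s (x - y) = rs s x - rs s y"
  and rs_add_left: "rs (s + t) x = rs s x + rs t x"
  and rs_diff_left: "rs (s - t) x = rs s x - rs t x"
  and rs_one [simp]: "rs 1 x = x"
  and rs_zero [simp]: "rs 0 x = 0" "rs s 0 = 0"
  and rs_minus: "rs (- s) x = - rs s x" "rs s (- x) = - rs s x"
  and star_rs: "star (rs s x) = rs s (star x)"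
  and mul_rs: "rs s x \<odot> y = rs s (x \<odot> y)" "x \<odot> rs s y = rs s (x \<odot> y)"
  and N_rs: "N (rs s x) = \<bar>s\<bar> * N x"
  by (simp_all add: rs_def scale_right_distrib scale_right_diff_distrib scale_left_distrib
      scale_left_diff_distrib star_sc mul_sc_left mul_sc_right N_sc)

lemmas rs_simps = rs_rs rs_add_right rs_diff_right rs_add_left rs_diff_left rs_minus

lemma rs_cancel: "s \<noteq> 0 \<Longrightarrow> rs s (rs (1 / s) x) = x" "s \<noteq> 0 \<Longrightarrow> rs (1 / s) (rs s x) = x"
  by (simp_all add: rs_rs)

lemma rs_2: "rs 2 x = x + x"
  using rs_add_left[of 1 1 x] by simp

lemma rs_half: "rs (1/2) (x + x) = x"
  by (simp only: rs_2[symmetric] rs_rs) simp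

text \<open>
  For self-adjoint \<open>a\<close> this says that the spectrum is nonnegative. Defining it by norms avoids
  spectra and makes the positive cone stable under all limits that do not increase norms.
\<close>

definition pos :: "'a \<Rightarrow> bool"
  where "pos a \<longleftrightarrow> star a = a \<and> (\<exists>t. N (rs t e - a) \<le> t)"

lemma pos_sa: "pos a \<Longrightarrow> star a = a"
  by (simp add: pos_def)

lemma pos_witness_mono:
  assumes "N (rs t e - a) \<le> t" "t \<le> t'" shows "N (rs t' e - a) \<le> t'"
proof -
  have "rs t' e - a = (rs t e - a) + rs (t' - t) e" by (simp add: rs_diff_left)
  also have "N \<dots> \<le> t + (t' - t)"
    using assms by - (rule order_trans[OF N_triangle], rule add_mono, auto simp: N_rs)
  finally show ?thesis by simp
qed

lemma pos_witness:
  assumes "pos a" shows "\<exists>T>0. \<forall>t\<ge>T. N (rs t e - a) \<le> t"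
proof -
  from assms obtain t where t: "N (rs t e - a) \<le> t" by (auto simp: pos_def)
  have t0: "t \<ge> 0" using t N_nonneg[of "rs t e - a"] by linarith
  have "N (rs u e - a) \<le> u" if "u \<ge> t + 1" for u
    by (rule pos_witness_mono[OF t]) (use that in simp)
  thus ?thesis using t0 by (intro exI[of _ "t + 1"]) auto
qed

lemma pos_small:
  assumes "pos a" shows "\<exists>T>0. \<forall>s\<ge>0. s * T \<le> 1 \<longrightarrow> N (e - rs s a) \<le> 1"
proof -
  obtain T where T: "T > 0" "\<forall>t\<ge>T. N (rs t e - a) \<le> t"
    using pos_witness[OF assms] by blast
  have "N (e - rs s a) \<le> 1" if s: "0 \<le> s" "s * T \<le> 1" for s
  proof (cases "s = 0")
    case False
    hence "s > 0" "1 / s \<ge> T" using s by (auto simp: field_simps)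
    hence "N (rs s (rs (1/s) e - a)) \<le> s * (1 / s)"
      by (simp only: N_rs) (use T(2)[rule_format, of "1/s"] in \<open>simp add: field_simps\<close>)
    thus ?thesis using \<open>s > 0\<close> by (simp add: rs_diff_right rs_rs)
  qed simp
  thus ?thesis using T(1) by blast
qed

lemma pos_zero [simp]: "pos 0"
  unfolding pos_def by (auto intro: exI[of _ 0])

lemma pos_e [simp]: "pos e"
  unfolding pos_def by (auto intro: exI[of _ 1])

lemma pos_add: assumes "pos a" "pos b" shows "pos (a + b)"
proof -
  from assms obtain s t where st: "N (rs s e - a) \<le> s" "N (rs t e - b) \<le> t" by (auto simp: pos_def)
  have "rs (s + t) e - (a + b) = (rs s e - a) + (rs t e - b)" by (simp add: rs_add_left)
  also have "N \<dots> \<le> s + t" by (rule order_trans[OF N_triangle add_mono[OF st]])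
  finally show ?thesis using assms by (auto simp: pos_def star_add)
qed

lemma pos_rs: assumes "pos a" "c \<ge> 0" shows "pos (rs c a)"
proof -
  from assms obtain t where t: "N (rs t e - a) \<le> t" by (auto simp: pos_def)
  have "rs (c * t) e - rs c a = rs c (rs t e - a)" by (simp add: rs_simps)
  also have "N \<dots> \<le> c * t" using t \<open>c \<ge> 0\<close> by (simp add: N_rs mult_left_mono)
  finally show ?thesis using assms by (auto simp: pos_def star_rs)
qed

lemma pos_sum: "(\<And>i. i \<in> A \<Longrightarrow> pos (f i)) \<Longrightarrow> pos (\<Sum>i\<in>A. f i)"
  by (induction A rule: infinite_finite_induct) (auto intro: pos_add)

lemma pos_diff_of_norm: "star a = a \<Longrightarrow> N a \<le> t \<Longrightarrow> pos (rs t e - a)" 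
  and pos_sum_of_norm: "star a = a \<Longrightarrow> N a \<le> t \<Longrightarrow> pos (rs t e + a)"
  unfolding pos_def by (auto intro!: exI[of _ t] simp: star_diff star_add star_rs)

text \<open>
  The definition gives the estimate for large \<open>t\<close> only. It is a statement about \<open>e + s (t e - a)\<close> for
  small \<open>s\<close>, to which \<open>sa_norm_le\<close> applies.
\<close>

lemma pos_norm_diff:
  assumes "pos a" "N a \<le> t" shows "N (rs t e - a) \<le> t"
proof -
  obtain T where T: "T > 0" "\<forall>t\<ge>T. N (rs t e - a) \<le> t"
    using pos_witness[OF assms(1)] by blast
  have t0: "t \<ge> 0" using assms(2) N_nonneg[of a] by linarith
  \<comment> \<open>Small enough for the witness \<open>T\<close> to apply, with \<open>s * t \<le> 1\<close>.\<close>
  define s where "s = 1 / (T + t + 1)"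
  have s: "s > 0" "1 / s = T + t + 1" "s * t \<le> 1" using T t0 by (auto simp: s_def)
  define b where "b = rs t e - a"
  have "N (rs s b) \<le> s * t"
  proof (rule sa_norm_le)
    show "star (rs s b) = rs s b" using pos_sa[OF assms(1)] by (simp add: star_rs b_def star_diff)
    have "e + rs s b = rs s (rs (1 / s + t) e - a)"
      using s(1) by (simp add: b_def rs_diff_right rs_rs distrib_left rs_add_left rs_add_right)
    also have "N \<dots> \<le> s * (1 / s + t)"
      using s(1) T(2)[rule_format, of "1/s + t"] t0 by (simp only: N_rs) (simp add: s(2))
    also have "\<dots> = 1 + s * t" using s(1) by (simp add: distrib_left)
    finally show "N (e + rs s b) \<le> 1 + s * t" .
    have "e - rs s b = rs (1 - s * t) e + rs s a"
      by (simp add: b_def rs_simps)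
    also have "N \<dots> \<le> (1 - s * t) * 1 + s * t"
      using s assms(2) by - (rule order_trans[OF N_triangle], rule add_mono, auto simp: N_rs)
    also have "\<dots> \<le> 1 + s * t" using s(1) t0 by simp
    finally show "N (e - rs s b) \<le> 1 + s * t" .
  qed
  thus ?thesis using s(1) by (simp add: N_rs b_def)
qed

text \<open>
  The element \<open>w = e - \<sigma> h\<^sup>2 + \<i> sqrt (2 \<sigma>) h\<close> satisfies \<open>star w \<odot> w = e + \<sigma>\<^sup>2 h\<^sup>4\<close>, so the norm of its real
  part \<open>e - \<sigma> h\<^sup>2\<close> exceeds \<open>1\<close> only to second order in \<open>\<sigma>\<close>. By \<open>sa_norm_le\<close> this first order information
  determines the norm of \<open>e - h\<^sup>2\<close>.
\<close>

lemma norm_one_minus_square: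
  assumes h: "star h = h" "N h \<le> 1" shows "N (e - h \<odot> h) \<le> 1"
proof -
  have Nhh: "N (h \<odot> h) \<le> 1" using N_mul_mono[OF h(2) h(2)] by simp
  have quad: "N (e - rs \<sigma> (h \<odot> h)) \<le> 1 + \<sigma>\<^sup>2" if "\<sigma> \<ge> 0" for \<sigma>
  proof -
    define p where "p = e - rs \<sigma> (h \<odot> h)"
    define q where "q = sc (\<i> * of_real (sqrt (2 * \<sigma>))) h"
    have sp: "star p = p" by (simp add: p_def star_diff star_rs star_mul h)
    have sq: "star q = - q" by (simp add: q_def star_sc h)
    have "p \<odot> h = h \<odot> p" by (simp add: p_def mul_diff mul_rs mul_assoc)
    hence pq: "p \<odot> q = q \<odot> p" by (simp add: q_def mul_sc_left mul_sc_right)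
    have "complex_of_real (sqrt (2 * \<sigma>)) * of_real (sqrt (2 * \<sigma>)) = of_real (2 * \<sigma>)"
      using that by (simp only: of_real_mult[symmetric]) simp
    moreover have "(\<i> * x) * (\<i> * x) = - (x * x)" for x
      by (simp add: complex_eq_iff)
    ultimately have "(\<i> * of_real (sqrt (2 * \<sigma>))) * (\<i> * of_real (sqrt (2 * \<sigma>))) = - of_real (2 * \<sigma>)"
      by (simp only:)
    hence qq: "q \<odot> q = - rs (2 * \<sigma>) (h \<odot> h)"
      unfolding q_def mul_sc_left mul_sc_right scale_scale rs_def by (simp only: scale_minus_left)
    have pp: "p \<odot> p = e - rs (2 * \<sigma>) (h \<odot> h) + rs (\<sigma>\<^sup>2) (h \<odot> h \<odot> (h \<odot> h))"
      using rs_add_left[of \<sigma> \<sigma> "h \<odot> h"] by (simp add: p_def mul_diff mul_rs rs_rs rs_diff_right power2_eq_square)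
    have "star (p + q) \<odot> (p + q) = p \<odot> p - q \<odot> q"
      by (simp add: star_add sp sq mul_add_left mul_add_right mul_minus mul_diff pq)
    also have "\<dots> = e + rs (\<sigma>\<^sup>2) (h \<odot> h \<odot> (h \<odot> h))" by (simp add: qq pp)
    also have "N \<dots> \<le> 1 + \<sigma>\<^sup>2 * 1"
      using N_mul_mono[OF Nhh Nhh]
      by - (rule order_trans[OF N_triangle], rule add_mono, auto simp: N_rs intro: mult_left_le)
    finally have "(N (p + q))\<^sup>2 \<le> 1 + \<sigma>\<^sup>2" by (simp add: N_cstar)
    also have "\<dots> \<le> (1 + \<sigma>\<^sup>2)\<^sup>2" by (rule self_le_power) simp_all
    finally have 1: "N (p + q) \<le> 1 + \<sigma>\<^sup>2" by (rule power2_le_imp_le) simp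
    have "p = rs (1/2) ((p + q) + star (p + q))"
      by (simp add: star_add sp sq rs_add_right flip: rs_add_left)
    hence "N p = N (rs (1/2) ((p + q) + star (p + q)))" by (rule arg_cong)
    also have "\<dots> \<le> N (p + q)"
      using N_triangle[of "p + q" "star (p + q)"] by (simp only: N_rs N_star)
    finally show ?thesis using 1 by (simp add: p_def)
  qed
  define b where "b = e - h \<odot> h"
  have lin: "N b \<le> 1 + 2 * s" if s: "0 < s" "s \<le> 1" for s
  proof -
    have "N (rs s b) \<le> s * (1 + 2 * s)"
    proof (rule sa_norm_le)
      show "star (rs s b) = rs s b" by (simp add: star_rs b_def star_diff star_mul h)
      \<comment> \<open>Chosen such that \<open>e + s b\<close> is a multiple of \<open>e - \<sigma> h\<^sup>2\<close>.\<close>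
      define \<sigma> where "\<sigma> = s / (1 + s)"
      have \<sigma>: "0 \<le> \<sigma>" "\<sigma> \<le> s" "(1 + s) * \<sigma> = s" using s by (auto simp: \<sigma>_def field_simps)
      have "e + rs s b = rs (1 + s) (e - rs \<sigma> (h \<odot> h))"
        by (simp only: rs_diff_right rs_rs \<sigma>) (simp add: b_def rs_simps)
      hence "N (e + rs s b) \<le> (1 + s) * (1 + \<sigma>\<^sup>2)"
        using s quad[OF \<sigma>(1)] by (simp add: N_rs)
      also have "\<dots> \<le> (1 + s) * (1 + s\<^sup>2)"
        using s \<sigma> by (intro mult_left_mono add_left_mono power_mono) auto
      also have "\<dots> \<le> 1 + s * (1 + 2 * s)"
        using s mult_mono[of s 1 "s^2" "s^2"] by (simp add: power2_eq_square algebra_simps)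
      finally show "N (e + rs s b) \<le> 1 + s * (1 + 2 * s)" .
      have "e - rs s b = rs (1 - s) e + rs s (h \<odot> h)" by (simp add: b_def rs_simps)
      also have "N \<dots> \<le> (1 - s) * 1 + s * 1"
        using s Nhh by - (rule order_trans[OF N_triangle], rule add_mono, auto simp: N_rs)
      also have "\<dots> \<le> 1 + s * (1 + 2 * s)" using s by simp
      finally show "N (e - rs s b) \<le> 1 + s * (1 + 2 * s)" .
    qed
    thus ?thesis using s by (simp add: N_rs)
  qed
  show ?thesis
  proof (rule field_le_epsilon)
    fix \<epsilon> :: real assume "\<epsilon> > 0"
    define s where "s = min 1 (\<epsilon> / 2)"
    have "0 < s" "s \<le> 1" "s \<le> \<epsilon> / 2" using \<open>\<epsilon> > 0\<close> by (auto simp: s_def)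
    thus "N (e - h \<odot> h) \<le> 1 + \<epsilon>" using lin[of s] unfolding b_def by linarith
  qed
qed

lemma pos_square:
  assumes "star h = h" shows "pos (h \<odot> h)"
proof -
  define c where "c = N h + 1"
  have c: "c > 0" using N_nonneg[of h] by (simp add: c_def add_nonneg_pos)
  define h' where "h' = rs (1 / c) h"
  have h': "star h' = h'" "N h' \<le> 1" "h = rs c h'"
    using assms c by (simp_all add: h'_def star_rs N_rs rs_cancel field_simps) (simp add: c_def)
  have "pos (h' \<odot> h')" unfolding pos_def
    using norm_one_minus_square[OF h'(1,2)] by (auto intro!: exI[of _ 1] simp: star_mul h')
  hence "pos (rs (c * c) (h' \<odot> h'))" using c by (intro pos_rs) auto
  thus ?thesis by (simp add: h'(3) mul_rs rs_rs)
qed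

text \<open>
  For small \<open>s\<close>, \<open>e + s a\<close> is the mean of \<open>e + 2 s (a + b)\<close> and \<open>e - 2 s b\<close>, of which the second is a
  contraction.
\<close>

lemma pos_norm_mono:
  assumes "pos a" "pos b" shows "N a \<le> N (a + b)"
proof -
  obtain S where S: "S > 0" "\<forall>s\<ge>0. s * S \<le> 1 \<longrightarrow> N (e - rs s a) \<le> 1"
    using pos_small[OF assms(1)] by blast
  obtain T where T: "T > 0" "\<forall>s\<ge>0. s * T \<le> 1 \<longrightarrow> N (e - rs s b) \<le> 1"
    using pos_small[OF assms(2)] by blast
  define s where "s = 1 / (S + 2 * T)"
  have s: "s > 0" "s * S \<le> 1" "(2 * s) * T \<le> 1" using S(1) T(1) by (auto simp: s_def field_simps)
  have "N (rs s a) \<le> s * N (a + b)"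
  proof (rule sa_norm_le)
    show "star (rs s a) = rs s a" using pos_sa[OF assms(1)] by (simp add: star_rs)
    have "e + rs s a = rs (1/2) ((e + rs (2 * s) (a + b)) + (e - rs (2 * s) b))"
    proof -
      have "rs (1/2) ((e + rs (2 * s) (a + b)) + (e - rs (2 * s) b)) = rs (1/2) (rs 2 e + rs (2 * s) a)"
        by (simp add: rs_2 rs_add_right algebra_simps)
      thus ?thesis by (simp add: rs_add_right rs_rs)
    qed
    hence "N (e + rs s a) = 1/2 * N ((e + rs (2 * s) (a + b)) + (e - rs (2 * s) b))"
      by (simp only: N_rs)
    also have "\<dots> \<le> 1/2 * ((1 + (2 * s) * N (a + b)) + 1)"
    proof -
      have "N (e + rs (2 * s) (a + b)) \<le> 1 + (2 * s) * N (a + b)"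
        using N_triangle[of e "rs (2 * s) (a + b)"] s by (simp add: N_rs)
      moreover have "N (e - rs (2 * s) b) \<le> 1" using T(2)[rule_format, of "2 * s"] s by simp
      ultimately have "N ((e + rs (2 * s) (a + b)) + (e - rs (2 * s) b)) \<le> (1 + (2 * s) * N (a + b)) + 1"
        by (rule order_trans[OF N_triangle add_mono])
      thus ?thesis by (rule mult_left_mono) simp
    qed
    also have "\<dots> = 1 + s * N (a + b)" by simp
    finally show "N (e + rs s a) \<le> 1 + s * N (a + b)" .
    have "0 \<le> s * N (a + b)" using s by simp
    thus "N (e - rs s a) \<le> 1 + s * N (a + b)" using S(2)[rule_format, of s] s by linarith
  qed
  thus ?thesis using s by (simp add: N_rs)
qed

lemma pos_norm_le: "pos a \<Longrightarrow> pos (b - a) \<Longrightarrow> N a \<le> N b"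
  using pos_norm_mono[of a "b - a"] by simp

lemma sqrt_unit_ball:
  assumes z: "star z = z" "N (e - z) \<le> 1"
  obtains d where "star d = d" "d \<odot> d = z" "N (e - d) \<le> 1" "\<And>w. w \<odot> z = z \<odot> w \<Longrightarrow> w \<odot> d = d \<odot> w"
proof -
  define x where "x = e - z"
  have sx: "star x = x" by (simp add: x_def star_diff z)
  have "ppow x k = upow x (Suc k)" for k
    by (induction k) (simp_all add: upow_Suc ppow_Suc)
  hence Nx: "N (ppow x k) \<le> 1" for k
    using N_upow_le[of x "Suc k"] power_le_one[of "N x" "Suc k"] z(2) by (simp add: x_def)
  obtain y where y: "N (y + y - y \<odot> y - x) = 0" "N (star y - y) = 0" "N y \<le> 1"
    "\<And>w. w \<odot> x = x \<odot> w \<Longrightarrow> N (w \<odot> y - y \<odot> w) = 0"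
    using sqrt_series[OF sx Nx] by blast
  have y1: "x = y + y - y \<odot> y" using N_eq_0[OF y(1)] by simp
  have y2: "star y = y" using N_eq_0[OF y(2)] by simp
  have y4: "w \<odot> y = y \<odot> w" if "w \<odot> z = z \<odot> w" for w
    using N_eq_0[OF y(4)[of w]] that by (simp add: x_def mul_diff)
  show ?thesis
  proof
    show "star (e - y) = e - y" by (simp add: star_diff y2)
    have "z = e - x" by (simp add: x_def)
    thus "(e - y) \<odot> (e - y) = z" by (simp add: mul_diff y1)
    show "N (e - (e - y)) \<le> 1" using y(3) by simp
    show "w \<odot> (e - y) = (e - y) \<odot> w" if "w \<odot> z = z \<odot> w" for w
      using y4[OF that] by (simp add: mul_diff)
  qed
qed

lemma pos_sqrt:
  assumes "pos a"
  obtains d where "star d = d" "d \<odot> d = a" "pos d" "\<And>w. w \<odot> a = a \<odot> w \<Longrightarrow> w \<odot> d = d \<odot> w"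
proof -
  obtain T where T: "T > 0" "\<forall>t\<ge>T. N (rs t e - a) \<le> t"
    using pos_witness[OF assms] by blast
  define z where "z = rs (1 / T) a"
  have z: "star z = z" by (simp add: z_def star_rs pos_sa[OF assms])
  have "e - z = rs (1 / T) (rs T e - a)" using T(1) by (simp add: z_def rs_simps)
  also have "N \<dots> \<le> 1" using T by (simp add: N_rs field_simps)
  finally obtain d where d: "star d = d" "d \<odot> d = z" "N (e - d) \<le> 1" "\<And>w. w \<odot> z = z \<odot> w \<Longrightarrow> w \<odot> d = d \<odot> w"
    using sqrt_unit_ball[OF z] by blast
  show ?thesis
  proof
    show "star (rs (sqrt T) d) = rs (sqrt T) d" by (simp add: star_rs d)
    show "rs (sqrt T) d \<odot> rs (sqrt T) d = a"
      using T(1) by (simp add: mul_rs rs_rs d(2) z_def)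
    have "pos d" unfolding pos_def using d(1,3) by (auto intro: exI[of _ 1])
    thus "pos (rs (sqrt T) d)" using T by (intro pos_rs) auto
    show "w \<odot> rs (sqrt T) d = rs (sqrt T) d \<odot> w" if "w \<odot> a = a \<odot> w" for w
      using d(4)[of w] that by (simp add: z_def mul_rs)
  qed
qed

lemma star_mul_eq_0: "star x \<odot> x = 0 \<Longrightarrow> x = 0"
  using N_cstar[of x] N_eq_0[of x] by simp

lemma square_eq_0: "star x = x \<Longrightarrow> x \<odot> x = 0 \<Longrightarrow> x = 0"
  using star_mul_eq_0[of x] by simp

text \<open>
  Since \<open>y\<close> intertwines \<open>e + s (y \<odot> star y)\<close> with the contraction \<open>e + s (star y \<odot> y)\<close>, the powers of the
  former grow at most linearly. It is self-adjoint, so it is a contraction as well, and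
  \<open>sa_norm_le\<close> forces \<open>y \<odot> star y\<close> to vanish.
\<close>

lemma no_negative_star_mul:
  assumes neg: "pos (- (star y \<odot> y))" and p: "pos (y \<odot> star y)"
  shows "y = 0"
proof -
  let ?c = "y \<odot> star y"
  obtain S where S: "S > 0" "\<forall>s\<ge>0. s * S \<le> 1 \<longrightarrow> N (e - rs s (- (star y \<odot> y))) \<le> 1"
    using pos_small[OF neg] by blast
  obtain T where T: "T > 0" "\<forall>s\<ge>0. s * T \<le> 1 \<longrightarrow> N (e - rs s ?c) \<le> 1"
    using pos_small[OF p] by blast
  define s where "s = 1 / (S + T)"
  have s: "s > 0" "s * S \<le> 1" "s * T \<le> 1" using S(1) T(1) by (auto simp: s_def field_simps)
  define D where "D = e + rs s ?c"
  define g where "g = e + rs s (star y \<odot> y)"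
  have Ng: "N g \<le> 1" using S(2)[rule_format, of s] s by (simp add: g_def rs_minus)
  have Dy: "D \<odot> y = y \<odot> g" by (simp add: D_def g_def mul_add_left mul_add_right mul_rs mul_assoc)
  have inter: "upow D n \<odot> y = y \<odot> upow g n" for n
    by (induction n) (simp_all add: upow_Suc mul_assoc, metis Dy mul_assoc)
  have growth: "N (upow D n) \<le> s * (N y)\<^sup>2 * real n + 1" for n
  proof (induction n)
    case (Suc n)
    have "upow D (Suc n) = upow D n \<odot> D" by (rule upow_Suc2)
    also have "\<dots> = upow D n + rs s (upow D n \<odot> y \<odot> star y)"
      by (simp add: D_def mul_add_right mul_rs mul_assoc)
    also have "\<dots> = upow D n + rs s (y \<odot> upow g n \<odot> star y)" by (simp add: inter)
    also have "N \<dots> \<le> (s * (N y)\<^sup>2 * real n + 1) + s * (N y * 1 * N y)"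
    proof (rule order_trans[OF N_triangle add_mono[OF Suc]])
      have "N (upow g n) \<le> 1" using N_upow_le[of g n] power_le_one[OF N_nonneg Ng, of n] by linarith
      hence "N (y \<odot> upow g n \<odot> star y) \<le> N y * 1 * N y"
        by (intro N_mul_mono) (auto simp: N_star)
      thus "N (rs s (y \<odot> upow g n \<odot> star y)) \<le> s * (N y * 1 * N y)"
        using s by (simp add: N_rs)
    qed
    finally show ?case by (simp add: power2_eq_square algebra_simps)
  qed simp
  have sD: "star D = D" by (simp add: D_def star_add star_rs star_mul star_star)
  have ND: "N D \<le> 1"
    by (rule le_of_power_le_linear[of 1 "N D" "s * (N y)\<^sup>2" 1]) (use growth in \<open>simp_all add: N_upow_sa[OF sD]\<close>)
  have "N (rs s ?c) \<le> 0"
  proof (rule sa_norm_le)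
    show "star (rs s ?c) = rs s ?c" by (simp add: star_rs star_mul star_star)
    show "N (e + rs s ?c) \<le> 1 + 0" using ND by (simp add: D_def)
    show "N (e - rs s ?c) \<le> 1 + 0" using T(2)[rule_format, of s] s by simp
  qed
  hence "N ?c = 0" using s N_nonneg[of ?c] by (auto simp: N_rs mult_le_0_iff)
  hence "?c = 0" by (rule N_eq_0)
  hence "star y = 0" using star_mul_eq_0[of "star y"] by (simp add: star_star)
  thus ?thesis by (metis star_star star_zero)
qed

text \<open>
  Let \<open>a = star x \<odot> x\<close>, let \<open>p\<close> be the positive square root of \<open>a\<^sup>2\<close>, and let \<open>n = p - a\<close>, which is
  twice the negative part of \<open>a\<close>. For \<open>y = x \<odot> n\<close> the product \<open>star y \<odot> y\<close> is the negative of a square,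
  while \<open>y \<odot> star y + star y \<odot> y\<close> is a sum of squares; hence \<open>y = 0\<close> by the previous lemma, and then
  \<open>n = 0\<close>.
\<close>

theorem pos_star_mul: "pos (star x \<odot> x)"
proof -
  define a where "a = star x \<odot> x"
  have sa: "star a = a" by (simp add: a_def star_mul star_star)
  obtain p where p: "star p = p" "p \<odot> p = a \<odot> a" "pos p" "a \<odot> p = p \<odot> a"
    using pos_sqrt[OF pos_square[OF sa]] by (metis mul_assoc)
  obtain q where q: "star q = q" "q \<odot> q = p" "\<And>w. w \<odot> p = p \<odot> w \<Longrightarrow> w \<odot> q = q \<odot> w"
    using pos_sqrt[OF p(3)] by blast
  define n where "n = p - a"
  have sn: "star n = n" by (simp add: n_def star_diff p sa)
  have np: "n \<odot> p = p \<odot> n" by (simp add: n_def mul_diff p)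
  have nq: "n \<odot> q = q \<odot> n" by (rule q(3)[OF np])
  \<comment> \<open>On the range of \<open>n\<close>, \<open>a\<close> acts as the negative of its absolute value \<open>p\<close>.\<close>
  have an: "a \<odot> n = - (p \<odot> n)" by (simp add: n_def mul_diff p)
  have sqn: "star (q \<odot> n) = q \<odot> n" by (simp add: star_mul sn q nq)
  define y where "y = x \<odot> n"
  have "star y \<odot> y = n \<odot> (a \<odot> n)" by (simp add: y_def a_def star_mul sn mul_assoc)
  also have "\<dots> = - ((n \<odot> q) \<odot> (q \<odot> n))" by (simp add: an mul_minus mul_assoc flip: q(2))
  finally have yy: "- (star y \<odot> y) = (q \<odot> n) \<odot> (q \<odot> n)" by (simp add: nq)
  hence neg: "pos (- (star y \<odot> y))" using pos_square[OF sqn] by simp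
  \<comment> \<open>Twice the real and, up to sign, the imaginary part of \<open>y\<close>.\<close>
  define h where "h = y + star y"
  define k where "k = sc \<i> (y - star y)"
  have sh: "star h = h" by (simp add: h_def star_add star_star)
  have sk: "star k = k" by (simp add: k_def star_sc star_diff star_star scale_right_diff_distrib)
  have "h \<odot> h + k \<odot> k = (y \<odot> star y + star y \<odot> y) + (y \<odot> star y + star y \<odot> y)"
    by (simp add: h_def k_def mul_sc_left mul_sc_right mul_add_left mul_add_right mul_diff scale_right_diff_distrib)
  hence "y \<odot> star y = rs (1/2) (h \<odot> h + k \<odot> k) + (- (star y \<odot> y))"
    by (simp only: rs_half) simp
  moreover have "pos (rs (1/2) (h \<odot> h + k \<odot> k) + (- (star y \<odot> y)))"
    by (intro pos_add pos_rs pos_square sh sk neg) simp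
  ultimately have "pos (y \<odot> star y)" by simp
  hence "y = 0" by (rule no_negative_star_mul[OF neg])
  hence "(q \<odot> n) \<odot> (q \<odot> n) = 0" using yy by simp
  hence "q \<odot> n = 0" by (rule square_eq_0[OF sqn])
  hence pn: "p \<odot> n = 0" by (metis q(2) mul_assoc mul_zero(2))
  have "n \<odot> n = p \<odot> n - a \<odot> n" by (simp add: n_def mul_diff)
  hence "n \<odot> n = 0" by (simp add: an pn)
  hence "n = 0" by (rule square_eq_0[OF sn])
  thus ?thesis using p(3) by (simp add: n_def a_def)
qed

lemma pos_mul_star: "pos (x \<odot> star x)"
  using pos_star_mul[of "star x"] by (simp add: star_star)

lemma pos_conj: assumes "pos a" shows "pos (star c \<odot> a \<odot> c)"
proof -
  obtain d where d: "star d = d" "d \<odot> d = a" using pos_sqrt[OF assms] by blast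
  have "star (d \<odot> c) \<odot> (d \<odot> c) = star c \<odot> (d \<odot> d) \<odot> c" by (simp only: star_mul d(1) mul_assoc)
  thus ?thesis using pos_star_mul[of "d \<odot> c"] by (simp only: d(2))
qed

lemma N_star_mul_commute: "N (star x \<odot> x) = N (x \<odot> star x)"
proof -
  have "N (star (star x) \<odot> star x) = (N (star x))\<^sup>2" by (rule N_cstar)
  thus ?thesis by (simp only: star_star N_star N_cstar)
qed

end

section \<open>Approximate units\<close>

context unital_cstar_algebra
begin

text \<open>
  Again \<open>sa_norm_le\<close> for a small multiple of \<open>x\<close>: after normalization, \<open>e + s x\<close> and \<open>e - s x\<close> differ from
  \<open>e\<close> by small multiples of positive elements.
\<close>

lemma norm_leI_pos:
  assumes "star x = x" "pos (rs t e + x)" "pos (rs t e - x)" "t \<ge> 0" shows "N x \<le> t"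
proof -
  obtain S where S: "S > 0" "\<forall>s\<ge>0. s * S \<le> 1 \<longrightarrow> N (e - rs s (rs t e + x)) \<le> 1"
    using pos_small[OF assms(2)] by blast
  obtain T where T: "T > 0" "\<forall>s\<ge>0. s * T \<le> 1 \<longrightarrow> N (e - rs s (rs t e - x)) \<le> 1"
    using pos_small[OF assms(3)] by blast
  define s where "s = 1 / (S + T)"
  have s: "s > 0" "s * S \<le> 1" "s * T \<le> 1" using S(1) T(1) by (auto simp: s_def field_simps)
  define r where "r = s / (1 + s * t)"
  have st: "1 + s * t > 0" using s(1) assms(4) by (simp add: add_pos_nonneg)
  have r: "r \<ge> 0" "(1 + s * t) * r = s" using s(1) st by (simp_all add: r_def)
  have "r \<le> s" using s(1) assms(4) by (simp add: r_def divide_simps mult_le_cancel_left1 add_pos_nonneg)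
  hence rST: "r * S \<le> 1" "r * T \<le> 1"
    using s mult_right_mono[of r s S] mult_right_mono[of r s T] S(1) T(1) by linarith+
  have "N (rs s x) \<le> s * t"
  proof (rule sa_norm_le)
    show "star (rs s x) = rs s x" by (simp add: star_rs assms)
    have "rs (1 + s * t) (e - rs r (rs t e - x)) = rs (1 + s * t) e - rs s (rs t e - x)"
      by (simp only: rs_diff_right rs_rs[of "1 + s * t" r] r(2))
    hence "e + rs s x = rs (1 + s * t) (e - rs r (rs t e - x))"
      by (simp add: rs_add_left rs_diff_right rs_rs)
    thus "N (e + rs s x) \<le> 1 + s * t"
      using T(2)[rule_format, OF r(1) rST(2)] st by (simp add: N_rs)
    have "rs (1 + s * t) (e - rs r (rs t e + x)) = rs (1 + s * t) e - rs s (rs t e + x)"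
      by (simp only: rs_diff_right rs_rs[of "1 + s * t" r] r(2))
    hence "e - rs s x = rs (1 + s * t) (e - rs r (rs t e + x))"
      by (simp add: rs_add_left rs_add_right rs_rs)
    thus "N (e - rs s x) \<le> 1 + s * t"
      using S(2)[rule_format, OF r(1) rST(1)] st by (simp add: N_rs)
  qed
  thus ?thesis using s(1) by (simp add: N_rs)
qed

lemma pos_e_minus: "pos c \<Longrightarrow> N c \<le> 1 \<Longrightarrow> pos (e - c)"
  using pos_diff_of_norm[of c 1] by (simp add: pos_sa)

lemma norm_e_minus: "pos c \<Longrightarrow> N c \<le> 1 \<Longrightarrow> N (e - c) \<le> 1"
  using pos_norm_diff[of c 1] by simp

lemma upow_sqrt:
  assumes "\<delta> \<odot> \<delta> = d" shows "upow d n = upow \<delta> n \<odot> upow \<delta> n"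
proof -
  have "upow d n = upow \<delta> (n + n)"
  proof (induction n)
    case (Suc n)
    have "upow \<delta> (Suc n + Suc n) = \<delta> \<odot> (\<delta> \<odot> upow \<delta> (n + n))" by (simp add: upow_Suc)
    thus ?case using Suc assms by (simp add: upow_Suc mul_assoc[symmetric])
  qed simp
  thus ?thesis by (simp add: upow_add)
qed

lemma pos_upow: assumes "pos d" shows "pos (upow d n)"
proof -
  obtain \<delta> where \<delta>: "star \<delta> = \<delta>" "\<delta> \<odot> \<delta> = d" using pos_sqrt[OF assms] by metis
  show ?thesis unfolding upow_sqrt[OF \<delta>(2)] by (rule pos_square[OF star_upow[OF \<delta>(1)]])
qed

lemma norm_upow_le_one: "N d \<le> 1 \<Longrightarrow> N (upow d n) \<le> 1"
  using N_upow_le[of d n] power_le_one[OF N_nonneg, of d n] by linarith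

text \<open>
  The elements \<open>(e - c) ^ k \<odot> c\<close> decrease with \<open>k\<close>, and the first \<open>n\<close> of them add up to \<open>e - (e - c) ^ n\<close>.
\<close>

lemma complement_power_norm:
  assumes c: "pos c" "N c \<le> 1"
  shows "real n * N (upow (e - c) n \<odot> c) \<le> 1"
proof -
  define d where "d = e - c"
  have d: "pos d" "N d \<le> 1" using pos_e_minus[OF c] norm_e_minus[OF c] by (simp_all add: d_def)
  obtain \<delta> where \<delta>: "star \<delta> = \<delta>" "\<delta> \<odot> \<delta> = d" "\<And>w. w \<odot> d = d \<odot> w \<Longrightarrow> w \<odot> \<delta> = \<delta> \<odot> w"
    using pos_sqrt[OF d(1)] by metis
  obtain y where y: "star y = y" "y \<odot> y = c" "\<And>w. w \<odot> c = c \<odot> w \<Longrightarrow> w \<odot> y = y \<odot> w"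
    using pos_sqrt[OF c(1)] by metis
  define t where "t k = upow d k \<odot> c" for k
  have c\<delta>: "c \<odot> \<delta> = \<delta> \<odot> c" by (rule \<delta>(3)) (simp add: d_def mul_diff)
  have c\<delta>k: "c \<odot> upow \<delta> k = upow \<delta> k \<odot> c" for k by (rule upow_commute[OF c\<delta>])
  have t: "t k = star (upow \<delta> k) \<odot> c \<odot> upow \<delta> k" for k
    unfolding t_def upow_sqrt[OF \<delta>(2)] star_upow[OF \<delta>(1)] by (simp only: mul_assoc c\<delta>k)
  have dec: "pos (t k - t (Suc k))" for k
  proof -
    have "t k - t (Suc k) = upow d k \<odot> (c \<odot> c)"
      by (simp only: t_def upow_Suc2) (simp add: d_def mul_diff mul_assoc)
    also have "\<dots> = star (upow \<delta> k) \<odot> (c \<odot> c) \<odot> upow \<delta> k"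
      unfolding upow_sqrt[OF \<delta>(2)] star_upow[OF \<delta>(1)] by (simp only: mul_assoc c\<delta>k) (metis c\<delta>k mul_assoc)
    finally show ?thesis using pos_conj[OF pos_square[OF pos_sa[OF c(1)]]] by simp
  qed
  have dec': "pos (t k - t (k + j))" for k j
  proof (induction j)
    case (Suc j)
    have eq: "t k - t (k + Suc j) = (t k - t (k + j)) + (t (k + j) - t (Suc (k + j)))" by simp
    show ?case unfolding eq by (rule pos_add[OF Suc dec])
  qed simp
  have tele: "(\<Sum>k<n. t k) = e - upow d n"
  proof (induction n)
    case (Suc n)
    have "t n = upow d n - upow d (Suc n)" by (simp add: t_def upow_Suc2 d_def mul_diff)
    thus ?case using Suc by simp
  qed simp
  have "(\<Sum>k<m. x) = rs (real m) x" for m x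
    by (induction m) (simp_all add: rs_add_left add.commute)
  hence "real n * N (t n) = N (\<Sum>k<n. t n)" by (simp add: N_rs)
  also have "\<dots> \<le> N (\<Sum>k<n. t k)"
  proof (rule pos_norm_le)
    show "pos (\<Sum>k<n. t n)" by (rule pos_sum) (simp only: t pos_conj c)
    have "pos (t k - t n)" if "k < n" for k using dec'[of k "n - k"] that by simp
    thus "pos ((\<Sum>k<n. t k) - (\<Sum>k<n. t n))" unfolding sum_subtractf[symmetric] by (intro pos_sum) auto
  qed
  also have "\<dots> \<le> 1" unfolding tele by (intro norm_e_minus pos_upow d norm_upow_le_one)
  finally show ?thesis by (simp add: t_def d_def)
qed

text \<open>
  The element \<open>h = e - (e - c) ^ n\<close> is almost a unit for every \<open>g \<in> Q\<close>, since \<open>g\<close> is at most a multiple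
  of \<open>c\<close>. Hence \<open>g\<close> is close to \<open>h \<odot> g \<odot> h \<le> h\<^sup>2\<close>, and \<open>2 h\<^sup>2 \<le> e + h\<close>. The resulting inequality
  \<open>2 g \<le> e + h\<close>, up to \<open>\<epsilon>\<close>, is expressed by a norm so that it survives weak* limits.
\<close>

lemma dominating_contraction:
  assumes Q: "finite Q" "\<And>g. g \<in> Q \<Longrightarrow> pos g \<and> N g \<le> 1" and \<epsilon>: "\<epsilon> > 0"
    and c_mean: "c = rs (1 / real (Suc (card Q))) (\<Sum>g\<in>Q. g)"
  shows "\<exists>n. (\<forall>g\<in>Q. N ((e - upow (e - c) n) - (g + g)) \<le> 1 + \<epsilon>) \<and> N (e - upow (e - c) n) \<le> 1"
proof -
  define M where "M = real (Suc (card Q))"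
  have M: "M > 0" by (simp add: M_def)
  have c_def: "c = rs (1 / M) (\<Sum>g\<in>Q. g)" by (simp add: c_mean M_def)
  have cpos: "pos c" unfolding c_def using Q M by (intro pos_rs pos_sum) auto
  have "N (\<Sum>g\<in>Q. g) \<le> (\<Sum>g\<in>Q. 1)" using Q by (intro order_trans[OF N_sum sum_mono]) auto
  hence cN: "N c \<le> 1" using M by (simp add: c_def N_rs M_def divide_simps)
  define d where "d = e - c"
  have d: "pos d" "N d \<le> 1" using pos_e_minus[OF cpos cN] norm_e_minus[OF cpos cN] by (simp_all add: d_def)
  have sd: "star d = d" by (rule pos_sa[OF d(1)])
  obtain \<delta> where \<delta>: "star \<delta> = \<delta>" "\<delta> \<odot> \<delta> = d" using pos_sqrt[OF d(1)] by metis
  \<comment> \<open>This makes \<open>M / n\<close>, the bound on \<open>N (D \<odot> g)\<^sup>2\<close> below, at most \<open>(\<epsilon> / 4)\<^sup>2\<close>.\<close>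
  obtain n :: nat where n: "n > 0" "16 * M / \<epsilon>\<^sup>2 < real n"
    using reals_Archimedean2[of "max 0 (16 * M / \<epsilon>\<^sup>2)"] by auto
  define D where "D = upow d n"
  define h where "h = e - D"
  have D: "pos D" "N D \<le> 1" "star D = D"
    using pos_upow[OF d(1)] norm_upow_le_one[OF d(2)] star_upow[OF sd] by (simp_all add: D_def)
  have h: "pos h" "N h \<le> 1" using pos_e_minus[OF D(1,2)] norm_e_minus[OF D(1,2)] by (simp_all add: h_def)
  have sh: "star h = h" by (rule pos_sa[OF h(1)])
  have main: "N (h - (g + g)) \<le> 1 + \<epsilon>" if "g \<in> Q" for g
  proof -
    have g: "pos g" "N g \<le> 1" "star g = g" using Q(2)[OF that] pos_sa by auto
    define \<eta> where "\<eta> = N (D \<odot> g)"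
    have "\<eta>\<^sup>2 \<le> M / real n"
    proof -
      have "\<eta>\<^sup>2 = N (star (D \<odot> g) \<odot> (D \<odot> g))" by (simp add: \<eta>_def N_cstar)
      also have "\<dots> = N ((D \<odot> g) \<odot> star (D \<odot> g))" by (rule N_star_mul_commute)
      also have "\<dots> = N (star D \<odot> (g \<odot> g) \<odot> D)" by (simp add: star_mul D g mul_assoc)
      also have "\<dots> \<le> N (star D \<odot> g \<odot> D)"
      proof (rule pos_norm_le)
        show "pos (star D \<odot> (g \<odot> g) \<odot> D)" by (intro pos_conj pos_square g)
        obtain \<gamma> where \<gamma>: "star \<gamma> = \<gamma>" "\<gamma> \<odot> \<gamma> = g" using pos_sqrt[OF g(1)] by metis
        have "star \<gamma> \<odot> (e - g) \<odot> \<gamma> = \<gamma> \<odot> \<gamma> - \<gamma> \<odot> (\<gamma> \<odot> \<gamma>) \<odot> \<gamma>" by (simp only: \<gamma> mul_diff e_right)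
        also have "\<dots> = g - g \<odot> g" by (simp only: \<gamma>(2)[symmetric] mul_assoc)
        finally have "pos (g - g \<odot> g)" using pos_conj[OF pos_e_minus[OF g(1,2)], of \<gamma>] by simp
        hence "pos (star D \<odot> (g - g \<odot> g) \<odot> D)" by (rule pos_conj)
        thus "pos (star D \<odot> g \<odot> D - star D \<odot> (g \<odot> g) \<odot> D)" by (simp only: mul_diff)
      qed
      also have "\<dots> \<le> N (star D \<odot> rs M c \<odot> D)"
      proof (rule pos_norm_le)
        show "pos (star D \<odot> g \<odot> D)" by (intro pos_conj g)
        have "rs M c - g = (\<Sum>g\<in>Q. g) - g" using M by (simp add: c_def rs_rs)
        also have "\<dots> = (\<Sum>g\<in>Q - {g}. g)" using Q(1) that by (simp add: sum_diff1)
        finally have "pos (rs M c - g)" using Q(2) by (auto intro!: pos_sum)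
        hence "pos (star D \<odot> (rs M c - g) \<odot> D)" by (rule pos_conj)
        thus "pos (star D \<odot> rs M c \<odot> D - star D \<odot> g \<odot> D)" by (simp only: mul_diff)
      qed
      also have "\<dots> = M * N (D \<odot> (D \<odot> c))"
      proof -
        have "c \<odot> d = d \<odot> c" by (simp add: d_def mul_diff)
        hence "c \<odot> D = D \<odot> c" unfolding D_def by (rule upow_commute)
        hence "star D \<odot> rs M c \<odot> D = rs M (D \<odot> (D \<odot> c))" by (simp add: mul_rs D mul_assoc)
        thus ?thesis using M by (simp add: N_rs)
      qed
      also have "\<dots> \<le> M * N (D \<odot> c)"
        using M N_mul_mono[OF D(2) order_refl, of "D \<odot> c"] by (intro mult_left_mono) auto
      also have "\<dots> \<le> M * (1 / real n)"
        using complement_power_norm[OF cpos cN, of n] n(1) M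
        by (intro mult_left_mono) (auto simp: D_def d_def field_simps)
      finally show ?thesis by simp
    qed
    also have "\<dots> \<le> (\<epsilon> / 4)\<^sup>2" using n \<epsilon> by (simp add: field_simps power2_eq_square)
    finally have \<eta>: "\<eta> \<le> \<epsilon> / 4" by (rule power2_le_imp_le) (use \<epsilon> in simp)
    define r where "r = g - h \<odot> g \<odot> h"
    have sr: "star r = r" by (simp add: r_def star_diff star_mul sh g mul_assoc)
    have "r = D \<odot> g + h \<odot> g \<odot> D" by (simp add: r_def h_def mul_diff)
    hence "N r \<le> N (D \<odot> g) + N (h \<odot> g \<odot> D)" by (simp add: N_triangle)
    also have "N (h \<odot> g \<odot> D) \<le> 1 * N (g \<odot> D)" unfolding mul_assoc by (intro N_mul_mono h order_refl)
    also have "N (g \<odot> D) = \<eta>"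
      using N_star[of "D \<odot> g"] by (simp add: \<eta>_def star_mul D g)
    finally have Nr: "N r \<le> \<epsilon> / 2" using \<eta> by (simp add: \<eta>_def)
    show ?thesis
    proof (rule norm_leI_pos)
      show "star (h - (g + g)) = h - (g + g)" by (simp add: star_diff star_add sh g)
      have eq: "rs (1 + \<epsilon>) e - (h - (g + g)) = (D + (g + g)) + rs \<epsilon> e"
        by (simp add: h_def rs_add_left)
      show "pos (rs (1 + \<epsilon>) e - (h - (g + g)))"
        unfolding eq using \<epsilon> by (intro pos_add D g pos_rs pos_e) simp
      have 1: "pos (rs \<epsilon> e - (r + r))"
        using Nr N_triangle[of r r] by (intro pos_diff_of_norm) (auto simp: star_add sr)
      have 2: "pos (h \<odot> (e - g) \<odot> h)" using pos_conj[OF pos_e_minus[OF g(1,2)], of h] sh by simp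
      have 3: "pos (D - D \<odot> D)"
      proof -
        let ?R = "upow \<delta> n"
        have DR: "D = ?R \<odot> ?R" unfolding D_def by (rule upow_sqrt[OF \<delta>(2)])
        have "star ?R \<odot> (e - D) \<odot> ?R = ?R \<odot> ?R - ?R \<odot> (?R \<odot> ?R) \<odot> ?R"
          by (simp only: star_upow[OF \<delta>(1)] DR mul_diff e_right)
        also have "\<dots> = D - D \<odot> D" by (simp only: DR mul_assoc)
        finally show ?thesis using pos_conj[OF pos_e_minus[OF D(1,2)], of ?R] by simp
      qed
      have "rs (1 + \<epsilon>) e + (h - (g + g)) = (rs \<epsilon> e - (r + r)) + (h \<odot> (e - g) \<odot> h + h \<odot> (e - g) \<odot> h)
          + (D + ((D - D \<odot> D) + (D - D \<odot> D)))"
      proof -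
        have "h \<odot> h = e - D - D + D \<odot> D" by (simp add: h_def mul_diff)
        thus ?thesis by (simp add: r_def mul_diff rs_add_left) (simp add: h_def algebra_simps)
      qed
      thus "pos (rs (1 + \<epsilon>) e + (h - (g + g)))"
        using pos_add[OF pos_add[OF 1 pos_add[OF 2 2]] pos_add[OF D(1) pos_add[OF 3 3]]] by simp
    qed (use \<epsilon> in simp)
  qed
  show ?thesis
    using main h(2) unfolding h_def D_def d_def by (intro exI[of _ n]) auto
qed

text \<open>
  By the hypothesis, \<open>2 g \<le> e + h\<close> for \<open>g = e - (e - y \<odot> star y) ^ n\<close>. Conjugating by \<open>y\<close>, on which
  these \<open>g\<close> act more and more like a unit, shows that the positive element \<open>star y \<odot> (e - h) \<odot> y\<close> is
  arbitrarily small.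
\<close>

lemma unit_criterion:
  assumes h: "star h = h" "N h \<le> 1"
    and y: "N y \<le> 1"
    and dom: "\<And>n. N (h - ((e - upow (e - y \<odot> star y) n) + (e - upow (e - y \<odot> star y) n))) \<le> 1"
  shows "h \<odot> y = y"
proof -
  define c where "c = y \<odot> star y"
  have c: "pos c" "N c \<le> 1"
    using pos_mul_star[of y] N_mul_mono[OF y, of "star y" 1] y by (simp_all add: c_def N_star)
  define d where "d = e - c"
  have d: "pos d" "N d \<le> 1" using pos_e_minus[OF c] norm_e_minus[OF c] by (simp_all add: d_def)
  obtain \<delta> where \<delta>: "star \<delta> = \<delta>" "\<delta> \<odot> \<delta> = d" "\<And>w. w \<odot> d = d \<odot> w \<Longrightarrow> w \<odot> \<delta> = \<delta> \<odot> w"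
    using pos_sqrt[OF d(1)] by metis
  have "c \<odot> \<delta> = \<delta> \<odot> c" by (rule \<delta>(3)) (simp add: d_def mul_diff)
  hence c\<delta>: "c \<odot> upow \<delta> n = upow \<delta> n \<odot> c" for n by (rule upow_commute)
  define q where "q n = star y \<odot> upow d n \<odot> y" for n
  have q: "real n * N (q n) \<le> 1" for n
  proof -
    let ?z = "upow \<delta> n \<odot> y"
    have "q n = star ?z \<odot> ?z"
      by (simp only: q_def upow_sqrt[OF \<delta>(2)] star_mul star_upow[OF \<delta>(1)] mul_assoc)
    hence "N (q n) = N (?z \<odot> star ?z)" by (simp only: N_star_mul_commute)
    also have "?z \<odot> star ?z = upow \<delta> n \<odot> (c \<odot> upow \<delta> n)"
      by (simp only: star_mul star_upow[OF \<delta>(1)] mul_assoc c_def)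
    also have "\<dots> = upow d n \<odot> c" by (simp only: c\<delta> upow_sqrt[OF \<delta>(2)] mul_assoc)
    finally show ?thesis using complement_power_norm[OF c, of n] by (simp add: d_def)
  qed
  define p where "p = star y \<odot> (e - h) \<odot> y"
  have eh: "pos (e - h)" using pos_diff_of_norm[OF h] by simp
  have p: "pos p" unfolding p_def by (rule pos_conj[OF eh])
  have "real n * N p \<le> 2" for n
  proof -
    let ?g = "e - upow d n"
    have sg: "star ?g = ?g" by (simp add: star_diff star_upow pos_sa[OF d(1)])
    have "pos (rs 1 e + (h - (?g + ?g)))"
      using dom[of n] by (intro pos_sum_of_norm) (simp_all add: star_diff star_add sg h d_def c_def star_upow star_mul star_star)
    hence "pos (star y \<odot> (e + (h - (?g + ?g))) \<odot> y)" by (intro pos_conj) simp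
    moreover have "star y \<odot> (e + (h - (?g + ?g))) \<odot> y = (q n + q n) - p"
      by (simp add: q_def p_def mul_diff mul_add_left mul_add_right)
    ultimately have "N p \<le> N (q n + q n)" using p by (intro pos_norm_le) auto
    also have "\<dots> \<le> 2 * N (q n)" using N_triangle[of "q n" "q n"] by simp
    finally have "real n * N p \<le> 2 * (real n * N (q n))"
      using mult_left_mono[of "N p" "2 * N (q n)" "real n"] by simp
    thus ?thesis using q[of n] by linarith
  qed
  hence "N p = 0"
  proof -
    assume *: "\<And>n. real n * N p \<le> 2"
    show "N p = 0"
    proof (rule ccontr)
      assume "N p \<noteq> 0"
      hence "N p > 0" using N_nonneg[of p] by linarith
      then obtain n :: nat where "2 < real n * N p" by (metis ex_less_of_nat_mult)
      thus False using *[of n] by linarith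
    qed
  qed
  hence p0: "p = 0" by (rule N_eq_0)
  obtain s where s: "star s = s" "s \<odot> s = e - h" using pos_sqrt[OF eh] by metis
  have "star (s \<odot> y) \<odot> (s \<odot> y) = star y \<odot> (s \<odot> s) \<odot> y" by (simp only: star_mul s(1) mul_assoc)
  hence "star (s \<odot> y) \<odot> (s \<odot> y) = 0" using p0 by (simp only: s(2) p_def)
  hence "s \<odot> y = 0" by (rule star_mul_eq_0)
  hence "(s \<odot> s) \<odot> y = 0" by (simp add: mul_assoc)
  thus ?thesis by (simp add: s(2) mul_diff)
qed

end

section \<open>Every W*-algebra has a unit\<close>

sublocale cstar_algebra \<subseteq> alg: complete_seminormed_star_algebra scaleE mul star norm
proof -
  have star_le: "norm x \<le> norm (star x)" for x
  proof (cases "norm x = 0")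
    case False
    have "(norm x)\<^sup>2 \<le> norm (star x) * norm x"
      using norm_mult_le[of "star x" x] by (simp add: cstar_identity)
    thus ?thesis using False norm_ge_zero[of x] unfolding power2_eq_square by (simp add: mult_le_cancel_right)
  qed simp
  show "complete_seminormed_star_algebra scaleE mul star norm"
  proof unfold_locales
    show "mul (mul x y) z = mul x (mul y z)" for x y z by (rule mult_assoc)
    show "mul (x + y) z = mul x z + mul y z" "mul (scaleE c x) z = scaleE c (mul x z)" for x y z c
      using mult_linear_left[of z] by (auto simp: Vector_Spaces.linear_iff)
    show "mul x (y + z) = mul x y + mul x z" "mul x (scaleE c y) = scaleE c (mul x y)" for x y z c
      using mult_linear_right[of x] by (auto simp: Vector_Spaces.linear_iff)
    show "norm (star x) = norm x" for x using star_le[of x] star_le[of "star x"] by (simp add: star_star)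
    show "\<exists>s. (\<lambda>m. norm (s - (\<Sum>k<m. X k))) \<longlonglongrightarrow> 0" if "summable (\<lambda>k. norm (X k))" for X :: "nat \<Rightarrow> 'e"
    proof -
      have "(\<lambda>m. \<Sum>k<m. X k) \<longlonglongrightarrow> suminf X" by (rule summable_LIMSEQ[OF summable_norm_cancel[OF that]])
      hence "(\<lambda>m. suminf X - (\<Sum>k<m. X k)) \<longlonglongrightarrow> 0" 
        using tendsto_diff[OF tendsto_const[of "suminf X"]] by fastforce
      thus ?thesis by (auto intro: tendsto_norm_zero)
    qed
  qed (simp_all add: star_add star_scale star_mult star_star norm_triangle_ineq norm_scale norm_mult_le)
qed

context cstar_algebra
begin

definition unit_of_algebra :: "'e \<Rightarrow> bool"
  where "unit_of_algebra e \<longleftrightarrow> (\<forall>x. mul e x = x \<and> mul x e = x)"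

lemma unital_cstar_algebra:
  assumes e: "unit_of_algebra e" and nontriv: "(x0::'e) \<noteq> 0"
  shows "unital_cstar_algebra scaleE mul star norm e"
proof unfold_locales
  have el: "mul e x = x" and er: "mul x e = x" for x using e by (simp_all add: unit_of_algebra_def)
  show "mul e x = x" "mul x e = x" for x by (rule el, rule er)
  show "norm (mul (star x) x) = (norm x)\<^sup>2" for x by (rule cstar_identity)
  have se: "star e = e"
  proof -
    have "star (mul (star e) e) = mul (star e) e" by (simp only: star_mult star_star)
    thus ?thesis by (simp add: er star_star)
  qed
  have "norm e \<noteq> 0" using nontriv el[of x0] by auto
  moreover have "norm e = (norm e)\<^sup>2" using cstar_identity[of e] by (simp add: se el)
  ultimately show "norm e = 1" by (simp add: power2_eq_square)
qed simp

text \<open>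
  The pair \<open>(x, c)\<close> stands for \<open>x + c\<close>, acting on the algebra by left multiplication. The operator
  norm of this action is the C*-norm of the unitization.
\<close>

definition unitization_scale :: "complex \<Rightarrow> 'e \<times> complex \<Rightarrow> 'e \<times> complex"
  where "unitization_scale c a = (scaleE c (fst a), c * snd a)"

definition unitization_mul :: "'e \<times> complex \<Rightarrow> 'e \<times> complex \<Rightarrow> 'e \<times> complex"
  where "unitization_mul a b = (mul (fst a) (fst b) + scaleE (snd b) (fst a) + scaleE (snd a) (fst b), snd a * snd b)"

definition unitization_star :: "'e \<times> complex \<Rightarrow> 'e \<times> complex"
  where "unitization_star a = (star (fst a), cnj (snd a))"

definition unitization_action :: "'e \<times> complex \<Rightarrow> 'e \<Rightarrow> 'e"
  where "unitization_action a y = mul (fst a) y + scaleE (snd a) y"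

definition unitization_norm :: "'e \<times> complex \<Rightarrow> real"
  where "unitization_norm a = onorm (unitization_action a)"

lemmas unitization_defs = unitization_scale_def unitization_mul_def unitization_star_def unitization_action_def

lemma norm_unitization_action_le: "norm (unitization_action a y) \<le> (norm (fst a) + cmod (snd a)) * norm y"
proof -
  have "norm (unitization_action a y) \<le> norm (fst a) * norm y + cmod (snd a) * norm y"
    unfolding unitization_action_def
    by (rule order_trans[OF norm_triangle_ineq]) (simp add: norm_scale norm_mult_le)
  thus ?thesis by (simp add: distrib_right)
qed

lemma bounded_linear_unitization_action: "bounded_linear (unitization_action a)"
proof (rule bounded_linear_intro)
  show "unitization_action a (x + y) = unitization_action a x + unitization_action a y" for x y
    by (simp add: unitization_action_def alg.mul_add_right scale_right_distrib)
  show "unitization_action a (r *\<^sub>R x) = r *\<^sub>R unitization_action a x" for r x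
    by (simp add: unitization_action_def alg.mul_sc_right scale_right_distrib mult.commute flip: scale_of_real)
  show "norm (unitization_action a x) \<le> norm x * (norm (fst a) + cmod (snd a))" for x
    using norm_unitization_action_le[of a x] by (simp add: mult.commute)
qed

lemma unitization_norm_bound: "norm (unitization_action a y) \<le> unitization_norm a * norm y"
  unfolding unitization_norm_def by (rule onorm[OF bounded_linear_unitization_action])

lemma unitization_norm_leI:
  "0 \<le> B \<Longrightarrow> (\<And>y. norm (unitization_action a y) \<le> B * norm y) \<Longrightarrow> unitization_norm a \<le> B"
  unfolding unitization_norm_def by (rule onorm_bound)

lemma unitization_norm_nonneg: "unitization_norm a \<ge> 0"
  unfolding unitization_norm_def by (rule onorm_pos_le[OF bounded_linear_unitization_action])

lemma unitization_action_mul: "unitization_action (unitization_mul a b) y = unitization_action a (unitization_action b y)"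
  by (simp add: unitization_defs alg.mul_add_left alg.mul_add_right alg.mul_sc_left alg.mul_sc_right
      mult_assoc scale_right_distrib)

lemma unitization_norm_embed: "unitization_norm (x, 0) = norm x"
proof (rule antisym)
  show "unitization_norm (x, 0) \<le> norm x"
    by (rule unitization_norm_leI) (simp_all add: unitization_action_def norm_mult_le)
  have "norm (mul x (star x)) = (norm x)\<^sup>2"
    using cstar_identity[of "star x"] by (simp add: star_star alg.N_star)
  hence "norm x * norm x \<le> unitization_norm (x, 0) * norm x"
    using unitization_norm_bound[of "(x, 0)" "star x"]
    by (simp add: unitization_action_def alg.N_star power2_eq_square)
  thus "norm x \<le> unitization_norm (x, 0)"
    using unitization_norm_nonneg[of "(x, 0)"] by (cases "norm x = 0") (auto simp: mult_le_cancel_right)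
qed

lemma left_unit_imp_unit:
  assumes "\<And>y. mul u y = y" shows "unit_of_algebra u"
proof -
  have "mul y (star u) = y" for y
  proof -
    have "star (mul u (star y)) = y" using assms[of "star y"] by (simp add: star_star)
    thus ?thesis by (simp only: star_mult star_star)
  qed
  hence "u = star u" using assms[of "star u"] by metis
  thus ?thesis unfolding unit_of_algebra_def using assms \<open>\<And>y. mul y (star u) = y\<close> by metis
qed

text \<open>
  Otherwise the algebra contains an element \<open>z\<close> such that \<open>y \<mapsto> y - z y\<close> is a strict contraction. The
  fixed point \<open>u\<close> of \<open>u \<mapsto> z + (u - z u)\<close> satisfies \<open>z u = z\<close>, and then \<open>z (u y - y) = 0\<close> shows that it
  is a left unit.
\<close>

lemma snd_le_unitization_norm:
  assumes nonunital: "\<nexists>u. unit_of_algebra u"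
  shows "cmod (snd a) \<le> unitization_norm a"
proof (rule ccontr)
  assume "\<not> cmod (snd a) \<le> unitization_norm a"
  hence lt: "unitization_norm a < cmod (snd a)" by simp
  hence l0: "snd a \<noteq> 0" using unitization_norm_nonneg[of a] by auto
  define z where "z = - scaleE (1 / snd a) (fst a)"
  define q where "q = unitization_norm a / cmod (snd a)"
  have q: "0 \<le> q" "q < 1" using lt l0 unitization_norm_nonneg[of a] by (auto simp: q_def)
  have contr: "norm (y - mul z y) \<le> q * norm y" for y
  proof -
    have "y - mul z y = scaleE (1 / snd a) (unitization_action a y)"
      using l0 by (simp add: z_def unitization_action_def scale_right_distrib alg.mul_minus alg.mul_sc_left)
    hence "norm (y - mul z y) = (1 / cmod (snd a)) * norm (unitization_action a y)"
      by (simp add: norm_scale norm_divide)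
    also have "\<dots> \<le> (1 / cmod (snd a)) * (unitization_norm a * norm y)"
      by (intro mult_left_mono unitization_norm_bound) simp
    finally show ?thesis by (simp add: q_def)
  qed
  have "dist (z + (x - mul z x)) (z + (y - mul z y)) \<le> q * dist x y" for x y
    using contr[of "x - y"] by (simp add: dist_norm alg.mul_diff algebra_simps)
  hence "\<exists>!u. z + (u - mul z u) = u"
    by (intro banach_fix_type[OF q]) blast
  then obtain u where "z + (u - mul z u) = u" by blast
  hence zu: "mul z u = z" by (simp add: algebra_simps)
  have "mul u y = y" for y
  proof -
    have "mul z (mul u y - y) = 0" by (simp add: alg.mul_diff zu flip: mult_assoc)
    hence "norm (mul u y - y) \<le> q * norm (mul u y - y)" using contr[of "mul u y - y"] by simp
    hence "(1 - q) * norm (mul u y - y) \<le> 0" by (simp add: algebra_simps)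
    hence "norm (mul u y - y) = 0"
      using q norm_ge_zero[of "mul u y - y"] by (auto simp: mult_le_0_iff)
    thus ?thesis by simp
  qed
  hence "unit_of_algebra u" by (rule left_unit_imp_unit)
  thus False using nonunital by blast
qed

text \<open>
  The bound on the scalar component makes the unitization complete, and its seminorm a norm.
\<close>

lemma unitization:
  assumes nonunital: "\<nexists>u. unit_of_algebra u"
  shows "unital_cstar_algebra unitization_scale unitization_mul unitization_star unitization_norm (0, 1)"
proof -
  let ?N = unitization_norm and ?A = unitization_action
  have A_add: "?A (a + b) y = ?A a y + ?A b y" for a b y
    by (simp add: unitization_action_def alg.mul_add_left scale_left_distrib)
  have A_sc: "?A (unitization_scale c a) y = scaleE c (?A a y)" for c a y
    by (simp add: unitization_defs alg.mul_sc_left scale_right_distrib)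
  have N_tri: "?N (a + b) \<le> ?N a + ?N b" for a b
  proof (rule unitization_norm_leI)
    show "norm (?A (a + b) y) \<le> (?N a + ?N b) * norm y" for y
      unfolding A_add distrib_right
      by (rule order_trans[OF norm_triangle_ineq add_mono[OF unitization_norm_bound unitization_norm_bound]])
  qed (simp add: unitization_norm_nonneg)
  have N_sc_le: "?N (unitization_scale c a) \<le> cmod c * ?N a" for c a
  proof (rule unitization_norm_leI)
    show "norm (?A (unitization_scale c a) y) \<le> cmod c * ?N a * norm y" for y
      unfolding A_sc norm_scale using mult_left_mono[OF unitization_norm_bound[of a y], of "cmod c"] by simp
  qed (simp add: unitization_norm_nonneg)
  have N_scale: "?N (unitization_scale c a) = cmod c * ?N a" for c a
  proof (cases "c = 0")
    case True
    thus ?thesis using N_sc_le[of c a] unitization_norm_nonneg[of "unitization_scale c a"] by simp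
  next
    case False
    have "unitization_scale (1 / c) (unitization_scale c a) = a"
      using False by (simp add: unitization_scale_def)
    hence "?N a \<le> cmod (1 / c) * ?N (unitization_scale c a)"
      using N_sc_le[of "1 / c" "unitization_scale c a"] by simp
    hence "cmod c * ?N a \<le> ?N (unitization_scale c a)"
      using False by (simp add: norm_divide field_simps)
    thus ?thesis using N_sc_le[of c a] by simp
  qed
  have N_mult: "?N (unitization_mul a b) \<le> ?N a * ?N b" for a b
  proof (rule unitization_norm_leI)
    show "norm (?A (unitization_mul a b) y) \<le> ?N a * ?N b * norm y" for y
    proof -
      have "norm (?A a (?A b y)) \<le> ?N a * norm (?A b y)" by (rule unitization_norm_bound)
      also have "\<dots> \<le> ?N a * (?N b * norm y)"
        by (intro mult_left_mono unitization_norm_bound unitization_norm_nonneg)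
      finally show ?thesis by (simp add: unitization_action_mul)
    qed
  qed (simp add: unitization_norm_nonneg)
  have cstar_le: "(?N a)\<^sup>2 \<le> ?N (unitization_mul (unitization_star a) a)" for a
  proof -
    let ?c = "?N (unitization_mul (unitization_star a) a)"
    have "?N a \<le> sqrt ?c"
    proof (rule unitization_norm_leI)
      fix y
      have "(norm (?A a y))\<^sup>2 = norm (mul (star (?A a y)) (?A a y))" by (rule cstar_identity[symmetric])
      also have "mul (star (?A a y)) (?A a y) = mul (star y) (?A (unitization_mul (unitization_star a) a) y)"
        unfolding unitization_action_mul
        by (simp add: unitization_action_def unitization_star_def star_add star_mult star_scale alg.mul_add_left
            alg.mul_add_right alg.mul_sc_left alg.mul_sc_right mult_assoc scale_right_distrib mult.commute)
      also have "norm \<dots> \<le> norm (star y) * norm (?A (unitization_mul (unitization_star a) a) y)"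
        by (rule norm_mult_le)
      also have "\<dots> \<le> norm y * (?c * norm y)"
        unfolding alg.N_star by (intro mult_left_mono unitization_norm_bound) simp
      also have "\<dots> = (sqrt ?c * norm y)\<^sup>2"
        by (simp add: power_mult_distrib unitization_norm_nonneg power2_eq_square)
      finally show "norm (?A a y) \<le> sqrt ?c * norm y"
        by (rule power2_le_imp_le) (simp add: unitization_norm_nonneg)
    qed (simp add: unitization_norm_nonneg)
    hence "(?N a)\<^sup>2 \<le> (sqrt ?c)\<^sup>2" by (rule power_mono) (rule unitization_norm_nonneg)
    thus ?thesis by (simp add: unitization_norm_nonneg)
  qed
  have star2: "unitization_star (unitization_star a) = a" for a
    by (simp add: unitization_star_def star_star)
  have N_star_le: "?N a \<le> ?N (unitization_star a)" for a
  proof (cases "?N a = 0")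
    case True
    thus ?thesis using unitization_norm_nonneg[of "unitization_star a"] by simp
  next
    case False
    have "?N a * ?N a \<le> ?N (unitization_star a) * ?N a"
      using cstar_le[of a] N_mult[of "unitization_star a" a] by (simp add: power2_eq_square)
    thus ?thesis using False unitization_norm_nonneg[of a] by (simp add: mult_le_cancel_right)
  qed
  have N_st: "?N (unitization_star a) = ?N a" for a
    using N_star_le[of a] N_star_le[of "unitization_star a"] by (simp add: star2)
  note snd_le = snd_le_unitization_norm[OF nonunital]
  have N_unit: "?N (0, 1) = 1"
  proof (rule antisym)
    show "?N (0, 1) \<le> 1" by (rule unitization_norm_leI) (simp_all add: unitization_action_def)
    show "1 \<le> ?N (0, 1)" using snd_le[of "(0, 1)"] by simp
  qed
  have N_le_sum: "?N a \<le> norm (fst a) + cmod (snd a)" for a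
    by (rule unitization_norm_leI) (simp_all add: norm_unitization_action_le)
  have fst_le: "norm (fst a) \<le> 2 * ?N a" for a
  proof -
    have "(fst a, 0) = a + unitization_scale (- snd a) (0, 1)"
      by (simp add: unitization_scale_def prod_eq_iff)
    hence "norm (fst a) \<le> ?N a + ?N (unitization_scale (- snd a) (0, 1))"
      using N_tri by (metis unitization_norm_embed)
    thus ?thesis using snd_le[of a] by (simp add: N_scale N_unit)
  qed
  show ?thesis
  proof unfold_locales
    show "\<exists>s. (\<lambda>m. ?N (s - (\<Sum>k<m. X k))) \<longlonglongrightarrow> 0" if X: "summable (\<lambda>k. ?N (X k))" for X
    proof -
      have sf: "summable (\<lambda>k. fst (X k))"
        by (rule summable_comparison_test'[of "\<lambda>k. 2 * ?N (X k)" 0]) (auto intro: summable_mult X fst_le)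
      have ss: "summable (\<lambda>k. snd (X k))"
        by (rule summable_comparison_test'[of "\<lambda>k. ?N (X k)" 0]) (auto intro: X snd_le)
      have fs: "fst (sum f A) = (\<Sum>k\<in>A. fst (f k))" "snd (sum f A) = (\<Sum>k\<in>A. snd (f k))"
        for f :: "nat \<Rightarrow> 'e \<times> complex" and A
        by (induction A rule: infinite_finite_induct) simp_all
      define s where "s = ((\<Sum>k. fst (X k)), (\<Sum>k. snd (X k)))"
      have "(\<lambda>m. norm ((\<Sum>k. fst (X k)) - (\<Sum>k<m. fst (X k))) + cmod ((\<Sum>k. snd (X k)) - (\<Sum>k<m. snd (X k))))
          \<longlonglongrightarrow> norm ((\<Sum>k. fst (X k)) - (\<Sum>k. fst (X k))) + cmod ((\<Sum>k. snd (X k)) - (\<Sum>k. snd (X k)))"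
        by (intro tendsto_intros summable_LIMSEQ sf ss)
      hence lim: "(\<lambda>m. norm (fst (s - (\<Sum>k<m. X k))) + cmod (snd (s - (\<Sum>k<m. X k)))) \<longlonglongrightarrow> 0"
        by (simp add: s_def fs)
      have "(\<lambda>m. ?N (s - (\<Sum>k<m. X k))) \<longlonglongrightarrow> 0"
        by (rule tendsto_sandwich[OF _ _ tendsto_const lim])
           (intro always_eventually allI unitization_norm_nonneg N_le_sum)+
      thus ?thesis by blast
    qed
    show "a = 0" if "?N a = 0" for a
      using fst_le[of a] snd_le[of a] that by (simp add: prod_eq_iff)
    show "?N (unitization_mul (unitization_star a) a) = (?N a)\<^sup>2" for a
      using cstar_le[of a] N_mult[of "unitization_star a" a] by (simp add: N_st power2_eq_square)
    show "?N (unitization_scale c a) = cmod c * ?N a" for c a by (rule N_scale)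
    show "?N (unitization_mul a b) \<le> ?N a * ?N b" for a b by (rule N_mult)
    show "?N (unitization_star a) = ?N a" for a by (rule N_st)
  qed (simp_all add: N_tri N_unit unitization_defs star2[unfolded unitization_star_def] scale_right_distrib
        scale_left_distrib alg.mul_add_left alg.mul_add_right alg.mul_sc_left alg.mul_sc_right mult_assoc
        star_add star_scale star_mult star_star algebra_simps)
qed

end

context wstar_algebra
begin

text \<open>
  Otherwise consider the unitization. Every finite set of positive contractions of the algebra is
  dominated, up to \<open>\<epsilon>\<close>, by a contraction of the algebra, and this condition cuts out norm balls. By
  weak* compactness there is one contraction dominating all of them, and it is a unit by
  \<open>unit_criterion\<close>.
\<close>

lemma unit_exists: "\<exists>e. unit_of_algebra e"
proof (rule ccontr)
  assume no: "\<nexists>e. unit_of_algebra e"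
  interpret U: unital_cstar_algebra unitization_scale unitization_mul unitization_star unitization_norm "(0, 1)"
    by (rule unitization[OF no])
  let ?i = "\<lambda>x::'e. (x, 0::complex)"
  have i_mul: "unitization_mul (?i x) (?i y) = ?i (mul x y)" for x y by (simp add: unitization_mul_def)
  have i_star: "unitization_star (?i x) = ?i (star x)" for x by (simp add: unitization_star_def)
  have i_inj: "?i x = ?i y \<longleftrightarrow> x = y" for x y by simp
  have snd_pow: "snd (U.upow a k) = snd a ^ k" for a k
  proof (induction k)
    case (Suc k)
    have "snd (unitization_mul a (U.upow a k)) = snd a * snd (U.upow a k)" by (simp add: unitization_mul_def)
    thus ?case using Suc by (simp add: U.upow_Suc)
  qed simp
  have in_E: "\<exists>x. (0, 1) - U.upow ((0, 1) - ?i c) n = ?i x" for c n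
    by (rule exI[of _ "fst ((0, 1) - U.upow ((0, 1) - ?i c) n)"]) (simp add: prod_eq_iff snd_pow)
  define D where "D = {g::'e. U.pos (?i g) \<and> norm g \<le> 1}"
  \<comment> \<open>Indices: a finite set of positive contractions to be dominated, and a precision.\<close>
  have "\<exists>h. norm h \<le> 1 \<and> (\<forall>g\<in>Q. norm (h - (g + g)) \<le> 1 + 1 / real (Suc n))"
    if "finite Q" "Q \<subseteq> D" for Q n
  proof -
    have "finite (?i ` Q)" using that(1) by simp
    moreover have "U.pos g \<and> unitization_norm g \<le> 1" if "g \<in> ?i ` Q" for g
      using that \<open>Q \<subseteq> D\<close> by (auto simp: D_def unitization_norm_embed)
    moreover have "(0::real) < 1 / real (Suc n)" by simp
    moreover define c where "c = U.rs (1 / real (Suc (card (?i ` Q)))) (\<Sum>g\<in>?i ` Q. g)"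
    ultimately have "\<exists>N. (\<forall>g\<in>?i ` Q. unitization_norm ((0, 1) - U.upow ((0, 1) - c) N - (g + g)) \<le> 1 + 1 / real (Suc n)) \<and>
        unitization_norm ((0, 1) - U.upow ((0, 1) - c) N) \<le> 1"
      by (rule U.dominating_contraction)
    then obtain N where dom: "\<forall>g\<in>?i ` Q. unitization_norm ((0, 1) - U.upow ((0, 1) - c) N - (g + g)) \<le> 1 + 1 / real (Suc n)"
      and le1: "unitization_norm ((0, 1) - U.upow ((0, 1) - c) N) \<le> 1"
      by blast
    have "snd (\<Sum>g\<in>?i ` Q. g) = (\<Sum>g\<in>?i ` Q. snd g)"
      by (induction "?i ` Q" rule: infinite_finite_induct) (auto simp: snd_sum)
    hence "snd c = 0" by (auto simp: c_def U.rs_def unitization_scale_def intro!: sum.neutral)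
    hence "c = ?i (fst c)" by (simp add: prod_eq_iff)
    then obtain h where h: "(0, 1) - U.upow ((0, 1) - c) N = ?i h" using in_E[of "fst c" N] by auto
    have "norm (h - (g + g)) \<le> 1 + 1 / real (Suc n)" if "g \<in> Q" for g
      using dom that unfolding h by (auto simp flip: unitization_norm_embed)
    moreover have "norm h \<le> 1" using le1 unfolding h by (simp add: unitization_norm_embed)
    ultimately show ?thesis by blast
  qed
  then obtain h where h: "\<And>Q n. finite Q \<Longrightarrow> Q \<subseteq> D \<Longrightarrow> norm (h Q n) \<le> 1"
      "\<And>Q n g. finite Q \<Longrightarrow> Q \<subseteq> D \<Longrightarrow> g \<in> Q \<Longrightarrow> norm (h Q n - (g + g)) \<le> 1 + 1 / real (Suc n)"
    by metis
  define b where "b = (\<lambda>(Q, n::nat). if finite Q \<and> Q \<subseteq> D then h Q n else 0)"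
  define F where "F = finite_subsets_at_top D \<times>\<^sub>F sequentially"
  have "F \<noteq> bot" by (simp add: F_def prod_filter_eq_bot)
  then obtain G where G: "G \<le> F" "G \<noteq> bot"
    and conv: "\<And>(b :: 'e set \<times> nat \<Rightarrow> 'e) B. (\<And>i. norm (b i) \<le> B) \<Longrightarrow> \<exists>r. wlim b r G"
    using universal_filter by blast
  have bb: "norm (b i) \<le> 1" for i by (cases i) (simp add: b_def h(1))
  then obtain r where r: "wlim b r G" using conv by blast
  have nr: "norm r \<le> 1" by (rule wlim_norm_le[OF r G(2)]) (simp add: bb)
  have dom: "norm (r - (g + g)) \<le> 1" if g: "g \<in> D" for g
  proof (rule field_le_epsilon)
    fix \<epsilon> :: real assume "\<epsilon> > 0"
    then obtain m where m: "1 / real (Suc m) < \<epsilon>" using nat_approx_posE by metis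
    have "eventually (\<lambda>z. (finite (fst z) \<and> {g} \<subseteq> fst z \<and> fst z \<subseteq> D) \<and> m \<le> snd z) F"
      unfolding F_def
    proof (rule eventually_prodI)
      show "\<forall>\<^sub>F Q in finite_subsets_at_top D. finite Q \<and> {g} \<subseteq> Q \<and> Q \<subseteq> D"
        unfolding eventually_finite_subsets_at_top using g by (intro exI[of _ "{g}"]) auto
    qed (rule eventually_ge_at_top)
    hence "eventually (\<lambda>z. norm (b z - (g + g)) \<le> 1 + \<epsilon>) F"
    proof eventually_elim
      case (elim z)
      obtain Q n where z: "z = (Q, n)" by (cases z)
      have "1 / real (Suc n) \<le> 1 / real (Suc m)" using elim z by (simp add: frac_le)
      thus ?case using h(2)[of Q g n] elim z m by (auto simp: b_def)
    qed
    hence "eventually (\<lambda>z. norm (b z - (g + g)) \<le> 1 + \<epsilon>) G" using G(1) by (simp add: filter_leD)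
    thus "norm (r - (g + g)) \<le> 1 + \<epsilon>" by (rule wlim_norm_le[OF wlim_diff[OF r wlim_const] G(2)])
  qed
  \<comment> \<open>The domination conditions are invariant under the involution, so \<open>r\<close> may be replaced by its real part.\<close>
  define h0 where "h0 = scaleE (1/2) (r + star r)"
  have half: "scaleE (1/2) (x + x) = x" for x
  proof -
    have "scaleE (1/2) (x + x) = scaleE (1/2) x + scaleE (1/2) x" by (rule dual.scale_right_distrib)
    also have "\<dots> = scaleE (1/2 + 1/2) x" by (rule dual.scale_left_distrib[symmetric])
    finally show ?thesis by simp
  qed
  have sh0: "star h0 = h0" by (simp add: h0_def star_scale star_add star_star add.commute)
  have nh0: "norm h0 \<le> 1"
    using norm_triangle_ineq[of r "star r"] nr by (simp add: h0_def dual.norm_scale alg.N_star)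
  have dom0: "norm (h0 - (g + g)) \<le> 1" if g: "g \<in> D" for g
  proof -
    have sg: "star g = g" using U.pos_sa[of "?i g"] g by (simp add: D_def unitization_star_def)
    have "h0 - (g + g) = scaleE (1/2) ((r + star r) - ((g + g) + (g + g)))"
      by (simp add: h0_def dual.scale_right_diff_distrib half)
    also have "(r + star r) - ((g + g) + (g + g)) = (r - (g + g)) + star (r - (g + g))"
      by (simp add: alg.star_diff star_add sg)
    also have "norm (scaleE (1/2) \<dots>) \<le> 1/2 * (norm (r - (g + g)) + norm (star (r - (g + g))))"
      by (simp only: dual.norm_scale) (simp add: norm_triangle_ineq)
    also have "\<dots> \<le> 1" unfolding alg.N_star using dom[OF g] by simp
    finally show ?thesis .
  qed
  have key: "mul h0 y = y" if y: "norm y \<le> 1" for y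
  proof -
    have "unitization_mul (?i h0) (?i y) = ?i y"
    proof (rule U.unit_criterion)
      show "unitization_star (?i h0) = ?i h0" by (simp add: i_star sh0)
      show "unitization_norm (?i h0) \<le> 1" "unitization_norm (?i y) \<le> 1"
        using nh0 y by (simp_all add: unitization_norm_embed)
      fix n
      let ?c = "unitization_mul (?i y) (unitization_star (?i y))"
      let ?g = "(0, 1) - U.upow ((0, 1) - ?c) n"
      have c: "U.pos ?c" "unitization_norm ?c \<le> 1"
        using U.pos_mul_star[of "?i y"] U.N_mul_mono[of "?i y" 1 "unitization_star (?i y)" 1] y
        by (simp_all add: U.N_star unitization_norm_embed)
      have d: "U.pos ((0, 1) - ?c)" "unitization_norm ((0, 1) - ?c) \<le> 1"
        by (rule U.pos_e_minus[OF c], rule U.norm_e_minus[OF c])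
      have g: "U.pos ?g" "unitization_norm ?g \<le> 1"
        using U.pos_e_minus[OF U.pos_upow[OF d(1)] U.norm_upow_le_one[OF d(2)]]
          U.norm_e_minus[OF U.pos_upow[OF d(1)] U.norm_upow_le_one[OF d(2)]] by blast+
      obtain x where x: "?g = ?i x" using in_E[of "mul y (star y)" n] by (auto simp: i_mul i_star)
      have "x \<in> D" using g unfolding x D_def by (simp add: unitization_norm_embed)
      from dom0[OF this] show "unitization_norm (?i h0 - (?g + ?g)) \<le> 1"
        unfolding x by (simp add: unitization_norm_embed)
    qed
    thus ?thesis by (simp add: i_mul)
  qed
  have "mul h0 y = y" for y
  proof (cases "y = 0")
    case False
    have "mul h0 (scaleE (of_real (1 / norm y)) y) = scaleE (of_real (1 / norm y)) y"
      by (rule key) (use False in \<open>simp add: dual.norm_scale norm_divide\<close>)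
    hence "scaleE (of_real (1 / norm y)) (mul h0 y) = scaleE (of_real (1 / norm y)) y"
      by (simp only: alg.mul_sc_right)
    thus ?thesis using False by (simp add: dual.scale_cancel_left)
  qed simp
  hence "unit_of_algebra h0" by (rule left_unit_imp_unit)
  thus False using no by blast
qed

end

section \<open>Norm inequalities for weak* limits\<close>

locale unital_wstar_algebra = wstar_algebra scaleP scaleE pairing mul star
  for scaleP :: "complex \<Rightarrow> 'p::banach \<Rightarrow> 'p"
    and scaleE :: "complex \<Rightarrow> 'e::banach \<Rightarrow> 'e"
    and pairing :: "'p \<Rightarrow> 'e \<Rightarrow> complex"
    and mul :: "'e \<Rightarrow> 'e \<Rightarrow> 'e" (infixl "\<odot>" 70)
    and star :: "'e \<Rightarrow> 'e" +
  fixes e :: 'e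
  assumes unit: "unit_of_algebra e" and nontrivial: "\<exists>x::'e. x \<noteq> 0"

sublocale unital_wstar_algebra \<subseteq> C: unital_cstar_algebra scaleE mul star norm e
  using nontrivial by (auto intro: unital_cstar_algebra[OF unit])

context unital_wstar_algebra
begin

lemma norm_star_mul: "norm (star x \<odot> x) = (norm x)\<^sup>2"
  by (rule C.N_cstar)

lemma scaleE_eq_iff: "scaleE 2 x = scaleE 2 y \<longleftrightarrow> x = y"
  using dual.scale_cancel_left[of 2 x y] by simp

lemma double: "x + x = scaleE 2 x"
  using dual.scale_left_distrib[of 1 1 x] by simp

text \<open>
  For real \<open>t\<close> the norm of \<open>b i + \<i> t\<close> is at most \<open>sqrt (B\<^sup>2 + t\<^sup>2)\<close>, hence so is that of \<open>r + \<i> t\<close>. The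
  imaginary part \<open>y\<close> of \<open>r\<close> would contribute \<open>norm y + \<bar>t\<bar>\<close> for one of the two signs of \<open>t\<close>, which
  exceeds the bound for large \<open>\<bar>t\<bar>\<close> unless \<open>y = 0\<close>.
\<close>

lemma wlim_self_adjoint:
  assumes lim: "wlim b r G" and G: "G \<noteq> bot" and bd: "\<And>i. norm (b i) \<le> B" and sa: "\<And>i. star (b i) = b i"
  shows "star r = r"
proof -
  \<comment> \<open>The imaginary part of \<open>r\<close>.\<close>
  define y where "y = scaleE (1/2) (scaleE (-\<i>) (r - star r))"
  have sy: "star y = y"
    by (simp add: y_def star_scale alg.star_diff star_star dual.scale_right_diff_distrib)
  have est: "norm (y + C.rs t e) \<le> sqrt (B\<^sup>2 + t\<^sup>2)" for t
  proof -
    let ?it = "scaleE (\<i> * of_real t) e"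
    have "norm (b i + ?it) \<le> sqrt (B\<^sup>2 + t\<^sup>2)" for i
    proof (rule real_le_rsqrt)
      have s: "star ?it = - ?it" by (simp add: star_scale)
      have "star (b i + ?it) \<odot> (b i + ?it) = b i \<odot> b i - ?it \<odot> ?it"
        by (simp only: star_add s sa) (simp add: alg.mul_add_left alg.mul_add_right alg.mul_diff alg.mul_sc_left alg.mul_sc_right dual.scale_right_diff_distrib)
      hence "(norm (b i + ?it))\<^sup>2 = norm (b i \<odot> b i - ?it \<odot> ?it)" by (simp flip: norm_star_mul)
      also have "\<dots> \<le> norm (b i) * norm (b i) + norm ?it * norm ?it"
        by (rule order_trans[OF norm_triangle_ineq4 add_mono[OF norm_mult_le norm_mult_le]])
      also have "\<dots> \<le> B * B + t * t"
      proof (rule add_mono)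
        show "norm (b i) * norm (b i) \<le> B * B"
          using bd[of i] order_trans[OF norm_ge_zero bd[of i]] by (intro mult_mono) auto
        show "norm ?it * norm ?it \<le> t * t" by (simp add: dual.norm_scale norm_mult)
      qed
      finally show "(norm (b i + ?it))\<^sup>2 \<le> B\<^sup>2 + t\<^sup>2" by (simp add: power2_eq_square)
    qed
    hence le: "norm (r + ?it) \<le> sqrt (B\<^sup>2 + t\<^sup>2)"
      by (intro wlim_norm_le[OF wlim_add[OF lim wlim_const] G]) simp
    have "star ?it = - ?it" by (simp add: star_scale)
    hence "?it - star ?it = scaleE 2 ?it" by (simp only: diff_minus_eq_add double)
    hence "scaleE (-\<i>) (?it - star ?it) = scaleE ((-\<i>) * (2 * (\<i> * of_real t))) e"
      by (simp only: dual.scale_scale)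
    also have "(-\<i>) * (2 * (\<i> * of_real t)) = 2 * of_real t" by (simp add: complex_eq_iff)
    finally have "scaleE (-\<i>) (?it - star ?it) = scaleE 2 (C.rs t e)"
      by (simp only: C.rs_def dual.scale_scale)
    hence "y + C.rs t e = scaleE (1/2) (scaleE (-\<i>) ((r + ?it) - star (r + ?it)))"
    proof -
      assume *: "scaleE (-\<i>) (?it - star ?it) = scaleE 2 (C.rs t e)"
      have "(r + ?it) - star (r + ?it) = (r - star r) + (?it - star ?it)" by (simp add: star_add)
      hence "scaleE (-\<i>) ((r + ?it) - star (r + ?it)) = scaleE (-\<i>) (r - star r) + scaleE 2 (C.rs t e)"
        by (simp only: dual.scale_right_distrib *)
      thus ?thesis by (simp only: y_def dual.scale_right_distrib dual.scale_scale) simp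
    qed
    hence "norm (y + C.rs t e) = 1/2 * norm ((r + ?it) - star (r + ?it))"
      by (simp only: dual.norm_scale) simp
    also have "\<dots> \<le> norm (r + ?it)"
      using norm_triangle_ineq4[of "r + ?it" "star (r + ?it)"] unfolding alg.N_star by simp
    finally show ?thesis using le by simp
  qed
  have "norm y * t \<le> B\<^sup>2" if t: "t > 0" for t
  proof -
    define \<sigma> where "\<sigma> = B\<^sup>2 / t\<^sup>2"
    have \<sigma>0: "\<sigma> \<ge> 0" by (simp add: \<sigma>_def)
    have "sqrt (B\<^sup>2 + t\<^sup>2) \<le> t * (1 + \<sigma>)"
    proof (rule real_le_lsqrt)
      have "(t * (1 + \<sigma>))\<^sup>2 = t\<^sup>2 * (1 + 2 * \<sigma> + \<sigma>\<^sup>2)" by (simp add: power2_eq_square algebra_simps)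
      also have "\<dots> \<ge> t\<^sup>2 * (1 + \<sigma>)" using \<sigma>0 by (intro mult_left_mono) auto
      also have "t\<^sup>2 * (1 + \<sigma>) = B\<^sup>2 + t\<^sup>2" using t by (simp add: \<sigma>_def field_simps)
      finally show "B\<^sup>2 + t\<^sup>2 \<le> (t * (1 + \<sigma>))\<^sup>2" .
    qed (use t in \<open>auto simp: \<sigma>_def\<close>)
    hence le: "norm (y + C.rs s e) \<le> t * (1 + \<sigma>)" if "\<bar>s\<bar> = t" for s
      using est[of s] that t by (auto simp: abs_if split: if_splits)
    have "norm (C.rs (1 / t) y) \<le> \<sigma>"
    proof (rule C.sa_norm_le)
      show "star (C.rs (1 / t) y) = C.rs (1 / t) y" by (simp add: C.star_rs sy)
      have "e + C.rs (1 / t) y = C.rs (1 / t) (y + C.rs t e)" using t by (simp add: C.rs_add_right C.rs_rs)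
      thus "norm (e + C.rs (1 / t) y) \<le> 1 + \<sigma>" using le[of t] t by (simp add: C.N_rs field_simps)
      have eq: "e - C.rs (1 / t) y = C.rs (- 1 / t) (y + C.rs (- t) e)" using t by (simp add: C.rs_add_right C.rs_diff_right C.rs_rs C.rs_minus)
      show "norm (e - C.rs (1 / t) y) \<le> 1 + \<sigma>"
        unfolding eq C.N_rs using le[of "- t"] t by (simp add: field_simps)
    qed
    hence "norm y / t \<le> B\<^sup>2 / t\<^sup>2" using t by (simp add: C.N_rs \<sigma>_def)
    thus ?thesis using t by (simp add: field_simps power2_eq_square)
  qed
  hence "norm y = 0"
  proof -
    assume *: "\<And>t. t > 0 \<Longrightarrow> norm y * t \<le> B\<^sup>2"
    show ?thesis
    proof (rule ccontr)
      assume "norm y \<noteq> 0"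
      hence "norm y > 0" by simp
      with *[of "(B\<^sup>2 + 1) / norm y"] show False by (simp add: add_nonneg_pos)
    qed
  qed
  hence "scaleE (1/2) (scaleE (-\<i>) (r - star r)) = 0" by (simp add: y_def)
  hence "r - star r = 0" by (simp only: dual.scale_eq_0_iff) simp
  thus ?thesis by simp
qed

lemma wlim_pos:
  assumes lim: "wlim b r G" and G: "G \<noteq> bot" and bd: "\<And>i. norm (b i) \<le> B" and pos: "\<And>i. C.pos (b i)"
  shows "C.pos r"
  unfolding C.pos_def
proof (intro conjI exI)
  show "star r = r" by (rule wlim_self_adjoint[OF lim G bd C.pos_sa[OF pos]])
  show "norm (C.rs B e - r) \<le> B"
    by (rule wlim_norm_le[OF wlim_diff[OF wlim_const lim] G]) (simp add: C.pos_norm_diff pos bd)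
qed

text \<open>
  With \<open>z = star x \<odot> x \<odot> r\<close>, the norm of the limit \<open>r + t z\<close> is at most the supremum of the norms of
  \<open>b i + t z\<close>. Both squares have the leading term \<open>t\<^sup>2 (norm z)\<^sup>2\<close>; the claim compares the terms linear
  in \<open>t\<close>. On the left that term is \<open>2 t (star r \<odot> z)\<close>, which dominates \<open>2 t (star z \<odot> z) / (norm x)\<^sup>2\<close>.
\<close>

lemma positive_compression_bound:
  assumes lim: "wlim b r G" and G: "G \<noteq> bot" and bd: "\<And>i. norm (b i) \<le> B"
    and \<beta>: "\<And>i. norm (star r \<odot> (star x \<odot> (x \<odot> b i))) \<le> \<beta>"
  shows "(norm (star x \<odot> (x \<odot> r)))\<^sup>2 \<le> (norm x)\<^sup>2 * \<beta>"
proof (cases "x = 0")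
  case True
  thus ?thesis by simp
next
  case False
  define X where "X = (norm x)\<^sup>2"
  have X: "X > 0" using False by (simp add: X_def)
  define z where "z = star x \<odot> (x \<odot> r)"
  define n where "n = (norm z)\<^sup>2"
  have B0: "B \<ge> 0" using bd norm_ge_zero order_trans by blast
  have sz: "star z = star r \<odot> (star x \<odot> x)" by (simp add: z_def star_mult star_star mult_assoc)
  have zr: "star z \<odot> r = star r \<odot> z" unfolding sz by (simp only: z_def mult_assoc)
  have main: "2 * t / X * n \<le> B\<^sup>2 + 2 * t * \<beta>" if t: "t > 0" for t
  proof -
    have expand: "star (c + C.rs t z) \<odot> (c + C.rs t z)
        = star c \<odot> c + C.rs t (star (star z \<odot> c) + star z \<odot> c) + C.rs (t\<^sup>2) (star z \<odot> z)" for c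
      by (simp add: star_add C.star_rs alg.mul_add_left alg.mul_add_right C.mul_rs C.rs_rs C.rs_add_right
          star_mult star_star power2_eq_square)
    have "norm (b i + C.rs t z) \<le> sqrt (B\<^sup>2 + 2 * t * \<beta> + t\<^sup>2 * n)" for i
    proof (rule real_le_rsqrt)
      have szb: "norm (star z \<odot> b i) \<le> \<beta>" using \<beta>[of i] by (simp add: sz mult_assoc)
      have "(norm (b i + C.rs t z))\<^sup>2 = norm (star (b i + C.rs t z) \<odot> (b i + C.rs t z))"
        by (simp only: norm_star_mul)
      also have "\<dots> \<le> norm (star (b i) \<odot> b i) + norm (C.rs t (star (star z \<odot> b i) + star z \<odot> b i)) + norm (C.rs (t\<^sup>2) (star z \<odot> z))"
        unfolding expand by (rule order_trans[OF norm_triangle_ineq add_right_mono[OF norm_triangle_ineq]])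
      also have "\<dots> \<le> B\<^sup>2 + t * (\<beta> + \<beta>) + t\<^sup>2 * n"
      proof (intro add_mono)
        show "norm (star (b i) \<odot> b i) \<le> B\<^sup>2" using bd[of i] by (simp add: norm_star_mul power_mono)
        have "norm (star (star z \<odot> b i) + star z \<odot> b i) \<le> \<beta> + \<beta>"
          by (rule order_trans[OF norm_triangle_ineq add_mono]) (simp_all only: alg.N_star szb)
        thus "norm (C.rs t (star (star z \<odot> b i) + star z \<odot> b i)) \<le> t * (\<beta> + \<beta>)"
          using t by (simp add: C.N_rs)
        show "norm (C.rs (t\<^sup>2) (star z \<odot> z)) \<le> t\<^sup>2 * n" by (simp add: C.N_rs norm_star_mul n_def)
      qed
      finally show "(norm (b i + C.rs t z))\<^sup>2 \<le> B\<^sup>2 + 2 * t * \<beta> + t\<^sup>2 * n" by (simp add: algebra_simps)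
    qed
    hence "norm (r + C.rs t z) \<le> sqrt (B\<^sup>2 + 2 * t * \<beta> + t\<^sup>2 * n)"
      by (intro wlim_norm_le[OF wlim_add[OF lim wlim_const] G]) simp
    hence "(norm (r + C.rs t z))\<^sup>2 \<le> (sqrt (B\<^sup>2 + 2 * t * \<beta> + t\<^sup>2 * n))\<^sup>2" by (rule power_mono) simp
    moreover have "0 \<le> B\<^sup>2 + 2 * t * \<beta> + t\<^sup>2 * n"
      using t order_trans[OF norm_ge_zero \<beta>] by (simp add: n_def)
    ultimately have upper: "(norm (r + C.rs t z))\<^sup>2 \<le> B\<^sup>2 + 2 * t * \<beta> + t\<^sup>2 * n" by simp
    have p1: "C.pos (star r \<odot> z - C.rs (1 / X) (star z \<odot> z))"
    proof -
      have "C.pos (C.rs X e - x \<odot> star x)"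
        by (rule C.pos_diff_of_norm) (simp_all add: star_mult star_star X_def flip: C.N_star_mul_commute norm_star_mul)
      hence "C.pos (C.rs (1 / X) (star (x \<odot> r) \<odot> (C.rs X e - x \<odot> star x) \<odot> (x \<odot> r)))"
        using X by (intro C.pos_rs C.pos_conj) auto
      also have "C.rs (1 / X) (star (x \<odot> r) \<odot> (C.rs X e - x \<odot> star x) \<odot> (x \<odot> r))
          = star r \<odot> z - C.rs (1 / X) (star z \<odot> z)"
        using X unfolding sz by (simp add: z_def star_mult alg.mul_diff C.mul_rs C.rs_diff_right C.rs_rs mult_assoc)
      finally show ?thesis .
    qed
    have "(2 * t / X + t\<^sup>2) * n = norm (C.rs (2 * t / X + t\<^sup>2) (star z \<odot> z))"
      using t X by (simp add: C.N_rs norm_star_mul n_def)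
    also have "\<dots> \<le> norm (star (r + C.rs t z) \<odot> (r + C.rs t z))"
    proof (rule C.pos_norm_le)
      show "C.pos (C.rs (2 * t / X + t\<^sup>2) (star z \<odot> z))"
        using t X by (intro C.pos_rs C.pos_star_mul) auto
      have "star (star z \<odot> r) = star z \<odot> r" by (simp add: star_mult star_star zr)
      hence "star (r + C.rs t z) \<odot> (r + C.rs t z) - C.rs (2 * t / X + t\<^sup>2) (star z \<odot> z)
          = star r \<odot> r + C.rs (2 * t) (star r \<odot> z - C.rs (1 / X) (star z \<odot> z))"
        unfolding expand
        by (simp add: zr C.rs_add_left C.rs_diff_right C.rs_rs double[unfolded C.rs_def[symmetric]])
           (simp add: C.rs_def double mult.commute flip: dual.scale_scale)
      thus "C.pos (star (r + C.rs t z) \<odot> (r + C.rs t z) - C.rs (2 * t / X + t\<^sup>2) (star z \<odot> z))"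
        using t by (auto intro!: C.pos_add C.pos_star_mul C.pos_rs p1)
    qed
    also have "\<dots> = (norm (r + C.rs t z))\<^sup>2" by (rule norm_star_mul)
    also note upper
    finally show ?thesis by (simp add: algebra_simps)
  qed
  have *: "(n / X - \<beta>) * (2 * t) \<le> B\<^sup>2" if "t > 0" for t
    using main[OF that] by (simp add: algebra_simps)
  have "n / X \<le> \<beta>"
  proof (rule ccontr)
    assume "\<not> n / X \<le> \<beta>"
    hence d: "n / X - \<beta> > 0" by simp
    define d where "d = n / X - \<beta>"
    have "d > 0" using d by (simp add: d_def)
    have "d * (2 * ((B\<^sup>2 + 1) / d)) = (B\<^sup>2 + 1) + (B\<^sup>2 + 1)"
      using \<open>d > 0\<close> by (simp add: field_simps)
    moreover have "(B\<^sup>2 + 1) / d > 0" using \<open>d > 0\<close> by (simp add: add_nonneg_pos)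
    ultimately have "(B\<^sup>2 + 1) + (B\<^sup>2 + 1) \<le> B\<^sup>2" using *[of "(B\<^sup>2 + 1) / d"] by (simp add: d_def)
    thus False using zero_le_power2[of B] by linarith
  qed
  thus ?thesis using X by (simp add: n_def z_def X_def field_simps)
qed

lemma normal_norm_eq:
  assumes "star x \<odot> x = x \<odot> star x" shows "norm (star x \<odot> z) = norm (x \<odot> z)"
proof -
  have "(norm (star x \<odot> z))\<^sup>2 = norm (star z \<odot> ((x \<odot> star x) \<odot> z))"
    unfolding norm_star_mul[symmetric] by (simp only: star_mult star_star mult_assoc)
  also have "\<dots> = (norm (x \<odot> z))\<^sup>2"
    unfolding norm_star_mul[symmetric] assms[symmetric] by (simp only: star_mult mult_assoc)
  finally show ?thesis by simp
qed

text \<open>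
  If \<open>x\<close> is small on a bounded net, it is small on the weak* limit. The two versions differ in how
  the factors \<open>star r \<odot> star x \<odot> x \<odot> b i\<close> are grouped.
\<close>

lemma normal_compression_bounds:
  assumes lim: "wlim b r G" and G: "G \<noteq> bot" and bd: "\<And>i. norm (b i) \<le> B"
    and normal: "star x \<odot> x = x \<odot> star x"
  shows "(\<And>i. norm (x \<odot> b i) \<le> \<beta>) \<Longrightarrow> (norm (x \<odot> (x \<odot> r)))\<^sup>2 \<le> (norm x)\<^sup>2 * (norm (x \<odot> r) * \<beta>)"
    and "(\<And>i. norm (x \<odot> (x \<odot> b i)) \<le> \<beta>) \<Longrightarrow> (norm (x \<odot> (x \<odot> r)))\<^sup>2 \<le> (norm x)\<^sup>2 * (norm r * \<beta>)"
proof -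
  assume \<beta>: "\<And>i. norm (x \<odot> b i) \<le> \<beta>"
  have "norm (star r \<odot> (star x \<odot> (x \<odot> b i))) \<le> norm (x \<odot> r) * \<beta>" for i
  proof -
    have "star r \<odot> (star x \<odot> (x \<odot> b i)) = star (x \<odot> r) \<odot> (x \<odot> b i)" by (simp only: star_mult mult_assoc)
    also have "norm \<dots> \<le> norm (star (x \<odot> r)) * norm (x \<odot> b i)" by (rule norm_mult_le)
    also have "\<dots> \<le> norm (x \<odot> r) * \<beta>" unfolding alg.N_star by (intro mult_left_mono \<beta>) simp
    finally show ?thesis .
  qed
  from positive_compression_bound[OF lim G bd this]
  show "(norm (x \<odot> (x \<odot> r)))\<^sup>2 \<le> (norm x)\<^sup>2 * (norm (x \<odot> r) * \<beta>)" by (simp only: normal_norm_eq[OF normal])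
next
  assume \<beta>: "\<And>i. norm (x \<odot> (x \<odot> b i)) \<le> \<beta>"
  have "norm (star r \<odot> (star x \<odot> (x \<odot> b i))) \<le> norm r * \<beta>" for i
  proof -
    have "norm (star r \<odot> (star x \<odot> (x \<odot> b i))) \<le> norm (star r) * norm (star x \<odot> (x \<odot> b i))" by (rule norm_mult_le)
    also have "\<dots> \<le> norm r * \<beta>"
      unfolding alg.N_star normal_norm_eq[OF normal] by (intro mult_left_mono \<beta>) simp
    finally show ?thesis .
  qed
  from positive_compression_bound[OF lim G bd this]
  show "(norm (x \<odot> (x \<odot> r)))\<^sup>2 \<le> (norm x)\<^sup>2 * (norm r * \<beta>)" by (simp only: normal_norm_eq[OF normal])
qed

end

section \<open>Multiplication and weak* limits\<close>

text \<open>
  Throughout, \<open>G\<close> is a filter along which all bounded nets converge, as in \<open>universal_filter\<close>; this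
  makes the limit a linear map on all bounded nets.
\<close>

locale universal_limit = unital_wstar_algebra +
  fixes G :: "'i filter"
  assumes G_bot: "G \<noteq> bot"
    and G_universal: "(\<And>i. norm ((b :: 'i \<Rightarrow> 'b) i) \<le> B) \<Longrightarrow> \<exists>r. wlim b r G"
begin

definition bdd :: "('i \<Rightarrow> 'b) \<Rightarrow> bool"
  where "bdd b \<longleftrightarrow> (\<exists>B. \<forall>i. norm (b i) \<le> B)"

definition net_limit :: "('i \<Rightarrow> 'b) \<Rightarrow> 'b"
  where "net_limit b = (SOME r. wlim b r G)"

lemma bddI: "(\<And>i. norm (b i) \<le> B) \<Longrightarrow> bdd b"
  by (auto simp: bdd_def)

lemma bdd_add: "bdd b \<Longrightarrow> bdd c \<Longrightarrow> bdd (\<lambda>i. b i + c i)"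
  unfolding bdd_def by (meson add_mono norm_triangle_ineq order_trans)

lemma bdd_scale: "bdd b \<Longrightarrow> bdd (\<lambda>i. scaleE k (b i))"
  unfolding bdd_def by (metis dual.norm_scale mult_left_mono norm_ge_zero)

lemma bdd_mul: "bdd b \<Longrightarrow> bdd (\<lambda>i. x \<odot> b i)"
  unfolding bdd_def by (meson mult_left_mono norm_ge_zero norm_mult_le order_trans)

lemma bdd_star: "bdd b \<Longrightarrow> bdd (\<lambda>i. star (b i))"
  unfolding bdd_def by (simp add: alg.N_star)

lemma bdd_zero: "bdd (\<lambda>_. 0)"
  by (rule bddI[of _ 0]) simp

lemma bdd_sum: "(\<And>s. s \<in> S \<Longrightarrow> bdd (f s)) \<Longrightarrow> bdd (\<lambda>i. \<Sum>s\<in>S. f s i)"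
  by (induction S rule: infinite_finite_induct) (auto intro: bdd_add bdd_zero)

lemma wlim_net_limit: "bdd b \<Longrightarrow> wlim b (net_limit b) G"
  unfolding net_limit_def bdd_def using G_universal by (metis someI_ex)

lemma net_limit_eqI: "wlim b r G \<Longrightarrow> net_limit b = r"
  unfolding net_limit_def using wlim_unique[OF _ _ G_bot] by (metis someI)

lemma net_limit_norm_le: "(\<And>i. norm (b i) \<le> B) \<Longrightarrow> norm (net_limit b) \<le> B"
  by (rule wlim_norm_le[OF wlim_net_limit[OF bddI] G_bot]) auto

lemma net_limit_star: assumes "bdd b" shows "net_limit (\<lambda>i. star (b i)) = star (net_limit b)"
proof -
  let ?p = "net_limit b" and ?q = "net_limit (\<lambda>i. star (b i))"
  have p: "wlim b ?p G" and q: "wlim (\<lambda>i. star (b i)) ?q G"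
    using wlim_net_limit assms bdd_star by blast+
  obtain B where B: "\<And>i. norm (b i) \<le> B" using assms by (auto simp: bdd_def)
  have sum: "star (?p + ?q) = ?p + ?q"
  proof (rule wlim_self_adjoint[OF wlim_add[OF p q] G_bot])
    show "norm (b i + star (b i)) \<le> B + B" for i
      by (rule order_trans[OF norm_triangle_ineq add_mono]) (simp_all add: alg.N_star B)
  qed (simp add: star_add star_star add.commute)
  have "star (scaleE \<i> (?p - ?q)) = scaleE \<i> (?p - ?q)"
  proof (rule wlim_self_adjoint[OF wlim_scale[OF wlim_diff[OF p q]] G_bot])
    show "norm (scaleE \<i> (b i - star (b i))) \<le> B + B" for i
      unfolding dual.norm_scale using norm_triangle_ineq4[of "b i" "star (b i)"] B[of i] by (simp add: alg.N_star)
  qed (simp add: star_scale alg.star_diff star_star dual.scale_right_diff_distrib)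
  hence "scaleE \<i> (star ?q - star ?p) = scaleE \<i> (?p - ?q)"
    by (simp add: star_scale alg.star_diff dual.scale_right_diff_distrib)
  hence diff: "star ?q - star ?p = ?p - ?q" by (subst (asm) dual.scale_cancel_left) simp
  have "?q + ?q = (?p + ?q) - (?p - ?q)" by simp
  also have "\<dots> = (star ?p + star ?q) - (star ?q - star ?p)" by (simp only: diff sum[unfolded star_add])
  also have "\<dots> = star ?p + star ?p" by simp
  finally have "?q + ?q = star ?p + star ?p" .
  thus ?thesis by (simp only: double scaleE_eq_iff)
qed

definition bounded_net_map :: "(('i \<Rightarrow> 'b) \<Rightarrow> 'b) \<Rightarrow> real \<Rightarrow> bool"
  where "bounded_net_map \<Phi> C \<longleftrightarrow>
    (\<forall>b c. bdd b \<longrightarrow> bdd c \<longrightarrow> \<Phi> (\<lambda>i. b i + c i) = \<Phi> b + \<Phi> c) \<and>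
    (\<forall>b k. bdd b \<longrightarrow> \<Phi> (\<lambda>i. scaleE k (b i)) = scaleE k (\<Phi> b)) \<and>
    (\<forall>b B. (\<forall>i. norm (b i) \<le> B) \<longrightarrow> norm (\<Phi> b) \<le> C * B)"

lemma net_map_limit: "bounded_net_map net_limit 1"
  unfolding bounded_net_map_def
  using net_limit_norm_le by (auto intro!: net_limit_eqI wlim_add wlim_scale wlim_net_limit)

lemma net_map_add: "bounded_net_map \<Phi> C \<Longrightarrow> bdd b \<Longrightarrow> bdd c \<Longrightarrow> \<Phi> (\<lambda>i. b i + c i) = \<Phi> b + \<Phi> c"
  and net_map_scale: "bounded_net_map \<Phi> C \<Longrightarrow> bdd b \<Longrightarrow> \<Phi> (\<lambda>i. scaleE k (b i)) = scaleE k (\<Phi> b)"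
  and net_map_norm: "bounded_net_map \<Phi> C \<Longrightarrow> (\<And>i. norm (b i) \<le> B) \<Longrightarrow> norm (\<Phi> b) \<le> C * B"
  by (auto simp: bounded_net_map_def)

lemma net_map_zero: "bounded_net_map \<Phi> C \<Longrightarrow> \<Phi> (\<lambda>_. 0) = 0"
  using net_map_scale[OF _ bdd_zero, of \<Phi> C 0] by simp

lemma net_map_sum:
  assumes "bounded_net_map \<Phi> C" "\<And>s. s \<in> S \<Longrightarrow> bdd (f s)"
  shows "\<Phi> (\<lambda>i. \<Sum>s\<in>S. scaleE (k s) (f s i)) = (\<Sum>s\<in>S. scaleE (k s) (\<Phi> (f s)))"
  using assms(2)
proof (induction S rule: infinite_finite_induct)
  case (insert s S)
  have "\<Phi> (\<lambda>i. scaleE (k s) (f s i) + (\<Sum>s\<in>S. scaleE (k s) (f s i)))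
      = \<Phi> (\<lambda>i. scaleE (k s) (f s i)) + \<Phi> (\<lambda>i. \<Sum>s\<in>S. scaleE (k s) (f s i))"
    using insert.prems by (intro net_map_add[OF assms(1)] bdd_scale bdd_sum) auto
  thus ?case using insert net_map_scale[OF assms(1)] by simp
qed (simp_all add: net_map_zero[OF assms(1)])

text \<open>
  The failure of \<open>\<Phi>\<close> to commute with left multiplication by \<open>u\<close>.
\<close>

definition defect :: "'b \<Rightarrow> (('i \<Rightarrow> 'b) \<Rightarrow> 'b) \<Rightarrow> ('i \<Rightarrow> 'b) \<Rightarrow> 'b"
  where "defect u \<Phi> b = \<Phi> (\<lambda>i. u \<odot> b i) - u \<odot> \<Phi> b"

lemma net_map_defect:
  assumes \<Phi>: "bounded_net_map \<Phi> C" and u: "norm u \<le> 1"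
  shows "bounded_net_map (defect u \<Phi>) (2 * C)"
  unfolding bounded_net_map_def
proof (intro conjI allI impI)
  show "defect u \<Phi> (\<lambda>i. b i + c i) = defect u \<Phi> b + defect u \<Phi> c" if "bdd b" "bdd c" for b c
    using that net_map_add[OF \<Phi>] by (simp add: defect_def alg.mul_add_right bdd_mul)
  show "defect u \<Phi> (\<lambda>i. scaleE k (b i)) = scaleE k (defect u \<Phi> b)" if "bdd b" for b k
    using that net_map_scale[OF \<Phi>] by (simp add: defect_def alg.mul_sc_right bdd_mul dual.scale_right_diff_distrib)
  fix b :: "'i \<Rightarrow> 'b" and B assume b: "\<forall>i. norm (b i) \<le> B"
  have ub: "norm (u \<odot> x) \<le> A" if "norm x \<le> A" for x A
    using alg.N_mul_mono[OF u that] by simp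
  have "norm (defect u \<Phi> b) \<le> norm (\<Phi> (\<lambda>i. u \<odot> b i)) + norm (u \<odot> \<Phi> b)"
    unfolding defect_def by (rule norm_triangle_ineq4)
  also have "\<dots> \<le> C * B + C * B"
    using b by (intro add_mono ub net_map_norm[OF \<Phi>]) auto
  finally show "norm (defect u \<Phi> b) \<le> 2 * C * B" by (simp add: mult_ac)
qed

text \<open>
  Scalars commute with \<open>\<Phi>\<close>, so \<open>u\<close> may be replaced by \<open>u - k\<close>. This allows the scalar to be adapted to
  the net.
\<close>

lemma defect_shift:
  assumes \<Phi>: "bounded_net_map \<Phi> C" and b: "bdd b" and v: "v = u - scaleE k e"
  shows "defect u \<Phi> b = \<Phi> (\<lambda>i. v \<odot> b i) - v \<odot> \<Phi> b"
proof -
  have "\<Phi> (\<lambda>i. u \<odot> b i) = \<Phi> (\<lambda>i. v \<odot> b i + scaleE k (b i))"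
    by (simp add: v alg.mul_diff alg.mul_sc_left)
  also have "\<dots> = \<Phi> (\<lambda>i. v \<odot> b i) + scaleE k (\<Phi> b)"
    using net_map_add[OF \<Phi> bdd_mul[OF b] bdd_scale[OF b]] net_map_scale[OF \<Phi> b] by simp
  finally show ?thesis by (simp add: defect_def v alg.mul_diff alg.mul_sc_left)
qed

definition unitary :: "'b \<Rightarrow> bool"
  where "unitary u \<longleftrightarrow> star u \<odot> u = e \<and> u \<odot> star u = e"

lemma unitary_norm: "unitary u \<Longrightarrow> norm u \<le> 1"
  using norm_star_mul[of u] by (simp add: unitary_def) (metis C.N_e abs_norm_cancel order_refl real_sqrt_abs real_sqrt_one)

lemma unitary_upow_norm: assumes "unitary u" shows "norm (C.upow u m \<odot> z) = norm z"
proof (induction m)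
  case (Suc m)
  have "(norm (u \<odot> w))\<^sup>2 = (norm w)\<^sup>2" for w
    unfolding norm_star_mul[symmetric] using assms by (simp add: unitary_def star_mult mult_assoc) (simp flip: mult_assoc)
  hence "norm (u \<odot> w) = norm w" for w by simp
  thus ?case using Suc by (simp add: C.upow_Suc mult_assoc)
qed simp

text \<open>
  If the second defect vanishes, \<open>\<Phi> (u ^ m b)\<close> equals \<open>u ^ m (\<Phi> b)\<close> plus \<open>m\<close> times an element of the same
  norm as \<open>defect u \<Phi> b\<close>; boundedness leaves no room for the latter.
\<close>

lemma defect_zero_of_square:
  assumes \<Phi>: "bounded_net_map \<Phi> C" and u: "unitary u"
    and sq: "\<And>b. bdd b \<Longrightarrow> defect u (defect u \<Phi>) b = 0" and b: "bdd b"
  shows "defect u \<Phi> b = 0"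
proof -
  let ?U = "\<lambda>m i. C.upow u m \<odot> b i"
  have bU: "bdd (?U m)" for m by (rule bdd_mul[OF b])
  have step: "(\<lambda>i. u \<odot> ?U m i) = ?U (Suc m)" for m by (simp add: C.upow_Suc mult_assoc)
  have D: "defect u \<Phi> (?U m) = C.upow u m \<odot> defect u \<Phi> b" for m
  proof (induction m)
    case (Suc m)
    have "defect u \<Phi> (?U (Suc m)) = u \<odot> defect u \<Phi> (?U m)"
      using sq[OF bU[of m]] unfolding defect_def[of u "defect u \<Phi>"] step by simp
    thus ?case using Suc by (simp add: C.upow_Suc mult_assoc)
  qed simp
  have growth: "\<Phi> (?U (Suc m)) = C.upow u (Suc m) \<odot> \<Phi> b + C.rs (real (Suc m)) (C.upow u m \<odot> defect u \<Phi> b)" for m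
  proof (induction m)
    case 0
    show ?case by (simp add: defect_def C.upow_Suc)
  next
    case (Suc m)
    have "\<Phi> (?U (Suc (Suc m))) = u \<odot> \<Phi> (?U (Suc m)) + defect u \<Phi> (?U (Suc m))"
      unfolding defect_def step by simp
    also have "\<dots> = C.upow u (Suc (Suc m)) \<odot> \<Phi> b + (C.rs (real (Suc m)) (C.upow u (Suc m) \<odot> defect u \<Phi> b) + C.upow u (Suc m) \<odot> defect u \<Phi> b)"
      unfolding D Suc by (simp add: alg.mul_add_right C.mul_rs C.upow_Suc mult_assoc)
    also have "C.rs (real (Suc m)) (C.upow u (Suc m) \<odot> defect u \<Phi> b) + C.upow u (Suc m) \<odot> defect u \<Phi> b
        = C.rs (real (Suc (Suc m))) (C.upow u (Suc m) \<odot> defect u \<Phi> b)"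
      using C.rs_add_left[of "real (Suc m)" 1 "C.upow u (Suc m) \<odot> defect u \<Phi> b"] by (simp add: add.commute)
    finally show ?case .
  qed
  obtain B where B: "\<And>i. norm (b i) \<le> B" using b by (auto simp: bdd_def)
  have "real (Suc m) * norm (defect u \<Phi> b) \<le> C * B + norm (\<Phi> b)" for m
  proof -
    have "real (Suc m) * norm (defect u \<Phi> b) = norm (C.rs (real (Suc m)) (C.upow u m \<odot> defect u \<Phi> b))"
      by (simp only: C.N_rs unitary_upow_norm[OF u])
    also have "\<dots> = norm (\<Phi> (?U (Suc m)) - C.upow u (Suc m) \<odot> \<Phi> b)" by (simp only: growth) simp
    also have "\<dots> \<le> norm (\<Phi> (?U (Suc m))) + norm (C.upow u (Suc m) \<odot> \<Phi> b)" by (rule norm_triangle_ineq4)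
    also have "\<dots> \<le> C * B + norm (\<Phi> b)"
      unfolding unitary_upow_norm[OF u] by (intro add_right_mono net_map_norm[OF \<Phi>]) (simp add: unitary_upow_norm[OF u] B)
    finally show ?thesis .
  qed
  note bound = this
  have "norm (defect u \<Phi> b) = 0"
  proof (rule ccontr)
    assume "norm (defect u \<Phi> b) \<noteq> 0"
    hence "norm (defect u \<Phi> b) > 0" by simp
    then obtain m :: nat where "C * B + norm (\<Phi> b) < real m * norm (defect u \<Phi> b)" by (metis ex_less_of_nat_mult)
    also have "\<dots> \<le> real (Suc m) * norm (defect u \<Phi> b)" by (intro mult_right_mono) auto
    finally show False using bound[of m] by simp
  qed
  thus ?thesis by simp
qed

end

context universal_limit
begin

text \<open>
  The binomial expansion of the fourth defect, with \<open>v\<close> in place of \<open>u\<close>.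
\<close>

lemma fourth_defect_expand:
  assumes u: "norm u \<le> 1" and b: "bdd b" and v: "v = u - scaleE k e"
  shows "norm (defect u (defect u (defect u (defect u net_limit))) b) \<le>
    norm (net_limit (\<lambda>i. v \<odot> (v \<odot> (v \<odot> (v \<odot> b i))))) + 4 * norm (v \<odot> net_limit (\<lambda>i. v \<odot> (v \<odot> (v \<odot> b i))))
    + 6 * norm (v \<odot> (v \<odot> net_limit (\<lambda>i. v \<odot> (v \<odot> b i)))) + 4 * norm (v \<odot> (v \<odot> (v \<odot> net_limit (\<lambda>i. v \<odot> b i))))
    + norm (v \<odot> (v \<odot> (v \<odot> (v \<odot> net_limit b))))"
proof -
  define T0 where "T0 = net_limit b"
  define T1 where "T1 = net_limit (\<lambda>i. v \<odot> b i)"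
  define T2 where "T2 = net_limit (\<lambda>i. v \<odot> (v \<odot> b i))"
  define T3 where "T3 = net_limit (\<lambda>i. v \<odot> (v \<odot> (v \<odot> b i)))"
  define T4 where "T4 = net_limit (\<lambda>i. v \<odot> (v \<odot> (v \<odot> (v \<odot> b i))))"
  note m1 = net_map_limit and m2 = net_map_defect[OF net_map_limit u] and m3 = net_map_defect[OF net_map_defect[OF net_map_limit u] u]
    and m4 = net_map_defect[OF net_map_defect[OF net_map_defect[OF net_map_limit u] u] u]
  note bs = b bdd_mul[OF b] bdd_mul[OF bdd_mul[OF b]] bdd_mul[OF bdd_mul[OF bdd_mul[OF b]]]
    bdd_mul[OF bdd_mul[OF bdd_mul[OF bdd_mul[OF b]]]]
  have "defect u (defect u (defect u (defect u net_limit))) b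
      = T4 - (v \<odot> T3 + v \<odot> T3 + v \<odot> T3 + v \<odot> T3)
        + (v \<odot> (v \<odot> T2) + v \<odot> (v \<odot> T2) + v \<odot> (v \<odot> T2) + v \<odot> (v \<odot> T2) + v \<odot> (v \<odot> T2) + v \<odot> (v \<odot> T2))
        - (v \<odot> (v \<odot> (v \<odot> T1)) + v \<odot> (v \<odot> (v \<odot> T1)) + v \<odot> (v \<odot> (v \<odot> T1)) + v \<odot> (v \<odot> (v \<odot> T1)))
        + v \<odot> (v \<odot> (v \<odot> (v \<odot> T0)))"
    by (simp only: defect_shift[OF m4 bs(1) v] defect_shift[OF m3 bs(1) v] defect_shift[OF m3 bs(2) v]
        defect_shift[OF m2 bs(1) v] defect_shift[OF m2 bs(2) v] defect_shift[OF m2 bs(3) v]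
        defect_shift[OF m1 bs(1) v] defect_shift[OF m1 bs(2) v] defect_shift[OF m1 bs(3) v] defect_shift[OF m1 bs(4) v]
        T0_def[symmetric] T1_def[symmetric] T2_def[symmetric] T3_def[symmetric] T4_def[symmetric] alg.mul_diff)
       simp
  moreover have tri: "norm (a - (b + b + b + b) + (c + c + c + c + c + c) - (d + d + d + d) + f)
      \<le> norm a + 4 * norm b + 6 * norm c + 4 * norm d + norm f" for a b c d f :: 'b
  proof -
    have four: "norm (x + x + x + x) \<le> 4 * norm x" for x :: 'b
      using norm_triangle_ineq[of "x + x + x" x] norm_triangle_ineq[of "x + x" x] norm_triangle_ineq[of x x] by linarith
    have "norm (c + c + c + c + c + c) \<le> 6 * norm c"
      using four[of c] norm_triangle_ineq[of "c + c + c + c" c] norm_triangle_ineq[of "c + c + c + c + c" c] by linarith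
    thus ?thesis
      using four[of b] four[of d] norm_triangle_ineq4[of a "b + b + b + b"]
        norm_triangle_ineq[of "a - (b + b + b + b)" "c + c + c + c + c + c"]
        norm_triangle_ineq4[of "a - (b + b + b + b) + (c + c + c + c + c + c)" "d + d + d + d"]
        norm_triangle_ineq[of "a - (b + b + b + b) + (c + c + c + c + c + c) - (d + d + d + d)" f]
      by linarith
  qed
  ultimately show ?thesis
    unfolding T0_def[symmetric] T1_def[symmetric] T2_def[symmetric] T3_def[symmetric] T4_def[symmetric]
    by (simp only: tri)
qed

lemma net_map_fourth_defect:
  "norm u \<le> 1 \<Longrightarrow> bounded_net_map (defect u (defect u (defect u (defect u net_limit)))) (2 * (2 * (2 * (2 * 1))))"
  by (intro net_map_defect net_map_limit)

text \<open>
  Up to a power of \<open>u\<close>, \<open>q \<odot> q\<close> is the Fejer kernel of order \<open>M\<close> concentrated at the point \<open>k = cnj \<omega>\<close>.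
  With \<open>v = u - k\<close>, the product \<open>v \<odot> q\<close> telescopes and has norm at most \<open>2\<close>, so the net
  \<open>c = q \<odot> q \<odot> b\<close> has norm of order \<open>M\<^sup>2\<close>, but \<open>v \<odot> c\<close> only of order \<open>M\<close>, and \<open>v \<odot> v \<odot> c\<close> is bounded.
  In the expansion of the fourth defect, the terms with at least two factors \<open>v\<close> inside the limit
  are therefore bounded; the compression bounds show that the other two are of order \<open>sqrt M\<close>.
\<close>

lemma fejer_bound:
  assumes u: "unitary u" and \<omega>: "cmod \<omega> = 1" and b: "\<And>i. norm (b i) \<le> B" and M: "M \<ge> (1::nat)"
  defines "q \<equiv> \<Sum>j<M. scaleE (\<omega> ^ j) (C.upow u j)"
  shows "norm (defect u (defect u (defect u (defect u net_limit))) (\<lambda>i. q \<odot> (q \<odot> b i))) \<le> 256 * sqrt (real M) * B"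
proof -
  have B0: "B \<ge> 0" using b norm_ge_zero order_trans by blast
  have nu: "norm u \<le> 1" by (rule unitary_norm[OF u])
  define k where "k = cnj \<omega>"
  have k\<omega>: "k * \<omega> = 1" "\<omega> * k = 1" using \<omega> by (simp_all add: k_def complex_norm_square[symmetric] mult.commute)
  have nk: "cmod k = 1" using \<omega> by (simp add: k_def)
  define v where "v = u - scaleE k e"
  have sv: "star v \<odot> v = v \<odot> star v"
    using u by (simp add: v_def unitary_def alg.star_diff star_scale alg.mul_diff alg.mul_sc_left alg.mul_sc_right
        dual.scale_right_diff_distrib mult.commute)
  have nv: "norm v \<le> 2"
    using norm_triangle_ineq4[of u "scaleE k e"] nu nk by (simp add: v_def dual.norm_scale)
  have nU: "norm (C.upow u j) \<le> 1" for j
    using C.N_upow_le[of u j] power_le_one[OF norm_ge_zero nu, of j] by linarith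
  have nq: "norm q \<le> real M"
  proof -
    have "norm q \<le> (\<Sum>j<M. 1)" unfolding q_def
      by (rule order_trans[OF norm_sum sum_mono]) (simp add: dual.norm_scale norm_power \<omega> nU)
    thus ?thesis by simp
  qed
  have "v \<odot> (\<Sum>j<m. scaleE (\<omega> ^ j) (C.upow u j)) = scaleE (k * \<omega> ^ m) (C.upow u m) - scaleE k e" for m
  proof (induction m)
    case (Suc m)
    have "v \<odot> scaleE (\<omega> ^ m) (C.upow u m) = scaleE (\<omega> ^ m) (C.upow u (Suc m)) - scaleE (k * \<omega> ^ m) (C.upow u m)"
      by (simp add: v_def alg.mul_diff alg.mul_sc_left alg.mul_sc_right C.upow_Suc dual.scale_right_diff_distrib mult.commute)
    moreover have "k * \<omega> ^ Suc m = \<omega> ^ m" using k\<omega> by (simp add: mult.assoc[symmetric])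
    ultimately show ?case using Suc by (simp only: sum.lessThan_Suc alg.mul_add_right) simp
  qed simp
  hence vq: "v \<odot> q = scaleE (k * \<omega> ^ M) (C.upow u M) - scaleE k e" by (simp add: q_def)
  have nvq: "norm (v \<odot> q) \<le> 2"
    unfolding vq using norm_triangle_ineq4[of "scaleE (k * \<omega> ^ M) (C.upow u M)" "scaleE k e"] nU[of M]
    by (simp add: dual.norm_scale norm_mult norm_power nk \<omega>)
  have vu: "v \<odot> u = u \<odot> v" by (simp add: v_def alg.mul_diff alg.mul_sc_left alg.mul_sc_right)
  have comm: "v \<odot> q = q \<odot> v"
    by (simp add: q_def alg.mul_sum alg.mul_sc_left alg.mul_sc_right C.upow_commute[OF vu])
  define c where "c i = q \<odot> (q \<odot> b i)" for i
  have mono: "norm (x \<odot> y) \<le> a * a'" if "norm x \<le> a" "norm y \<le> a'" for x y a a'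
    by (rule alg.N_mul_mono[OF that])
  have c0: "norm (c i) \<le> real M * (real M * B)" for i
    unfolding c_def by (intro mono nq b)
  have vc: "v \<odot> c i = (v \<odot> q) \<odot> (q \<odot> b i)" for i by (simp only: c_def mult_assoc)
  have vvc: "v \<odot> (v \<odot> c i) = (v \<odot> q) \<odot> ((v \<odot> q) \<odot> b i)" for i
  proof -
    have "v \<odot> (v \<odot> c i) = v \<odot> ((q \<odot> v) \<odot> (q \<odot> b i))" by (simp only: vc comm)
    thus ?thesis by (simp only: mult_assoc)
  qed
  have c1: "norm (v \<odot> c i) \<le> 2 * (real M * B)" for i unfolding vc by (intro mono nvq nq b)
  have c2: "norm (v \<odot> (v \<odot> c i)) \<le> 2 * (2 * B)" for i unfolding vvc by (intro mono nvq b)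
  have c3: "norm (v \<odot> (v \<odot> (v \<odot> c i))) \<le> 2 * (2 * (2 * B))" for i by (intro mono nv c2)
  have c4: "norm (v \<odot> (v \<odot> (v \<odot> (v \<odot> c i)))) \<le> 2 * (2 * (2 * (2 * B)))" for i by (intro mono nv c3)
  have bc: "bdd c" by (rule bddI[OF c0])
  let ?s = "sqrt (real M)"
  have sq: "(n * (s * t))\<^sup>2 = n\<^sup>2 * ((s * s) * (t * t))" for n s t :: real
    by (simp add: power2_eq_square)
  have s1: "?s \<ge> 1" using M by simp
  have ss: "?s * ?s = real M" by simp
  have Bs: "B \<le> B * ?s" using mult_left_mono[OF s1 B0] by simp
  \<comment> \<open>The five terms of the expansion, by the number of factors \<open>v\<close> inside of the limit.\<close>
  have t4: "norm (net_limit (\<lambda>i. v \<odot> (v \<odot> (v \<odot> (v \<odot> c i))))) \<le> 16 * B" using net_limit_norm_le[OF c4] by simp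
  have t3: "norm (v \<odot> net_limit (\<lambda>i. v \<odot> (v \<odot> (v \<odot> c i)))) \<le> 16 * B"
    using mono[OF nv net_limit_norm_le[OF c3]] by simp
  have t2: "norm (v \<odot> (v \<odot> net_limit (\<lambda>i. v \<odot> (v \<odot> c i)))) \<le> 16 * B"
    using mono[OF nv mono[OF nv net_limit_norm_le[OF c2]]] by simp
  have nv2: "(norm v)\<^sup>2 \<le> 4" using power_mono[OF nv norm_ge_zero, of 2] by simp
  have t1: "norm (v \<odot> (v \<odot> (v \<odot> net_limit (\<lambda>i. v \<odot> c i)))) \<le> 16 * (?s * B)"
  proof -
    let ?r = "net_limit (\<lambda>i. v \<odot> c i)"
    have w: "wlim (\<lambda>i. v \<odot> c i) ?r G" by (intro wlim_net_limit bdd_mul bc)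
    have "(norm (v \<odot> (v \<odot> ?r)))\<^sup>2 \<le> (norm v)\<^sup>2 * (norm ?r * (2 * (2 * (2 * B))))"
      by (rule normal_compression_bounds(2)[OF w G_bot c1 sv c3])
    also have "\<dots> \<le> 4 * ((2 * (real M * B)) * (2 * (2 * (2 * B))))"
      using nv2 net_limit_norm_le[OF c1] B0 by (intro mult_mono) auto
    also have "\<dots> = 64 * ((?s * ?s) * (B * B))" unfolding ss by simp
    also have "\<dots> = (8 * (?s * B))\<^sup>2" by (simp only: sq) simp
    finally have "norm (v \<odot> (v \<odot> ?r)) \<le> 8 * (?s * B)" by (rule power2_le_imp_le) (use B0 in simp)
    from mono[OF nv this] show ?thesis by simp
  qed
  have t0: "norm (v \<odot> (v \<odot> (v \<odot> (v \<odot> net_limit c)))) \<le> 16 * (?s * B)"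
  proof -
    let ?r = "net_limit c"
    have w: "wlim c ?r G" by (intro wlim_net_limit bc)
    have "(norm (v \<odot> (v \<odot> ?r)))\<^sup>2 \<le> (norm v)\<^sup>2 * (norm ?r * (2 * (2 * B)))"
      by (rule normal_compression_bounds(2)[OF w G_bot c0 sv c2])
    also have "\<dots> \<le> 4 * ((real M * (real M * B)) * (2 * (2 * B)))"
      using nv2 net_limit_norm_le[OF c0] B0 by (intro mult_mono) auto
    also have "\<dots> = (4 * (real M * B))\<^sup>2" by (simp add: power2_eq_square)
    finally have vvr: "norm (v \<odot> (v \<odot> ?r)) \<le> 4 * (real M * B)" by (rule power2_le_imp_le) (use B0 in simp)
    let ?x = "v \<odot> v"
    have nx: "norm ?x \<le> 4" using mono[OF nv nv] by simp
    have nx2: "(norm ?x)\<^sup>2 \<le> 16" using power_mono[OF nx norm_ge_zero, of 2] by simp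
    have sx: "star ?x \<odot> ?x = ?x \<odot> star ?x"
    proof -
      have "star v \<odot> (v \<odot> z) = v \<odot> (star v \<odot> z)" for z using sv by (metis mult_assoc)
      thus ?thesis by (simp only: star_mult mult_assoc sv)
    qed
    have cx: "norm (?x \<odot> c i) \<le> 2 * (2 * B)" for i using c2[of i] by (simp only: mult_assoc)
    have "(norm (?x \<odot> (?x \<odot> ?r)))\<^sup>2 \<le> (norm ?x)\<^sup>2 * (norm (?x \<odot> ?r) * (2 * (2 * B)))"
      by (rule normal_compression_bounds(1)[OF w G_bot c0 sx cx])
    also have "\<dots> \<le> 16 * ((4 * (real M * B)) * (2 * (2 * B)))"
      using nx2 vvr B0 by (intro mult_mono) (auto simp: mult_assoc)
    also have "\<dots> = 256 * ((?s * ?s) * (B * B))" unfolding ss by simp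
    also have "\<dots> = (16 * (?s * B))\<^sup>2" by (simp only: sq) simp
    finally have "norm (?x \<odot> (?x \<odot> ?r)) \<le> 16 * (?s * B)" by (rule power2_le_imp_le) (use B0 in simp)
    thus ?thesis by (simp only: mult_assoc)
  qed
  have "norm (defect u (defect u (defect u (defect u net_limit))) c) \<le>
      16 * B + 4 * (16 * B) + 6 * (16 * B) + 4 * (16 * (?s * B)) + 16 * (?s * B)"
    by (rule order_trans[OF fourth_defect_expand[OF nu bc v_def]])
       (intro add_mono mult_left_mono t0 t1 t2 t3 t4, simp_all)
  also have "\<dots> \<le> 256 * (?s * B)" using Bs B0 by (simp add: mult.commute)
  finally show ?thesis by (simp add: c_def[abs_def] mult.assoc)
qed

text \<open>
  The exponent \<open>M - 1\<close> occurs \<open>M\<close> times in \<open>q\<^sup>2\<close>. Extracting its coefficient from \<open>fejer_bound\<close> bounds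
  \<open>M\<close> times the fourth defect by a multiple of \<open>sqrt M\<close>, for every \<open>M\<close>.
\<close>

lemma fourth_defect_zero:
  assumes u: "unitary u" and b: "bdd b"
  shows "defect u (defect u (defect u (defect u net_limit))) b = 0"
proof -
  let ?W = "defect u (defect u (defect u (defect u net_limit)))"
  have nu: "norm u \<le> 1" by (rule unitary_norm[OF u])
  note W = net_map_fourth_defect[OF nu]
  obtain B where B: "\<And>i. norm (b i) \<le> B" using b by (auto simp: bdd_def)
  have su: "unitary (star u)" using u by (simp add: unitary_def star_star)
  have inv: "C.upow u m \<odot> (C.upow (star u) m \<odot> z) = z" for m z
  proof (induction m arbitrary: z)
    case (Suc m)
    have "C.upow u (Suc m) \<odot> (C.upow (star u) (Suc m) \<odot> z)
        = u \<odot> (C.upow u m \<odot> (C.upow (star u) m \<odot> (star u \<odot> z)))"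
      by (simp only: C.upow_Suc[of u] C.upow_Suc2[of "star u"] mult_assoc)
    also have "\<dots> = (u \<odot> star u) \<odot> z" by (simp only: Suc mult_assoc)
    finally show ?case using u by (simp add: unitary_def)
  qed simp
  have est: "sqrt (real M) * norm (?W b) \<le> 256 * B" if M: "M \<ge> 1" for M :: nat
  proof -
    \<comment> \<open>Compensates for the factor \<open>u ^ (M - 1)\<close> that the coefficient extraction leaves on the net.\<close>
    define c where "c i = C.upow (star u) (M - 1) \<odot> b i" for i
    have c: "norm (c i) \<le> B" for i by (simp add: c_def unitary_upow_norm[OF su] B)
    have bc: "bdd c" by (rule bddI[OF c])
    define V where "V = (\<lambda>(i::nat, j::nat). ?W (\<lambda>l. C.upow u (i + j) \<odot> c l))"
    have "norm (\<Sum>s\<in>{s\<in>{..<M} \<times> {..<M}. fst s + snd s = M - 1}. V s) \<le> 256 * sqrt (real M) * B"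
    proof (rule alg.circle_coefficient_bound)
      fix \<omega> :: complex assume \<omega>: "cmod \<omega> = 1"
      let ?q = "\<Sum>j<M. scaleE (\<omega> ^ j) (C.upow u j)"
      have "?q \<odot> (?q \<odot> c l) = (\<Sum>s\<in>{..<M} \<times> {..<M}. scaleE (\<omega> ^ (fst s + snd s)) (C.upow u (fst s + snd s) \<odot> c l))" for l
      proof -
        have "?q \<odot> (?q \<odot> c l) = (\<Sum>i<M. \<Sum>j<M. scaleE (\<omega> ^ (i + j)) (C.upow u (i + j) \<odot> c l))"
          by (simp only: alg.mul_sum alg.mul_sc_left alg.mul_sc_right dual.scale_sum_right dual.scale_scale C.upow_add power_add mult_assoc)
             (subst sum.swap, simp only: mult.commute)
        thus ?thesis by (simp add: sum.cartesian_product split_beta)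
      qed
      hence "?W (\<lambda>l. ?q \<odot> (?q \<odot> c l)) = (\<Sum>s\<in>{..<M} \<times> {..<M}. scaleE (\<omega> ^ (fst s + snd s)) (V s))"
        by (simp only: net_map_sum[OF W bdd_mul[OF bc]]) (simp add: V_def split_beta)
      thus "norm (\<Sum>s\<in>{..<M} \<times> {..<M}. scaleE (\<omega> ^ (fst s + snd s)) (V s)) \<le> 256 * sqrt (real M) * B"
        using fejer_bound[OF u \<omega>, of c B M] c M by simp
    qed simp
    moreover have "V s = ?W b" if "s \<in> {s\<in>{..<M} \<times> {..<M}. fst s + snd s = M - 1}" for s
      using that by (auto simp: V_def c_def inv split: prod.splits)
    moreover have "card {s\<in>{..<M} \<times> {..<M}. fst s + snd s = M - 1} = M"
    proof -
      have "{s\<in>{..<M} \<times> {..<M}. fst s + snd s = M - 1} = (\<lambda>i. (i, M - 1 - i)) ` {..<M}"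
        by (auto simp: image_iff)
      moreover have "inj_on (\<lambda>i. (i, M - 1 - i)) {..<M}" by (auto simp: inj_on_def)
      ultimately show ?thesis by (simp add: card_image)
    qed
    ultimately have "norm (real M *\<^sub>R ?W b) \<le> 256 * sqrt (real M) * B"
      by (simp add: sum_constant_scaleR)
    hence "sqrt (real M) * (sqrt (real M) * norm (?W b)) \<le> sqrt (real M) * (256 * B)"
      by (simp add: mult_ac flip: mult.assoc)
    thus ?thesis using M by simp
  qed
  have "norm (?W b) = 0"
  proof (rule ccontr)
    assume "norm (?W b) \<noteq> 0"
    hence pos: "norm (?W b) > 0" by simp
    obtain n :: nat where n: "256 * B / norm (?W b) < real n" using reals_Archimedean2 by blast
    define M where "M = (Suc n)\<^sup>2"
    have "sqrt (real M) = real (Suc n)" unfolding M_def by (simp only: of_nat_power real_sqrt_abs)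
    hence "real (Suc n) * norm (?W b) \<le> 256 * B" using est[of M] by (simp add: M_def)
    moreover have "256 * B < real n * norm (?W b)" using n pos by (simp add: field_simps)
    moreover have "real n * norm (?W b) \<le> real (Suc n) * norm (?W b)" by (intro mult_right_mono) auto
    ultimately show False by linarith
  qed
  thus ?thesis by simp
qed

text \<open>
  Descend from the fourth defect to the first one, applying \<open>defect_zero_of_square\<close> three times.
\<close>

lemma net_limit_unitary_left:
  assumes u: "unitary u" and b: "bdd b" shows "net_limit (\<lambda>i. u \<odot> b i) = u \<odot> net_limit b"
proof -
  have nu: "norm u \<le> 1" by (rule unitary_norm[OF u])
  have 3: "defect u (defect u (defect u net_limit)) b = 0" if "bdd b" for b
    by (rule defect_zero_of_square[OF net_map_defect[OF net_map_defect[OF net_map_limit nu] nu] u fourth_defect_zero[OF u] that])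
  have 2: "defect u (defect u net_limit) b = 0" if "bdd b" for b
    by (rule defect_zero_of_square[OF net_map_defect[OF net_map_limit nu] u 3 that])
  have "defect u net_limit b = 0" by (rule defect_zero_of_square[OF net_map_limit u 2 b])
  thus ?thesis by (simp add: defect_def)
qed

text \<open>
  Take \<open>u = h + \<i> sqrt (1 - h\<^sup>2)\<close>.
\<close>

lemma self_adjoint_contraction_average_unitary:
  assumes h: "star h = h" "norm h \<le> 1"
  shows "\<exists>u. unitary u \<and> h = scaleE (1/2) (u + star u)"
proof -
  have "norm (e - (e - h \<odot> h)) \<le> 1" using alg.N_mul_mono[OF h(2) h(2)] by simp
  moreover have "star (e - h \<odot> h) = e - h \<odot> h" by (simp add: alg.star_diff star_mult h)
  ultimately obtain s where s: "star s = s" "s \<odot> s = e - h \<odot> h"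
      "\<And>w. w \<odot> (e - h \<odot> h) = (e - h \<odot> h) \<odot> w \<Longrightarrow> w \<odot> s = s \<odot> w"
    using C.sqrt_unit_ball by metis
  have hs: "h \<odot> s = s \<odot> h" by (rule s(3)) (simp add: alg.mul_diff mult_assoc)
  define u where "u = h + scaleE \<i> s"
  have su: "star u = h - scaleE \<i> s" by (simp add: u_def star_add star_scale h s)
  have "unitary u" unfolding unitary_def su
    by (simp add: u_def alg.mul_add_left alg.mul_add_right alg.mul_diff alg.mul_sc_left alg.mul_sc_right hs s
        dual.scale_right_diff_distrib dual.scale_right_distrib)
  moreover have "h = scaleE (1/2) (u + star u)"
    unfolding su by (simp add: u_def double)
  ultimately show ?thesis by blast
qed

text \<open>
  The algebra is spanned by unitaries. This is the separate weak* continuity of the product, for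
  bounded nets.
\<close>

theorem net_limit_mul_left: assumes b: "bdd b" shows "net_limit (\<lambda>i. x \<odot> b i) = x \<odot> net_limit b"
proof -
  have add: "net_limit (\<lambda>i. (y + z) \<odot> b i) = (y + z) \<odot> net_limit b"
    if "net_limit (\<lambda>i. y \<odot> b i) = y \<odot> net_limit b" "net_limit (\<lambda>i. z \<odot> b i) = z \<odot> net_limit b" for y z
    using that net_map_add[OF net_map_limit bdd_mul[OF b] bdd_mul[OF b]] by (simp add: alg.mul_add_left)
  have sc: "net_limit (\<lambda>i. scaleE k y \<odot> b i) = scaleE k y \<odot> net_limit b" if "net_limit (\<lambda>i. y \<odot> b i) = y \<odot> net_limit b" for y k
    using that net_map_scale[OF net_map_limit bdd_mul[OF b]] by (simp add: alg.mul_sc_left)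
  have sa: "net_limit (\<lambda>i. h \<odot> b i) = h \<odot> net_limit b" if h: "star h = h" for h
  proof -
    define c where "c = norm h + 1"
    have c: "c > 0" by (simp add: c_def add_nonneg_pos)
    define h' where "h' = C.rs (1 / c) h"
    have "star h' = h'" "norm h' \<le> 1"
      using h c by (simp_all add: h'_def C.star_rs C.N_rs field_simps) (simp add: c_def)
    then obtain u where u: "unitary u" "h' = scaleE (1/2) (u + star u)"
      using self_adjoint_contraction_average_unitary by blast
    have su: "unitary (star u)" using u(1) by (simp add: unitary_def star_star)
    have "net_limit (\<lambda>i. h' \<odot> b i) = h' \<odot> net_limit b" unfolding u(2)
      by (rule sc[OF add[OF net_limit_unitary_left[OF u(1) b] net_limit_unitary_left[OF su b]]])
    moreover have "h = scaleE (of_real c) h'" using c by (simp add: h'_def C.rs_def flip: of_real_mult)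
    ultimately show ?thesis using sc[of h' "of_real c"] by simp
  qed
  define h where "h = x + star x"
  define k where "k = scaleE \<i> (star x - x)"
  have hk: "star h = h" "star k = k"
    by (simp_all add: h_def k_def star_add star_star star_scale alg.star_diff add.commute dual.scale_right_diff_distrib)
  have "scaleE \<i> k = x - star x" by (simp add: k_def dual.scale_right_diff_distrib)
  hence "h + scaleE \<i> k = x + x" by (simp add: h_def)
  hence "scaleE (1/2) (h + scaleE \<i> k) = x" by (simp add: double)
  thus ?thesis using sc[OF add[OF sa[OF hk(1)] sc[OF sa[OF hk(2)]]], of "1/2" \<i>] by simp
qed

theorem net_limit_mul_right: assumes b: "bdd b" shows "net_limit (\<lambda>i. b i \<odot> x) = net_limit b \<odot> x"
proof -
  have "net_limit (\<lambda>i. b i \<odot> x) = net_limit (\<lambda>i. star (star x \<odot> star (b i)))" by (simp add: star_mult star_star)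
  also have "\<dots> = star (star x \<odot> star (net_limit b))"
    by (simp add: net_limit_star[OF bdd_mul[OF bdd_star[OF b]]] net_limit_mul_left[OF bdd_star[OF b]] net_limit_star[OF b])
  finally show ?thesis by (simp add: star_mult star_star)
qed

end

context unital_wstar_algebra
begin

theorem wlim_two_sided:
  assumes "universal_limit scaleP scaleE pairing mul star e G"
    and bd: "\<And>i. norm (b i) \<le> B" and lim: "wlim b r G"
  shows "wlim (\<lambda>i. x \<odot> b i \<odot> y) (x \<odot> r \<odot> y) G"
proof -
  interpret universal_limit scaleP scaleE pairing mul star e G by fact
  have b: "bdd b" by (rule bddI[OF bd])
  have xb: "bdd (\<lambda>i. x \<odot> b i)" by (rule bdd_mul[OF b])
  have "bdd (\<lambda>i. x \<odot> b i \<odot> y)"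
    unfolding bdd_def
  proof (intro exI allI)
    fix i show "norm (x \<odot> b i \<odot> y) \<le> norm x * B * norm y"
      by (intro alg.N_mul_mono order_refl bd)
  qed
  moreover have "net_limit (\<lambda>i. x \<odot> b i \<odot> y) = x \<odot> r \<odot> y"
    by (simp add: net_limit_mul_right[OF xb] net_limit_mul_left[OF b] net_limit_eqI[OF lim])
  ultimately show ?thesis using wlim_net_limit by metis
qed

end

section \<open>Positive matrices and complete positivity\<close>

lemma sum_fun_apply2: "(\<Sum>k\<in>A. f k) i j = (\<Sum>k\<in>A. f k i j :: 'z::ab_group_add)"
  by (induction A rule: infinite_finite_induct) (simp_all add: zero_fun_def plus_fun_def)

context unital_wstar_algebra
begin

text \<open>
  Matrices are functions, as in \<open>positive_matrix\<close>. Setting the product to \<open>0\<close> outside of the block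
  makes it associative on all functions, at the price of having no unit.
\<close>

definition mmul :: "nat \<Rightarrow> (nat \<Rightarrow> nat \<Rightarrow> 'e) \<Rightarrow> (nat \<Rightarrow> nat \<Rightarrow> 'e) \<Rightarrow> nat \<Rightarrow> nat \<Rightarrow> 'e"
  where "mmul n a b = (\<lambda>i j. if i < n \<and> j < n then \<Sum>k<n. a i k \<odot> b k j else 0)"

definition mstar :: "(nat \<Rightarrow> nat \<Rightarrow> 'e) \<Rightarrow> nat \<Rightarrow> nat \<Rightarrow> 'e"
  where "mstar a = (\<lambda>i j. star (a j i))"

definition mscale :: "complex \<Rightarrow> (nat \<Rightarrow> nat \<Rightarrow> 'e) \<Rightarrow> nat \<Rightarrow> nat \<Rightarrow> 'e"
  where "mscale c a = (\<lambda>i j. scaleE c (a i j))"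

definition mnorm :: "nat \<Rightarrow> (nat \<Rightarrow> nat \<Rightarrow> 'e) \<Rightarrow> real"
  where "mnorm n a = (\<Sum>i<n. \<Sum>j<n. norm (a i j))"

lemma mnorm_mul: "mnorm n (mmul n a b) \<le> mnorm n a * mnorm n b"
proof -
  have "mnorm n (mmul n a b) = (\<Sum>i<n. \<Sum>j<n. norm (\<Sum>k<n. a i k \<odot> b k j))"
    by (simp add: mnorm_def mmul_def)
  also have "\<dots> \<le> (\<Sum>i<n. \<Sum>j<n. \<Sum>k<n. norm (a i k) * norm (b k j))"
    by (intro sum_mono order_trans[OF norm_sum]) (rule norm_mult_le)
  also have "\<dots> = (\<Sum>i<n. \<Sum>k<n. norm (a i k) * (\<Sum>j<n. norm (b k j)))"
    unfolding sum_distrib_left by (rule sum.cong[OF refl], rule sum.swap)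
  also have "\<dots> \<le> (\<Sum>i<n. \<Sum>k<n. norm (a i k) * mnorm n b)"
  proof (intro sum_mono mult_left_mono)
    fix k assume "k \<in> {..<n}"
    thus "(\<Sum>j<n. norm (b k j)) \<le> mnorm n b"
      unfolding mnorm_def by (intro member_le_sum) (auto intro: sum_nonneg)
  qed simp
  also have "\<dots> = mnorm n a * mnorm n b" by (simp add: mnorm_def sum_distrib_right)
  finally show ?thesis .
qed

lemma entry_le_mnorm: "i < n \<Longrightarrow> j < n \<Longrightarrow> norm (a i j) \<le> mnorm n a"
proof -
  assume ij: "i < n" "j < n"
  have "norm (a i j) \<le> (\<Sum>j<n. norm (a i j))" using ij by (intro member_le_sum) auto
  also have "\<dots> \<le> mnorm n a" unfolding mnorm_def using ij by (intro member_le_sum) (auto intro: sum_nonneg)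
  finally show ?thesis .
qed

lemma matrix_algebra: "complete_seminormed_star_algebra mscale (mmul n) mstar (mnorm n)"
proof unfold_locales
  show "mmul n (mmul n a b) c = mmul n a (mmul n b c)" for a b c
  proof (intro ext)
    fix i j
    show "mmul n (mmul n a b) c i j = mmul n a (mmul n b c) i j"
    proof (cases "i < n \<and> j < n")
      case True
      have "(\<Sum>k<n. (\<Sum>l<n. a i l \<odot> b l k) \<odot> c k j) = (\<Sum>k<n. \<Sum>l<n. a i l \<odot> (b l k \<odot> c k j))"
        by (simp add: alg.mul_sum mult_assoc)
      also have "\<dots> = (\<Sum>l<n. a i l \<odot> (\<Sum>k<n. b l k \<odot> c k j))"
        by (subst sum.swap) (simp add: alg.mul_sum)
      finally show ?thesis using True by (simp add: mmul_def)
    qed (auto simp: mmul_def)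
  qed
  show "mmul n (a + b) c = mmul n a c + mmul n b c" "mmul n c (a + b) = mmul n c a + mmul n c b" for a b c
    by (auto simp: mmul_def fun_eq_iff alg.mul_add_left alg.mul_add_right sum.distrib)
  show "mmul n (mscale k a) b = mscale k (mmul n a b)" "mmul n a (mscale k b) = mscale k (mmul n a b)" for k a b
    by (auto simp: mmul_def mscale_def fun_eq_iff alg.mul_sc_left alg.mul_sc_right dual.scale_sum_right)
  show "mstar (mmul n a b) = mmul n (mstar b) (mstar a)" for a b
    by (auto simp: mmul_def mstar_def fun_eq_iff alg.star_sum star_mult)
  show "mnorm n (a + b) \<le> mnorm n a + mnorm n b" for a b
    unfolding mnorm_def sum.distrib[symmetric] by (intro sum_mono) (simp add: norm_triangle_ineq)
  show "mnorm n (mscale k a) = cmod k * mnorm n a" for k a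
    by (simp add: mnorm_def mscale_def dual.norm_scale sum_distrib_left)
  show "mnorm n (mmul n a b) \<le> mnorm n a * mnorm n b" for a b by (rule mnorm_mul)
  show "mnorm n (mstar a) = mnorm n a" for a
    unfolding mnorm_def mstar_def alg.N_star by (rule sum.swap)
  show "\<exists>s. (\<lambda>m. mnorm n (s - (\<Sum>k<m. X k))) \<longlonglongrightarrow> 0" if X: "summable (\<lambda>k. mnorm n (X k))" for X
  proof -
    define s where "s i j = (\<Sum>k. X k i j)" for i j
    have "(\<lambda>m. s i j - (\<Sum>k<m. X k i j)) \<longlonglongrightarrow> s i j - s i j" if "i < n" "j < n" for i j
      unfolding s_def
    proof (intro tendsto_diff tendsto_const summable_LIMSEQ)
      show "summable (\<lambda>k. X k i j)"
        by (rule summable_comparison_test'[OF X, of 0]) (use that entry_le_mnorm in auto)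
    qed
    hence "(\<lambda>m. \<Sum>i<n. \<Sum>j<n. norm (s i j - (\<Sum>k<m. X k i j))) \<longlonglongrightarrow> (\<Sum>i<n. \<Sum>j<n. 0)"
      by (intro tendsto_sum tendsto_norm_zero) auto
    hence "(\<lambda>m. mnorm n (s - (\<Sum>k<m. X k))) \<longlonglongrightarrow> 0"
      by (simp add: mnorm_def sum_fun_apply2)
    thus ?thesis by blast
  qed
qed (auto simp: mscale_def mstar_def fun_eq_iff star_add star_scale star_star dual.scale_right_distrib dual.scale_left_distrib)

definition ip :: "nat \<Rightarrow> (nat \<Rightarrow> 'e) \<Rightarrow> (nat \<Rightarrow> 'e) \<Rightarrow> 'e"
  where "ip n \<xi> \<eta> = (\<Sum>i<n. star (\<xi> i) \<odot> \<eta> i)"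

definition ap :: "nat \<Rightarrow> (nat \<Rightarrow> nat \<Rightarrow> 'e) \<Rightarrow> (nat \<Rightarrow> 'e) \<Rightarrow> nat \<Rightarrow> 'e"
  where "ap n a \<xi> i = (\<Sum>j<n. a i j \<odot> \<xi> j)"

text \<open>
  In contrast to the form \<open>star b \<odot> b\<close>, this condition is visibly stable under sums and under limits
  that respect two-sided multiplication.
\<close>

definition psd :: "nat \<Rightarrow> (nat \<Rightarrow> nat \<Rightarrow> 'e) \<Rightarrow> bool"
  where "psd n a \<longleftrightarrow> (\<forall>i<n. \<forall>j<n. star (a i j) = a j i) \<and> (\<forall>\<xi>. C.pos (ip n \<xi> (ap n a \<xi>)))"

lemma ip_diff: "ip n (\<lambda>i. \<xi> i - \<xi>' i) \<eta> = ip n \<xi> \<eta> - ip n \<xi>' \<eta>" "ip n \<xi> (\<lambda>i. \<eta> i - \<eta>' i) = ip n \<xi> \<eta> - ip n \<xi> \<eta>'"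
  by (simp_all add: ip_def alg.star_diff alg.mul_diff sum_subtractf)

lemma ap_diff: "ap n a (\<lambda>i. \<xi> i - \<eta> i) = (\<lambda>i. ap n a \<xi> i - ap n a \<eta> i)"
  by (simp add: fun_eq_iff ap_def alg.mul_diff sum_subtractf)

lemma ip_ap: "ip n \<xi> (ap n a \<eta>) = (\<Sum>i<n. \<Sum>j<n. star (\<xi> i) \<odot> a i j \<odot> \<eta> j)"
  by (simp add: ip_def ap_def alg.mul_sum mult_assoc)

lemma ip_hermitian:
  assumes "\<And>i j. i < n \<Longrightarrow> j < n \<Longrightarrow> star (a i j) = a j i"
  shows "ip n (ap n a \<xi>) \<eta> = ip n \<xi> (ap n a \<eta>)"
proof -
  have "ip n (ap n a \<xi>) \<eta> = (\<Sum>i<n. \<Sum>j<n. star (\<xi> j) \<odot> star (a i j) \<odot> \<eta> i)"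
    by (simp add: ip_def ap_def alg.star_sum star_mult alg.mul_sum)
  also have "\<dots> = (\<Sum>i<n. \<Sum>j<n. star (\<xi> j) \<odot> a j i \<odot> \<eta> i)"
    by (intro sum.cong refl) (simp add: assms)
  also have "\<dots> = ip n \<xi> (ap n a \<eta>)" unfolding ip_ap by (rule sum.swap)
  finally show ?thesis .
qed

lemma ip_pos: "C.pos (ip n \<xi> \<xi>)"
  unfolding ip_def by (intro C.pos_sum C.pos_star_mul)

lemma positive_matrix_imp_psd:
  assumes "positive_matrix mul star n a" shows "psd n a"
proof -
  obtain b where b: "\<And>i j. i < n \<Longrightarrow> j < n \<Longrightarrow> a i j = (\<Sum>k<n. star (b k i) \<odot> b k j)"
    using assms by (auto simp: positive_matrix_def)
  have "ip n \<xi> (ap n a \<xi>) = (\<Sum>k<n. star (\<Sum>i<n. b k i \<odot> \<xi> i) \<odot> (\<Sum>j<n. b k j \<odot> \<xi> j))" for \<xi>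
  proof -
    have "ip n \<xi> (ap n a \<xi>) = (\<Sum>i<n. \<Sum>j<n. \<Sum>k<n. star (\<xi> i) \<odot> (star (b k i) \<odot> (b k j \<odot> \<xi> j)))"
      unfolding ip_ap by (intro sum.cong refl) (simp add: b alg.mul_sum mult_assoc)
    also have "\<dots> = (\<Sum>i<n. \<Sum>k<n. \<Sum>j<n. star (\<xi> i) \<odot> (star (b k i) \<odot> (b k j \<odot> \<xi> j)))"
      by (rule sum.cong[OF refl], rule sum.swap)
    also have "\<dots> = (\<Sum>k<n. \<Sum>i<n. \<Sum>j<n. star (\<xi> i) \<odot> (star (b k i) \<odot> (b k j \<odot> \<xi> j)))"
      by (rule sum.swap)
    also have "\<dots> = (\<Sum>k<n. star (\<Sum>i<n. b k i \<odot> \<xi> i) \<odot> (\<Sum>j<n. b k j \<odot> \<xi> j))"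
      unfolding alg.star_sum alg.mul_sum(1) unfolding alg.mul_sum(2) by (simp add: star_mult mult_assoc)
    finally show ?thesis .
  qed
  hence "C.pos (ip n \<xi> (ap n a \<xi>))" for \<xi> by (auto intro: C.pos_sum C.pos_star_mul)
  moreover have "star (a i j) = a j i" if "i < n" "j < n" for i j
    using that by (simp add: b alg.star_sum star_mult star_star)
  ultimately show ?thesis by (auto simp: psd_def)
qed

text \<open>
  Complete the square: the difference is \<open>star z \<odot> z\<close>, for \<open>z = sqrt \<mu> x - m y / sqrt \<mu>\<close>, plus a multiple
  of \<open>star y \<odot> (\<mu>\<^sup>2 - star m \<odot> m) \<odot> y\<close>.
\<close>

lemma young_inequality:
  assumes \<mu>: "norm m \<le> \<mu>"
  shows "C.pos (C.rs \<mu> (star x \<odot> x + star y \<odot> y) - (star x \<odot> m \<odot> y + star y \<odot> star m \<odot> x))"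
proof (cases "\<mu> = 0")
  case True
  thus ?thesis using \<mu> by simp
next
  case False
  hence \<mu>0: "\<mu> > 0" using \<mu> norm_ge_zero[of m] by linarith
  define z where "z = C.rs (sqrt \<mu>) x - C.rs (1 / sqrt \<mu>) (m \<odot> y)"
  have "norm (star m \<odot> m) \<le> \<mu>\<^sup>2" using power_mono[OF \<mu> norm_ge_zero] by (simp add: norm_star_mul)
  hence "C.pos (C.rs (\<mu>\<^sup>2) e - star m \<odot> m)"
    by (intro C.pos_diff_of_norm) (simp_all add: star_mult star_star)
  hence p: "C.pos (C.rs (1 / \<mu>) (star y \<odot> (C.rs (\<mu>\<^sup>2) e - star m \<odot> m) \<odot> y))"
    using \<mu>0 by (intro C.pos_rs C.pos_conj) auto
  have 1: "star z \<odot> z = C.rs \<mu> (star x \<odot> x) - star x \<odot> m \<odot> y - star y \<odot> star m \<odot> x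
      + C.rs (1 / \<mu>) (star y \<odot> star m \<odot> m \<odot> y)"
    using \<mu>0 by (simp add: z_def alg.star_diff C.star_rs alg.mul_diff C.mul_rs C.rs_rs C.rs_diff_right star_mult mult_assoc)
  have 2: "C.rs (1 / \<mu>) (star y \<odot> (C.rs (\<mu>\<^sup>2) e - star m \<odot> m) \<odot> y)
      = C.rs \<mu> (star y \<odot> y) - C.rs (1 / \<mu>) (star y \<odot> star m \<odot> m \<odot> y)"
    using \<mu>0 by (simp add: alg.mul_diff C.mul_rs C.rs_rs C.rs_diff_right mult_assoc power2_eq_square)
  have "C.rs \<mu> (star x \<odot> x + star y \<odot> y) - (star x \<odot> m \<odot> y + star y \<odot> star m \<odot> x)
      = star z \<odot> z + C.rs (1 / \<mu>) (star y \<odot> (C.rs (\<mu>\<^sup>2) e - star m \<odot> m) \<odot> y)"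
    unfolding 1 2 by (simp add: C.rs_add_right)
  thus ?thesis using C.pos_add[OF C.pos_star_mul[of z] p] by simp
qed

lemma form_le_ip:
  assumes h: "\<And>i j. i < n \<Longrightarrow> j < n \<Longrightarrow> star (a i j) = a j i"
  shows "C.pos (C.rs (mnorm n a) (ip n \<xi> \<xi>) - ip n \<xi> (ap n a \<xi>))"
proof -
  let ?S = "ip n \<xi> \<xi>" and ?q = "\<lambda>i. star (\<xi> i) \<odot> \<xi> i" and ?f = "ip n \<xi> (ap n a \<xi>)"
  let ?t = "\<lambda>i j. star (\<xi> i) \<odot> a i j \<odot> \<xi> j"
  have qS: "C.pos (?S - ?q i)" if "i < n" for i
  proof -
    have "?S - ?q i = (\<Sum>k\<in>{..<n} - {i}. ?q k)" using that by (simp add: ip_def sum_diff1)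
    thus ?thesis by (simp add: C.pos_sum C.pos_star_mul)
  qed
  have pair: "C.pos (C.rs (norm (a i j)) (?S + ?S) - (?t i j + ?t j i))" if ij: "i < n" "j < n" for i j
  proof -
    have eq: "C.rs (norm (a i j)) (?S + ?S) - (?t i j + ?t j i)
      = (C.rs (norm (a i j)) (?q i + ?q j) - (star (\<xi> i) \<odot> a i j \<odot> \<xi> j + star (\<xi> j) \<odot> star (a i j) \<odot> \<xi> i))
        + C.rs (norm (a i j)) ((?S - ?q i) + (?S - ?q j))"
      using ij by (simp add: h C.rs_add_right C.rs_diff_right)
    show ?thesis unfolding eq
      by (intro C.pos_add C.pos_rs young_inequality order_refl qS ij norm_ge_zero)
  qed
  have "C.pos (\<Sum>i<n. \<Sum>j<n. C.rs (norm (a i j)) (?S + ?S) - (?t i j + ?t j i))"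
    by (intro C.pos_sum pair) auto
  also have "(\<Sum>i<n. \<Sum>j<n. C.rs (norm (a i j)) (?S + ?S) - (?t i j + ?t j i)) =
      C.rs (mnorm n a) (?S + ?S) - (?f + ?f)"
  proof -
    have 1: "(\<Sum>i<n. \<Sum>j<n. C.rs (norm (a i j)) z) = C.rs (mnorm n a) z" for z
      by (simp add: mnorm_def C.rs_def dual.scale_sum_left)
    have 2: "(\<Sum>i<n. \<Sum>j<n. ?t j i) = ?f" unfolding ip_ap by (rule sum.swap)
    show ?thesis by (simp only: sum_subtractf sum.distrib 1 2 ip_ap[symmetric])
  qed
  finally have "C.pos (C.rs (1/2) (C.rs (mnorm n a) (?S + ?S) - (?f + ?f)))" by (rule C.pos_rs) simp
  also have "C.rs (1/2) (C.rs (mnorm n a) (?S + ?S) - (?f + ?f)) = C.rs (mnorm n a) ?S - ?f"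
  proof -
    have "C.rs (mnorm n a) (?S + ?S) - (?f + ?f) = (C.rs (mnorm n a) ?S - ?f) + (C.rs (mnorm n a) ?S - ?f)"
      by (simp add: C.rs_add_right)
    thus ?thesis by (simp only: C.rs_half)
  qed
  finally show ?thesis .
qed

text \<open>
  If \<open>0 \<le> x \<le> 1\<close> then \<open>x\<^sup>2 \<le> x\<close>, because \<open>x - x\<^sup>2 = x (1 - x) x + (1 - x) x (1 - x)\<close>.
\<close>

lemma contractive_of_between_zero_and_one:
  assumes h: "\<And>i j. i < n \<Longrightarrow> j < n \<Longrightarrow> star (x i j) = x j i"
    and p: "\<And>\<xi>. C.pos (ip n \<xi> (ap n x \<xi>))" and q: "\<And>\<xi>. C.pos (ip n \<xi> \<xi> - ip n \<xi> (ap n x \<xi>))"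
  shows "C.pos (ip n \<xi> \<xi> - ip n (ap n x \<xi>) (ap n x \<xi>))"
proof -
  define \<eta> where "\<eta> = ap n x \<xi>"
  have sym: "ip n \<eta> \<zeta> = ip n \<xi> (ap n x \<zeta>)" for \<zeta> unfolding \<eta>_def by (rule ip_hermitian[OF h])
  have eq: "ip n \<xi> \<xi> - ip n \<eta> \<eta> = (ip n \<xi> \<xi> - ip n \<xi> (ap n x \<xi>)) + ((ip n \<eta> \<eta> - ip n \<eta> (ap n x \<eta>))
      + ip n (\<lambda>i. \<xi> i - \<eta> i) (ap n x (\<lambda>i. \<xi> i - \<eta> i)))"
    unfolding ap_diff ip_diff using sym[of \<eta>] by (simp add: \<eta>_def[symmetric])
  show ?thesis unfolding \<eta>_def[symmetric] eq by (intro C.pos_add p q q[of \<xi>, folded \<eta>_def])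
qed

text \<open>
  For large \<open>T\<close> the matrix \<open>x = 1 - a / T\<close> lies between \<open>0\<close> and \<open>1\<close> in the sense of quadratic forms.
  Its powers are then contractions on the columns, so their entries are bounded by \<open>1\<close>, and
  \<open>sqrt_series\<close> provides a self-adjoint \<open>y\<close> with \<open>(1 - y)\<^sup>2 = a / T\<close>. Hence \<open>b = sqrt T (1 - y)\<close> is a
  square root of \<open>a\<close>.
\<close>

lemma psd_imp_positive_matrix:
  assumes "psd n a" shows "positive_matrix mul star n a"
proof -
  interpret M: complete_seminormed_star_algebra mscale "mmul n" mstar "mnorm n" by (rule matrix_algebra)
  have h: "star (a i j) = a j i" if "i < n" "j < n" for i j using assms that by (simp add: psd_def)
  have p: "C.pos (ip n \<xi> (ap n a \<xi>))" for \<xi> using assms by (simp add: psd_def)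
  define T where "T = mnorm n a + 1"
  have T: "T > 0" "mnorm n a \<le> T" using M.N_nonneg[of a] by (simp_all add: T_def add_nonneg_pos)
  define \<delta> where "\<delta> i j = (if i = j then e else 0)" for i j :: nat
  have s\<delta>: "star (\<delta> i j) = \<delta> j i" for i j by (simp add: \<delta>_def)
  have sum\<delta>: "(\<Sum>j<n. \<delta> i j \<odot> f j) = f i" "(\<Sum>j<n. f j \<odot> \<delta> j i) = f i" if "i < n" for i and f :: "nat \<Rightarrow> 'e"
  proof -
    have "(\<Sum>j<n. \<delta> i j \<odot> f j) = (\<Sum>j<n. if j = i then f j else 0)" by (intro sum.cong) (auto simp: \<delta>_def)
    thus "(\<Sum>j<n. \<delta> i j \<odot> f j) = f i" using that by simp
    have "(\<Sum>j<n. f j \<odot> \<delta> j i) = (\<Sum>j<n. if j = i then f j else 0)" by (intro sum.cong) (auto simp: \<delta>_def)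
    thus "(\<Sum>j<n. f j \<odot> \<delta> j i) = f i" using that by simp
  qed
  define x where "x i j = (if i < n \<and> j < n then \<delta> i j - C.rs (1 / T) (a i j) else 0)" for i j
  have hx: "star (x i j) = x j i" for i j
    by (auto simp: x_def alg.star_diff C.star_rs s\<delta> h)
  have formx: "ip n \<xi> (ap n x \<xi>) = ip n \<xi> \<xi> - C.rs (1 / T) (ip n \<xi> (ap n a \<xi>))" for \<xi>
  proof -
    have "ap n x \<xi> i = \<xi> i - C.rs (1 / T) (ap n a \<xi> i)" if "i < n" for i
      using that sum\<delta>(1)[OF that, of \<xi>]
      by (simp add: ap_def x_def alg.mul_diff sum_subtractf C.mul_rs C.rs_def dual.scale_sum_right alg.mul_sc_left)
    hence "ip n \<xi> (ap n x \<xi>) = ip n \<xi> (\<lambda>i. \<xi> i - C.rs (1 / T) (ap n a \<xi> i))"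
      unfolding ip_def by (intro sum.cong) auto
    thus ?thesis by (simp add: ip_diff) (simp add: ip_def C.rs_def dual.scale_sum_right alg.mul_sc_right)
  qed
  have px: "C.pos (ip n \<xi> (ap n x \<xi>))" for \<xi>
  proof -
    have "C.pos (C.rs (1 / T) ((C.rs (mnorm n a) (ip n \<xi> \<xi>) - ip n \<xi> (ap n a \<xi>)) + C.rs (T - mnorm n a) (ip n \<xi> \<xi>)))"
      using T by (intro C.pos_rs C.pos_add form_le_ip ip_pos h) auto
    also have "C.rs (1 / T) ((C.rs (mnorm n a) (ip n \<xi> \<xi>) - ip n \<xi> (ap n a \<xi>)) + C.rs (T - mnorm n a) (ip n \<xi> \<xi>))
        = ip n \<xi> (ap n x \<xi>)"
      unfolding formx using T(1) by (simp add: C.rs_simps)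
    finally show ?thesis .
  qed
  have qx: "C.pos (ip n \<xi> \<xi> - ip n \<xi> (ap n x \<xi>))" for \<xi>
    unfolding formx using T(1) by (simp add: C.pos_rs p)
  have contr: "C.pos (ip n \<xi> \<xi> - ip n (ap n x \<xi>) (ap n x \<xi>))" for \<xi>
    by (rule contractive_of_between_zero_and_one[OF hx px qx])
  have ap_pow: "ap n (M.ppow x (Suc k)) \<xi> i = ap n x (ap n (M.ppow x k) \<xi>) i" if "i < n" for k \<xi> i
  proof -
    have "(\<Sum>j<n. (\<Sum>l<n. x i l \<odot> M.ppow x k l j) \<odot> \<xi> j) = (\<Sum>j<n. \<Sum>l<n. x i l \<odot> (M.ppow x k l j \<odot> \<xi> j))"
      by (simp add: alg.mul_sum mult_assoc)
    also have "\<dots> = (\<Sum>l<n. x i l \<odot> (\<Sum>j<n. M.ppow x k l j \<odot> \<xi> j))"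
      by (subst sum.swap) (simp add: alg.mul_sum)
    finally show ?thesis using that by (simp add: ap_def M.ppow_Suc mmul_def)
  qed
  have ip_cong: "ip n \<xi> \<xi> = ip n \<eta> \<eta>" if "\<And>i. i < n \<Longrightarrow> \<xi> i = \<eta> i" for \<xi> \<eta>
    unfolding ip_def using that by (intro sum.cong) auto
  have contr_pow: "norm (ip n (ap n (M.ppow x k) \<xi>) (ap n (M.ppow x k) \<xi>)) \<le> norm (ip n \<xi> \<xi>)" for k \<xi>
  proof (induction k)
    case 0
    show ?case using C.pos_norm_le[OF ip_pos contr[of \<xi>]] by simp
  next
    case (Suc k)
    have "ip n (ap n (M.ppow x (Suc k)) \<xi>) (ap n (M.ppow x (Suc k)) \<xi>)
        = ip n (ap n x (ap n (M.ppow x k) \<xi>)) (ap n x (ap n (M.ppow x k) \<xi>))"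
      by (rule ip_cong) (rule ap_pow)
    thus ?case using C.pos_norm_le[OF ip_pos contr[of "ap n (M.ppow x k) \<xi>"]] Suc by simp
  qed
  have entry: "norm (M.ppow x k i j) \<le> 1" if ij: "i < n" "j < n" for k i j
  proof -
    let ?\<xi> = "\<lambda>l. \<delta> l j" and ?y = "ap n (M.ppow x k) (\<lambda>l. \<delta> l j)"
    have "ip n ?\<xi> ?\<xi> = (\<Sum>l<n. \<delta> j l \<odot> \<delta> l j)" by (simp add: ip_def s\<delta>)
    hence "ip n ?\<xi> ?\<xi> = e" by (simp only: sum\<delta>(1)[OF ij(2)]) (simp add: \<delta>_def)
    hence le1: "norm (ip n ?y ?y) \<le> 1" using contr_pow[of k ?\<xi>] by simp
    have "?y i = M.ppow x k i j" unfolding ap_def by (rule sum\<delta>(2)[OF ij(2)])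
    moreover have "norm (star (?y i) \<odot> ?y i) \<le> norm (ip n ?y ?y)"
    proof (rule C.pos_norm_le[OF C.pos_star_mul])
      have "ip n ?y ?y - star (?y i) \<odot> ?y i = (\<Sum>l\<in>{..<n} - {i}. star (?y l) \<odot> ?y l)"
        using ij by (simp add: ip_def sum_diff1)
      thus "C.pos (ip n ?y ?y - star (?y i) \<odot> ?y i)" by (simp add: C.pos_sum C.pos_star_mul)
    qed
    ultimately have "(norm (M.ppow x k i j))\<^sup>2 \<le> 1\<^sup>2" using le1 by (simp add: norm_star_mul)
    thus ?thesis by (rule power2_le_imp_le) simp
  qed
  have bd: "mnorm n (M.ppow x k) \<le> (\<Sum>i<n. \<Sum>j<n. 1)" for k
    unfolding mnorm_def by (intro sum_mono entry) auto
  have sx: "mstar x = x" by (simp add: mstar_def hx)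
  obtain y where y: "mnorm n (y + y - mmul n y y - x) = 0" "mnorm n (mstar y - y) = 0"
    using M.sqrt_series[OF sx bd] by metis
  have y1: "y i j + y i j - (\<Sum>k<n. y i k \<odot> y k j) = x i j" if "i < n" "j < n" for i j
    using entry_le_mnorm[OF that, of "y + y - mmul n y y - x"] y(1) that by (simp add: mmul_def)
  have y2: "star (y j i) = y i j" if "i < n" "j < n" for i j
    using entry_le_mnorm[OF that, of "mstar y - y"] y(2) by (simp add: mstar_def)
  \<comment> \<open>The entries of \<open>sqrt T * (1 - y)\<close>.\<close>
  define b where "b k i = C.rs (sqrt T) (\<delta> k i - y k i)" for k i
  have "a i j = (\<Sum>k<n. star (b k i) \<odot> b k j)" if ij: "i < n" "j < n" for i j
  proof -
    have "(\<Sum>k<n. star (b k i) \<odot> b k j) = (\<Sum>k<n. C.rs T ((\<delta> i k - y i k) \<odot> (\<delta> k j - y k j)))"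
      using T(1) ij by (intro sum.cong refl) (simp add: b_def C.star_rs C.mul_rs C.rs_rs alg.star_diff s\<delta> y2)
    also have "\<dots> = C.rs T (\<Sum>k<n. (\<delta> i k - y i k) \<odot> (\<delta> k j - y k j))"
      by (simp add: C.rs_def dual.scale_sum_right)
    also have "(\<Sum>k<n. (\<delta> i k - y i k) \<odot> (\<delta> k j - y k j)) = \<delta> i j - (y i j + y i j - (\<Sum>k<n. y i k \<odot> y k j))"
      by (simp only: alg.mul_diff sum_subtractf sum\<delta>(1)[OF ij(1)] sum\<delta>(2)[OF ij(2)]) simp
    also have "\<dots> = C.rs (1 / T) (a i j)" unfolding y1[OF ij] using ij by (simp add: x_def)
    also have "C.rs T \<dots> = a i j" using T(1) by (simp add: C.rs_rs)
    finally show ?thesis ..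
  qed
  thus ?thesis unfolding positive_matrix_def by blast
qed

lemma positive_matrix_iff_psd: "positive_matrix mul star n a \<longleftrightarrow> psd n a"
  using positive_matrix_imp_psd psd_imp_positive_matrix by blast

lemma completely_positive_iff:
  "completely_positive mul star K \<longleftrightarrow> (\<forall>n a. psd n a \<longrightarrow> psd n (\<lambda>i j. K (a i j)))"
  by (simp add: completely_positive_def positive_matrix_iff_psd)

lemma completely_positive_comp:
  "completely_positive mul star S \<Longrightarrow> completely_positive mul star T \<Longrightarrow> completely_positive mul star (\<lambda>x. S (T x))"
  by (simp add: completely_positive_def)

lemma completely_positive_automorphism:
  assumes "\<alpha> \<in> star_automorphisms scaleE mul star" shows "completely_positive mul star \<alpha>"
  unfolding completely_positive_def positive_matrix_def
proof (intro allI impI, elim exE)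
  fix n :: nat and a b assume b: "\<forall>i<n. \<forall>j<n. a i j = (\<Sum>k<n. star (b k i) \<odot> b k j)"
  have \<alpha>: "\<alpha> (x + y) = \<alpha> x + \<alpha> y" "\<alpha> (x \<odot> y) = \<alpha> x \<odot> \<alpha> y" "\<alpha> (star x) = star (\<alpha> x)" "\<alpha> (scaleE c x) = scaleE c (\<alpha> x)" for x y c
    using assms by (auto simp: star_automorphisms_def Vector_Spaces.linear_iff)
  have \<alpha>0: "\<alpha> 0 = 0" using \<alpha>(4)[of 0 0] by simp
  have \<alpha>sum: "\<alpha> (\<Sum>k\<in>A. f k) = (\<Sum>k\<in>A. \<alpha> (f k))" for f :: "nat \<Rightarrow> 'e" and A
    by (induction A rule: infinite_finite_induct) (simp_all add: \<alpha> \<alpha>0)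
  have "\<alpha> (a i j) = (\<Sum>k<n. star (\<alpha> (b k i)) \<odot> \<alpha> (b k j))" if "i < n" "j < n" for i j
  proof -
    have "\<alpha> (a i j) = \<alpha> (\<Sum>k<n. star (b k i) \<odot> b k j)" using b that by simp
    also have "\<dots> = (\<Sum>k<n. \<alpha> (star (b k i) \<odot> b k j))" by (rule \<alpha>sum)
    finally show ?thesis by (simp only: \<alpha>)
  qed
  thus "\<exists>b. \<forall>i<n. \<forall>j<n. \<alpha> (a i j) = (\<Sum>k<n. star (b k i) \<odot> b k j)"
    by (intro exI[of _ "\<lambda>k i. \<alpha> (b k i)"]) blast
qed

lemma completely_positive_combination:
  assumes S: "\<And>k. k \<in> A \<Longrightarrow> completely_positive mul star (S k)" and w: "\<And>k. k \<in> A \<Longrightarrow> w k \<ge> 0"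
  shows "completely_positive mul star (\<lambda>x. \<Sum>k\<in>A. w k *\<^sub>R S k x)"
  unfolding completely_positive_iff
proof (intro allI impI)
  fix n a assume "psd n a"
  hence p: "psd n (\<lambda>i j. S k (a i j))" if "k \<in> A" for k using S[OF that] by (simp add: completely_positive_iff)
  have R: "w *\<^sub>R x = C.rs w x" for w x by (simp add: C.rs_def dual.scale_of_real)
  have "ip n \<xi> (ap n (\<lambda>i j. \<Sum>k\<in>A. w k *\<^sub>R S k (a i j)) \<xi>) = (\<Sum>k\<in>A. C.rs (w k) (ip n \<xi> (ap n (\<lambda>i j. S k (a i j)) \<xi>)))" for \<xi>
  proof -
    have "ip n \<xi> (ap n (\<lambda>i j. \<Sum>k\<in>A. w k *\<^sub>R S k (a i j)) \<xi>)
        = (\<Sum>i<n. \<Sum>j<n. \<Sum>k\<in>A. C.rs (w k) (star (\<xi> i) \<odot> S k (a i j) \<odot> \<xi> j))"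
      unfolding ip_ap R by (simp add: alg.mul_sum C.mul_rs)
    also have "\<dots> = (\<Sum>i<n. \<Sum>k\<in>A. \<Sum>j<n. C.rs (w k) (star (\<xi> i) \<odot> S k (a i j) \<odot> \<xi> j))"
      by (rule sum.cong[OF refl], rule sum.swap)
    also have "\<dots> = (\<Sum>k\<in>A. \<Sum>i<n. \<Sum>j<n. C.rs (w k) (star (\<xi> i) \<odot> S k (a i j) \<odot> \<xi> j))"
      by (rule sum.swap)
    finally show ?thesis by (simp add: ip_ap C.rs_def dual.scale_sum_right)
  qed
  hence "C.pos (ip n \<xi> (ap n (\<lambda>i j. \<Sum>k\<in>A. w k *\<^sub>R S k (a i j)) \<xi>))" for \<xi>
    using p w by (auto intro!: C.pos_sum C.pos_rs simp: psd_def)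
  moreover have "star (\<Sum>k\<in>A. w k *\<^sub>R S k (a i j)) = (\<Sum>k\<in>A. w k *\<^sub>R S k (a j i))" if "i < n" "j < n" for i j
    using p that by (auto simp: alg.star_sum R C.star_rs psd_def intro!: sum.cong)
  ultimately show "psd n (\<lambda>i j. \<Sum>k\<in>A. w k *\<^sub>R S k (a i j))" by (simp add: psd_def)
qed

text \<open>
  Pass to a finer filter along which all bounded nets converge. There the involution and two-sided
  multiplication pass through the limit, hence so do the conditions in \<open>psd\<close>.
\<close>

theorem completely_positive_limit:
  assumes F: "(F :: 'i filter) \<noteq> bot" and S: "\<And>l. completely_positive mul star (S l)"
    and bd: "\<And>x l. norm (S l x) \<le> norm x" and lim: "\<And>x. wlim (\<lambda>l. S l x) (K x) F"
  shows "completely_positive mul star K"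
proof -
  obtain G where G: "G \<le> F" "G \<noteq> bot"
    and univ: "\<And>(b :: 'i \<Rightarrow> 'e) B. (\<And>i. norm (b i) \<le> B) \<Longrightarrow> \<exists>r. wlim b r G"
    using universal_filter[OF F] by blast
  have U: "universal_limit scaleP scaleE pairing mul star e G"
    by unfold_locales (use G univ in auto)
  interpret U: universal_limit scaleP scaleE pairing mul star e G by (rule U)
  have limG: "wlim (\<lambda>l. S l x) (K x) G" for x by (rule wlim_mono[OF lim G(1)])
  have RK: "U.net_limit (\<lambda>l. S l x) = K x" for x by (rule U.net_limit_eqI[OF limG])
  show ?thesis unfolding completely_positive_iff
  proof (intro allI impI)
    fix n a assume a: "psd n a"
    have p: "psd n (\<lambda>i j. S l (a i j))" for l using S[of l] a by (simp add: completely_positive_iff)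
    have "star (K (a i j)) = K (a j i)" if "i < n" "j < n" for i j
    proof -
      have "star (K (a i j)) = U.net_limit (\<lambda>l. star (S l (a i j)))"
        unfolding RK[symmetric] by (rule U.net_limit_star[symmetric, OF U.bddI[OF bd]])
      also have "(\<lambda>l. star (S l (a i j))) = (\<lambda>l. S l (a j i))" using p that by (simp add: psd_def)
      finally show ?thesis by (simp only: RK)
    qed
    moreover have "C.pos (ip n \<xi> (ap n (\<lambda>i j. K (a i j)) \<xi>))" for \<xi>
    proof (rule wlim_pos[OF _ G(2)])
      show "wlim (\<lambda>l. ip n \<xi> (ap n (\<lambda>i j. S l (a i j)) \<xi>)) (ip n \<xi> (ap n (\<lambda>i j. K (a i j)) \<xi>)) G"
        unfolding ip_ap by (intro wlim_sum wlim_two_sided[OF U bd limG])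
      show "norm (ip n \<xi> (ap n (\<lambda>i j. S l (a i j)) \<xi>)) \<le> (\<Sum>i<n. \<Sum>j<n. norm (star (\<xi> i)) * norm (a i j) * norm (\<xi> j))" for l
        unfolding ip_ap by (intro order_trans[OF norm_sum] sum_mono alg.N_mul_mono order_refl bd)
      show "C.pos (ip n \<xi> (ap n (\<lambda>i j. S l (a i j)) \<xi>))" for l using p[of l] by (simp add: psd_def)
    qed
    ultimately show "psd n (\<lambda>i j. K (a i j))" by (simp add: psd_def)
  qed
qed

end

section \<open>The projection onto the harmonic elements\<close>

text \<open>
  By \<open>average_approx\<close>, the operator is the limit, in the point-weak* topology, of convex combinations
  of automorphisms. The approximants are indexed by a finite set of predual elements and a
  precision.
\<close>

lemma completely_positive_average:
  fixes scaleQ :: "complex \<Rightarrow> 'q::banach \<Rightarrow> 'q"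
    and scaleW :: "complex \<Rightarrow> 'w::banach \<Rightarrow> 'w"
    and repQ :: "'g::{topological_group_add,t2_space,second_countable_topology} \<Rightarrow> 'q \<Rightarrow> 'q"
  assumes "unital_wstar_algebra scaleQ scaleW pairingW mul star e"
    and "averaged_representation scaleQ scaleW pairingW repQ \<mu>"
    and aut: "\<And>g. adjoint_rep pairingW repQ g \<in> star_automorphisms scaleW mul star"
  shows "completely_positive mul star (averaged_operator pairingW (adjoint_rep pairingW repQ) \<mu>)"
proof -
  interpret A: unital_wstar_algebra scaleQ scaleW pairingW mul star e by fact
  interpret V: averaged_representation scaleQ scaleW pairingW repQ \<mu> by fact
  let ?\<pi> = "adjoint_rep pairingW repQ"
  let ?P = "averaged_operator pairingW ?\<pi> \<mu>"
  have "\<exists>S. completely_positive mul star S \<and> (\<forall>x. norm (S x) \<le> norm x) \<and>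
      (\<forall>p\<in>Q. \<forall>x. norm (pairingW p (?P x - S x)) \<le> 1 / real (Suc n) * norm x)" if Q: "finite Q" for Q :: "'q set" and n :: nat
  proof -
    obtain m :: nat and w :: "nat \<Rightarrow> real" and h where w: "\<forall>k. w k \<ge> 0" "(\<Sum>k<m. w k) = 1"
      and approx: "\<forall>p\<in>Q. \<forall>x. norm (pairingW p (?P x - (\<Sum>k<m. w k *\<^sub>R ?\<pi> (h k) x))) \<le> 1 / real (Suc n) * norm x"
      using V.average_approx[OF Q, of "1 / real (Suc n)"] by auto
    let ?S = "\<lambda>x. \<Sum>k<m. w k *\<^sub>R ?\<pi> (h k) x"
    have "completely_positive mul star ?S"
      using w(1) by (intro A.completely_positive_combination A.completely_positive_automorphism aut) auto
    moreover have "norm (?S x) \<le> norm x" for x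
    proof -
      have "norm (?S x) \<le> (\<Sum>k<m. w k * norm x)"
        using w(1) V.norm_adjoint_le by (intro order_trans[OF norm_sum sum_mono]) (simp add: mult_left_mono)
      also have "\<dots> = norm x" using w(2) by (simp flip: sum_distrib_right)
      finally show ?thesis .
    qed
    ultimately show ?thesis using approx by blast
  qed
  then obtain S where S: "\<And>Q n. finite Q \<Longrightarrow> completely_positive mul star (S Q n)"
      "\<And>Q n x. finite Q \<Longrightarrow> norm (S Q n x) \<le> norm x"
      "\<And>Q n p x. finite Q \<Longrightarrow> p \<in> Q \<Longrightarrow> norm (pairingW p (?P x - S Q n x)) \<le> 1 / real (Suc n) * norm x"
    by metis
  define C where "C = (\<lambda>(Q, n::nat). if finite Q then S Q n else (\<lambda>x. x))"
  define F where "F = finite_subsets_at_top (UNIV :: 'q set) \<times>\<^sub>F (sequentially :: nat filter)"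
  have "F \<noteq> bot" by (simp add: F_def prod_filter_eq_bot)
  moreover have "completely_positive mul star (C z)" for z
    by (cases z) (auto simp: C_def S completely_positive_def[of _ _ "\<lambda>x. x"])
  moreover have "norm (C z x) \<le> norm x" for x z
    by (cases z) (simp add: C_def S)
  moreover have "A.wlim (\<lambda>z. C z x) (?P x) F" for x
    unfolding A.wlim_def
  proof (intro allI tendstoI)
    fix p and \<epsilon> :: real assume "\<epsilon> > 0"
    hence "\<epsilon> / (norm x + 1) > 0" by (simp add: add_nonneg_pos)
    then obtain m where m: "1 / real (Suc m) < \<epsilon> / (norm x + 1)" using nat_approx_posE by metis
    have "eventually (\<lambda>z. (finite (fst z) \<and> p \<in> fst z) \<and> m \<le> snd z) F"
      unfolding F_def
    proof (rule eventually_prodI)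
      show "\<forall>\<^sub>F Q in finite_subsets_at_top UNIV. finite Q \<and> p \<in> Q"
        unfolding eventually_finite_subsets_at_top by (intro exI[of _ "{p}"]) auto
    qed (rule eventually_ge_at_top)
    thus "\<forall>\<^sub>F z in F. dist (pairingW p (C z x)) (pairingW p (?P x)) < \<epsilon>"
    proof eventually_elim
      case (elim z)
      obtain Q n where z: "z = (Q, n)" by (cases z)
      have "norm (pairingW p (?P x - S Q n x)) \<le> 1 / real (Suc n) * norm x" using S(3) elim z by auto
      also have "\<dots> \<le> 1 / real (Suc m) * norm x"
        using elim z by (intro mult_right_mono) (auto simp: frac_le)
      also have "\<dots> \<le> 1 / real (Suc m) * (norm x + 1)" by (intro mult_left_mono) auto
      also have "\<dots> < \<epsilon>" using m by (simp add: less_divide_eq add_nonneg_pos)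
      finally show ?case using elim z by (simp add: C_def dist_norm norm_minus_commute A.pairing_diff_right)
    qed
  qed
  ultimately show ?thesis by (rule A.completely_positive_limit)
qed

lemma completely_positive_ergodic_limit:
  fixes scaleQ :: "complex \<Rightarrow> 'q::banach \<Rightarrow> 'q"
    and scaleW :: "complex \<Rightarrow> 'w::banach \<Rightarrow> 'w"
    and repQ :: "'g::{topological_group_add,t2_space,second_countable_topology} \<Rightarrow> 'q \<Rightarrow> 'q"
  assumes "wstar_algebra scaleQ scaleW pairingW mul star"
    and "averaged_representation scaleQ scaleW pairingW repQ \<mu>"
    and aut: "\<And>g. adjoint_rep pairingW repQ g \<in> star_automorphisms scaleW mul star"
    and nontrivial: "\<exists>x :: 'w. x \<noteq> 0"
    and G: "G \<noteq> bot"
    and lim: "\<And>x. banach_predual.wlim pairingW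
      (\<lambda>n. averaged_representation.cesaro pairingW repQ \<mu> n x) (K x) G"
  shows "completely_positive mul star K"
proof -
  interpret W: wstar_algebra scaleQ scaleW pairingW mul star by fact
  obtain e where "W.unit_of_algebra e" using W.unit_exists by blast
  then interpret A: unital_wstar_algebra scaleQ scaleW pairingW mul star e
    using nontrivial by unfold_locales
  interpret V: averaged_representation scaleQ scaleW pairingW repQ \<mu> by fact
  have P: "completely_positive mul star V.P"
    by (rule completely_positive_average[OF A.unital_wstar_algebra_axioms assms(2) aut])
  have "completely_positive mul star (V.P ^^ k)" for k
  proof (induction k)
    case 0
    show ?case by (simp add: completely_positive_def id_def)
  next
    case (Suc k)
    thus ?case using A.completely_positive_comp[OF P Suc] by (simp add: o_def)
  qed
  hence "completely_positive mul star (\<lambda>x. \<Sum>k<Suc n. (1 / real (Suc n)) *\<^sub>R (V.P ^^ k) x)" for n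
    by (intro A.completely_positive_combination) auto
  hence "completely_positive mul star (V.cesaro n)" for n
    by (simp only: V.cesaro_def[abs_def] scaleR_right.sum)
  thus ?thesis by (rule A.completely_positive_limit[OF G _ V.norm_cesaro_le lim])
qed

theorem theorem7p4:
  fixes \<mu> :: "'g::{topological_group_add,t2_space,second_countable_topology} measure"
    and scaleP :: "'k::{real_normed_field,euclidean_space} \<Rightarrow> 'p::banach \<Rightarrow> 'p"
    and scaleE :: "'k \<Rightarrow> 'e::banach \<Rightarrow> 'e"
    and pairing :: "'p \<Rightarrow> 'e \<Rightarrow> 'k"
    and rep :: "'g \<Rightarrow> 'p \<Rightarrow> 'p"
    and scaleQ :: "complex \<Rightarrow> 'q::banach \<Rightarrow> 'q"
    and scaleW :: "complex \<Rightarrow> 'w::banach \<Rightarrow> 'w"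
    and pairingW :: "'q \<Rightarrow> 'w \<Rightarrow> complex"
    and repQ :: "'g \<Rightarrow> 'q \<Rightarrow> 'q"
    and mul :: "'w \<Rightarrow> 'w \<Rightarrow> 'w" and star :: "'w \<Rightarrow> 'w"
  assumes "locally_compact_space (euclidean :: 'g topology)"
    and "prob_space \<mu>" and "sets \<mu> = sets borel"
  shows
    "(banach_predual scaleP scaleE pairing \<and>
      separable_space (euclidean :: 'p topology) \<and>
      strongly_continuous_isometric_rep scaleP rep \<and>
      harmonic_elements pairing (adjoint_rep pairing rep) \<mu> \<noteq> {0} \<longrightarrow>
      (\<exists>K. norm_one_projection_onto scaleE (harmonic_elements pairing (adjoint_rep pairing rep) \<mu>) K \<and>
        (\<forall>T. Vector_Spaces.linear scaleE scaleE T \<and> weak_star_continuous pairing T \<and>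
             commutes_with_rep (adjoint_rep pairing rep) T \<longrightarrow> K \<circ> T = T \<circ> K)))
     \<and>
     (wstar_algebra scaleQ scaleW pairingW mul star \<and>
      separable_space (euclidean :: 'q topology) \<and>
      strongly_continuous_isometric_rep scaleQ repQ \<and>
      (\<forall>g. adjoint_rep pairingW repQ g \<in> star_automorphisms scaleW mul star) \<and>
      harmonic_elements pairingW (adjoint_rep pairingW repQ) \<mu> \<noteq> {0} \<longrightarrow>
      (\<exists>K. norm_one_projection_onto scaleW (harmonic_elements pairingW (adjoint_rep pairingW repQ) \<mu>) K \<and>
        (\<forall>T. Vector_Spaces.linear scaleW scaleW T \<and> weak_star_continuous pairingW T \<and>
             commutes_with_rep (adjoint_rep pairingW repQ) T \<longrightarrow> K \<circ> T = T \<circ> K) \<and>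
        completely_positive mul star K))"
proof (intro conjI impI)
  assume *: "banach_predual scaleP scaleE pairing \<and> separable_space (euclidean :: 'p topology) \<and>
      strongly_continuous_isometric_rep scaleP rep \<and>
      harmonic_elements pairing (adjoint_rep pairing rep) \<mu> \<noteq> {0}"
  have "averaged_representation scaleP scaleE pairing rep \<mu>"
    using * assms by (intro averaged_representation.intro averaged_representation_axioms.intro) auto
  then interpret V: averaged_representation scaleP scaleE pairing rep \<mu> .
  show "\<exists>K. norm_one_projection_onto scaleE (harmonic_elements pairing (adjoint_rep pairing rep) \<mu>) K \<and>
        (\<forall>T. Vector_Spaces.linear scaleE scaleE T \<and> weak_star_continuous pairing T \<and>
             commutes_with_rep (adjoint_rep pairing rep) T \<longrightarrow> K \<circ> T = T \<circ> K)"
    using V.mean_ergodic_projection * by metis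
next
  assume *: "wstar_algebra scaleQ scaleW pairingW mul star \<and> separable_space (euclidean :: 'q topology) \<and>
      strongly_continuous_isometric_rep scaleQ repQ \<and>
      (\<forall>g. adjoint_rep pairingW repQ g \<in> star_automorphisms scaleW mul star) \<and>
      harmonic_elements pairingW (adjoint_rep pairingW repQ) \<mu> \<noteq> {0}"
  then interpret W: wstar_algebra scaleQ scaleW pairingW mul star by blast
  have avg: "averaged_representation scaleQ scaleW pairingW repQ \<mu>"
    using * assms W.banach_predual_axioms
    by (intro averaged_representation.intro averaged_representation_axioms.intro) auto
  then interpret V: averaged_representation scaleQ scaleW pairingW repQ \<mu> .
  from * have H: "harmonic_elements pairingW V.\<pi> \<mu> \<noteq> {0}" by blast
  have "0 \<in> harmonic_elements pairingW V.\<pi> \<mu>" by (simp add: harmonic_elements_def)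
  with H have nontrivial: "\<exists>x. (x :: 'w) \<noteq> 0" by auto
  from H obtain K G where K: "G \<noteq> bot" "\<And>x. W.wlim (\<lambda>n. V.cesaro n x) (K x) G"
      "norm_one_projection_onto scaleW (harmonic_elements pairingW V.\<pi> \<mu>) K"
      "\<And>T. Vector_Spaces.linear scaleW scaleW T \<Longrightarrow> weak_star_continuous pairingW T \<Longrightarrow>
         commutes_with_rep V.\<pi> T \<Longrightarrow> K \<circ> T = T \<circ> K"
    using V.mean_ergodic_projection by metis
  have "completely_positive mul star K"
    by (rule completely_positive_ergodic_limit[OF W.wstar_algebra_axioms avg _ nontrivial K(1,2)]) (use * in blast)
  thus "\<exists>K. norm_one_projection_onto scaleW (harmonic_elements pairingW (adjoint_rep pairingW repQ) \<mu>) K \<and>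
        (\<forall>T. Vector_Spaces.linear scaleW scaleW T \<and> weak_star_continuous pairingW T \<and>
             commutes_with_rep (adjoint_rep pairingW repQ) T \<longrightarrow> K \<circ> T = T \<circ> K) \<and>
        completely_positive mul star K"
    using K(3,4) by blast
qed

end
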